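(* Let $n\geq 2$ and let $g_1$ and $g_2$ be two simple Riemannian metrics on the closed unit ball $\mathbb{D}^{n}$ whose first fundamental forms on $\mathbb{S}^{n-1}$ agree (i.e. $g_1$ and $g_2$ induce the same Riemannian metric on $\mathbb{S}^{n-1}$). If the broken scattering relations of $g_1$ and $g_2$ coincide, i.e. $\mathcal{B}^{1}_T=\mathcal{B}^{2}_T$ as relations on $B\mathbb{S}^{n-1}$ for every $T>0$, then there exists a smooth Riemannian isometry $\Psi\colon(\mathbb{D}^{n},g_1)\to(\mathbb{D}^{n},g_2)$ whose restriction to $\mathbb{S}^{n-1}$ is the identity map.
   Context: A compact Riemannian manifold with boundary is simple if its boundary is strictly convex and the exponential map at each point is a diffeomorphism onto the manifold from its domain of definition. For a metric $g$ on $\mathbb{D}^{n}$: $S\mathbb{D}^{n}$ is the unit sphere bundle, $\pi$ the base point projection, $\nu$ the inward unit normal on $\mathbb{S}^{n-1}$, $\phi_t(\eta)=(\gamma_\eta(t),\dot\gamma_\eta(t))$ the geodesic flow ($\gamma_\eta$ the geodesic with initial data $\eta$), $\partial_{\mathrm{in}}S\mathbb{D}^{n}=\{v\in S\mathbb{D}^{n}:\pi(v)\in\mathbb{S}^{n-1},\ \langle v,\nu\rangle_g>0\}$, $B\mathbb{S}^{n-1}=\{\xi\in T\mathbb{S}^{n-1}:|\xi|<1\}$ (depending only on the boundary metric), and $N_{\mathrm{in}}\colon\partial_{\mathrm{in}}S\mathbb{D}^{n}\to B\mathbb{S}^{n-1}$, $N_{\mathrm{in}}(\xi)=\xi-\langle\xi,\nu\rangle_g\nu$,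 a diffeomorphism. For $T>0$ the broken scattering relation $\mathcal{B}_T$ on $B\mathbb{S}^{n-1}$ is: $v_1\mathcal{B}_T v_2$ iff there exist $t_1,t_2>0$ with $t_1+t_2=T$ and $\pi(\phi_{t_1}(N_{\mathrm{in}}^{-1}v_1))=\pi(\phi_{t_2}(N_{\mathrm{in}}^{-1}v_2))$ (with the geodesics staying in $\mathbb{D}^n$). *)

theory Defs
  imports "HOL-Analysis.Analysis"
begin

text \<open>Riemannian metrics on the closed unit ball D = cball 0 1 in real^'n, given in the
 global Euclidean chart as matrix-valued functions g x (symmetric positive definite).\<close>

primrec sm_Ck :: "nat \<Rightarrow> ('a::real_normed_vector) set \<Rightarrow> ('a \<Rightarrow> 'b::real_normed_vector) \<Rightarrow> bool" where
  "sm_Ck 0 U f = continuous_on U f"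
| "sm_Ck (Suc k) U f = (\<exists>f'. (\<forall>x\<in>U. (f has_derivative f' x) (at x)) \<and>
                               (\<forall>h. sm_Ck k U (\<lambda>x. f' x h)) \<and> continuous_on U f)"

definition sm_smooth_on :: "('a::real_normed_vector) set \<Rightarrow> ('a \<Rightarrow> 'b::real_normed_vector) \<Rightarrow> bool" where
  "sm_smooth_on A f \<longleftrightarrow> (\<forall>p\<in>A. \<exists>U F. open U \<and> p \<in> U \<and> (\<forall>k. sm_Ck k U F) \<and>
                                       (\<forall>y\<in>A \<inter> U. F y = f y))"

definition sm_diffeo :: "('a::real_normed_vector \<Rightarrow> 'b::real_normed_vector) \<Rightarrow> 'a set \<Rightarrow> 'b set \<Rightarrow> bool" where
  "sm_diffeo f A B \<longleftrightarrow> bij_betw f A B \<and> sm_smooth_on A f \<and> sm_smooth_on B (inv_into A f)"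

type_synonym 'n rmetric = "real^'n \<Rightarrow> real^'n^'n"

definition gip :: "'n::finite rmetric \<Rightarrow> real^'n \<Rightarrow> real^'n \<Rightarrow> real^'n \<Rightarrow> real" where
  "gip g x u v = u \<bullet> (g x *v v)"

definition riem_metric :: "'n::finite rmetric \<Rightarrow> bool" where
  "riem_metric g \<longleftrightarrow> sm_smooth_on (cball 0 1) g \<and>
     (\<forall>x\<in>cball 0 1. transpose (g x) = g x \<and> (\<forall>v. v \<noteq> 0 \<longrightarrow> gip g x v v > 0))"

text \<open>Derivative of the metric (within D; unique since D is convex with nonempty interior).\<close>
definition mderiv :: "'n::finite rmetric \<Rightarrow> real^'n \<Rightarrow> real^'n \<Rightarrow> real^'n^'n" where
  "mderiv g x = frechet_derivative g (at x within cball 0 1)"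

text \<open>Lowered Christoffel term Gamma_k(w,w) = (Dg[w] w)_k - 1/2 w.(d_k g) w.\<close>
definition chr :: "'n::finite rmetric \<Rightarrow> real^'n \<Rightarrow> real^'n \<Rightarrow> real^'n" where
  "chr g x w = (mderiv g x w) *v w - (\<chi> i. (1/2) * (w \<bullet> (mderiv g x (axis i 1) *v w)))"

definition rgeodesic :: "'n::finite rmetric \<Rightarrow> (real \<Rightarrow> real^'n) \<Rightarrow> (real \<Rightarrow> real^'n) \<Rightarrow> real \<Rightarrow> real \<Rightarrow> bool" where
  "rgeodesic g \<gamma> \<gamma>' a b \<longleftrightarrow> a < b \<and> (\<exists>\<gamma>''. \<forall>t\<in>{a..b}.
      \<gamma> t \<in> cball 0 1 \<and>
      (\<gamma> has_vector_derivative \<gamma>' t) (at t within {a..b}) \<and>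
      (\<gamma>' has_vector_derivative \<gamma>'' t) (at t within {a..b}) \<and>
      g (\<gamma> t) *v \<gamma>'' t + chr g (\<gamma> t) (\<gamma>' t) = 0)"

definition flow_point :: "'n::finite rmetric \<Rightarrow> real^'n \<Rightarrow> real^'n \<Rightarrow> real \<Rightarrow> real^'n \<Rightarrow> bool" where
  "flow_point g x v t p \<longleftrightarrow> (\<exists>\<gamma> \<gamma>'. rgeodesic g \<gamma> \<gamma>' 0 t \<and> \<gamma> 0 = x \<and> \<gamma>' 0 = v \<and> \<gamma> t = p)"

definition inward_normal :: "'n::finite rmetric \<Rightarrow> real^'n \<Rightarrow> real^'n" where
  "inward_normal g x = (THE \<nu>. gip g x \<nu> \<nu> = 1 \<and> \<nu> \<bullet> x < 0 \<and> (\<forall>w. w \<bullet> x = 0 \<longrightarrow> gip g x w \<nu> = 0))"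

text \<open>Second fundamental form of the unit sphere w.r.t. the inward normal:
  II(w,w) = <nabla_c' c', nu>_g for the Euclidean great circle c with c(0)=x, c'(0)=w.\<close>
definition sff :: "'n::finite rmetric \<Rightarrow> real^'n \<Rightarrow> real^'n \<Rightarrow> real" where
  "sff g x w = inward_normal g x \<bullet> chr g x w - (w \<bullet> w) * gip g x x (inward_normal g x)"

definition strictly_convex_boundary :: "'n::finite rmetric \<Rightarrow> bool" where
  "strictly_convex_boundary g \<longleftrightarrow>
     (\<forall>x\<in>sphere 0 1. \<forall>w. w \<bullet> x = 0 \<and> w \<noteq> 0 \<longrightarrow> sff g x w > 0)"

definition exp_dom :: "'n::finite rmetric \<Rightarrow> real^'n \<Rightarrow> (real^'n) set" where
  "exp_dom g x = {v. \<exists>p. flow_point g x v 1 p}"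

definition expm :: "'n::finite rmetric \<Rightarrow> real^'n \<Rightarrow> real^'n \<Rightarrow> real^'n" where
  "expm g x v = (SOME p. flow_point g x v 1 p)"

definition simple_metric :: "'n::finite rmetric \<Rightarrow> bool" where
  "simple_metric g \<longleftrightarrow> riem_metric g \<and> strictly_convex_boundary g \<and>
     (\<forall>x\<in>cball 0 1. sm_diffeo (expm g x) (exp_dom g x) (cball 0 1))"

definition in_boundary :: "'n::finite rmetric \<Rightarrow> ((real^'n) \<times> (real^'n)) set" where
  "in_boundary g = {(x, v). x \<in> sphere 0 1 \<and> gip g x v v = 1 \<and> gip g x v (inward_normal g x) > 0}"

definition N_in :: "'n::finite rmetric \<Rightarrow> (real^'n) \<times> (real^'n) \<Rightarrow> (real^'n) \<times> (real^'n)" where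
  "N_in g \<eta> = (fst \<eta>, snd \<eta> - gip g (fst \<eta>) (snd \<eta>) (inward_normal g (fst \<eta>)) *\<^sub>R inward_normal g (fst \<eta>))"

definition BS :: "'n::finite rmetric \<Rightarrow> ((real^'n) \<times> (real^'n)) set" where
  "BS g = {(x, \<xi>). x \<in> sphere 0 1 \<and> \<xi> \<bullet> x = 0 \<and> gip g x \<xi> \<xi> < 1}"

text \<open>Since N_in is a bijection, "N_in^-1 v1 = eta1" is expressed as "eta1 in in_boundary, N_in eta1 = v1".\<close>
definition broken_scattering :: "'n::finite rmetric \<Rightarrow> real \<Rightarrow> (real^'n) \<times> (real^'n) \<Rightarrow> (real^'n) \<times> (real^'n) \<Rightarrow> bool" where
  "broken_scattering g T v1 v2 \<longleftrightarrow> v1 \<in> BS g \<and> v2 \<in> BS g \<and>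
     (\<exists>t1 t2 \<eta>1 \<eta>2 p. t1 > 0 \<and> t2 > 0 \<and> t1 + t2 = T \<and>
        \<eta>1 \<in> in_boundary g \<and> N_in g \<eta>1 = v1 \<and> \<eta>2 \<in> in_boundary g \<and> N_in g \<eta>2 = v2 \<and>
        flow_point g (fst \<eta>1) (snd \<eta>1) t1 p \<and> flow_point g (fst \<eta>2) (snd \<eta>2) t2 p)"

definition same_boundary_metric :: "'n::finite rmetric \<Rightarrow> 'n rmetric \<Rightarrow> bool" where
  "same_boundary_metric g1 g2 \<longleftrightarrow> (\<forall>x\<in>sphere 0 1. \<forall>u v. u \<bullet> x = 0 \<and> v \<bullet> x = 0 \<longrightarrow>
      gip g1 x u v = gip g2 x u v)"

definition riem_isometry :: "'n::finite rmetric \<Rightarrow> 'n rmetric \<Rightarrow> (real^'n \<Rightarrow> real^'n) \<Rightarrow> bool" where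
  "riem_isometry g1 g2 \<Psi> \<longleftrightarrow> sm_diffeo \<Psi> (cball 0 1) (cball 0 1) \<and>
     (\<forall>x\<in>cball 0 1. \<forall>u v. gip g1 x u v =
        gip g2 (\<Psi> x) (frechet_derivative \<Psi> (at x within cball 0 1) u)
                      (frechet_derivative \<Psi> (at x within cball 0 1) v))"

end

theory Submission
  imports Defs
begin

text \<open>For a boundary point \<open>z\<close> let \<open>\<Psi>\<^sub>z\<close> carry the \<open>g\<^sub>1\<close>-geodesics issuing from \<open>z\<close> to the
  \<open>g\<^sub>2\<close>-geodesics with the same tangential initial data, preserving arc length. It is a diffeomorphism of the
  ball because \<open>exp\<^sub>z\<close> is one for both metrics and because \<open>v B\<^bsub>2t\<^esub> v\<close> records for how long a geodesic exists.
  The heart of the matter is that \<open>\<Psi>\<^sub>z\<close> does not depend on \<open>z\<close>. Fix an interior point \<open>p\<close>. By hypothesis, the images of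
  the geodesics from \<open>z\<close> and from \<open>x\<close> to \<open>p\<close> meet at a point with parameter \<open>\<sigma> x\<close> on the image of the first
  one, and the total lengths agree: \<open>d\<^sub>1(z,p) + d\<^sub>1(x,p) = \<sigma> x + d\<^sub>2(x, \<gamma>(\<sigma> x))\<close>. By the Gauss lemma both sides have
  the same gradient in \<open>x\<close> along the sphere when \<open>\<sigma> x\<close> is frozen, since the tangential directions agree; and
  \<open>s + d\<^sub>2(x, \<gamma> s)\<close> has positive derivative in \<open>s\<close> unless \<open>x\<close> is the exit point of \<open>\<gamma>\<close>. Hence \<open>\<sigma>\<close> is locally
  constant. So \<open>\<Psi> = \<Psi>\<^sub>z\<close> maps all geodesics to geodesics with unit speed preserved, which makes it an isometry,
  and it fixes the boundary since \<open>d\<^sub>2(x, \<Psi> p) = d\<^sub>1(x, p)\<close> for all boundary points \<open>x\<close>.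

  The smooth dependence of geodesics on all initial data is never used; joint continuity of directions is
  obtained from the strict triangle inequality.\<close>

section \<open>Smooth functions on sets with unique derivatives\<close>

text \<open>For a base point on the sphere the zero vector lies on the boundary of the exponential
  domain, which is closed. So calculus is done with derivatives within a set; full derivatives of
  the exponential map are used only over the open ball, and identities reach the sphere and time
  zero by limits. The parameter \<sigma> comes from a choice, with no regularity. Continuity is
  extracted first: every cluster value solves the same detour equation, which strict monotonicity
  makes uniquely solvable. Differentiability then follows from a lower bound on detour increments
  that is uniform in the boundary point and plays the role of an implicit function theorem; this
  bound is what joint continuity of directions is for. The exit point of \<gamma> is a genuine
  obstruction: there \<open>s + d(x, \<gamma> s)\<close> is constant in \<open>s\<close> and says
  nothing about the meeting point. A great circle arc avoiding it joins \<open>z\<close> to any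
  other \<open>x\<close>, so each base point leaves at most one exceptional boundary point, and
  exceptions disappear when two base points are compared at a third.\<close>

lemma sm_Ck_imp_continuous_on: "sm_Ck k U f \<Longrightarrow> continuous_on U f"
  by (cases k) auto

lemma sm_Ck_subset: "sm_Ck k U f \<Longrightarrow> V \<subseteq> U \<Longrightarrow> sm_Ck k V f"
proof (induction k arbitrary: f)
  case 0 then show ?case by (auto intro: continuous_on_subset)
next
  case (Suc k)
  then obtain f' where f': "\<forall>x\<in>U. (f has_derivative f' x) (at x)" "\<forall>h. sm_Ck k U (\<lambda>x. f' x h)" "continuous_on U f"
    by auto
  have "\<forall>h. sm_Ck k V (\<lambda>x. f' x h)" using Suc.IH Suc.prems(2) f'(2) by blast
  then show ?case using f' Suc.prems(2) by (auto intro!: exI[of _ f'] intro: continuous_on_subset)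
qed

lemma sm_Ck_Suc_imp: "sm_Ck (Suc k) U f \<Longrightarrow> sm_Ck k U f"
proof (induction k arbitrary: f)
  case 0 then show ?case by auto
next
  case (Suc k)
  then obtain f' where f': "\<forall>x\<in>U. (f has_derivative f' x) (at x)" "\<forall>h. sm_Ck (Suc k) U (\<lambda>x. f' x h)" "continuous_on U f"
    by (metis sm_Ck.simps(2))
  then have "\<forall>h. sm_Ck k U (\<lambda>x. f' x h)" using Suc.IH by blast
  then show ?case using f' by auto
qed

lemma sm_Ck_cong:
  assumes "open U" "\<And>x. x \<in> U \<Longrightarrow> f x = g x" "sm_Ck k U f"
  shows "sm_Ck k U g"
proof (cases k)
  case 0 with assms show ?thesis by (simp cong: continuous_on_cong)
next
  case (Suc j)
  then obtain f' where f': "\<forall>x\<in>U. (f has_derivative f' x) (at x)" "\<forall>h. sm_Ck j U (\<lambda>x. f' x h)" "continuous_on U f"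
    using assms by auto
  have "(g has_derivative f' x) (at x)" if "x \<in> U" for x
    using has_derivative_transform_within_open[of f "f' x" x UNIV U g] f'(1) that assms by auto
  moreover have "continuous_on U g" using f'(3) assms(2) by (simp cong: continuous_on_cong)
  ultimately show ?thesis using Suc f'(2) by auto
qed

lemma sm_Ck_const: "sm_Ck k U (\<lambda>x. c)"
proof (induction k arbitrary: c)
  case (Suc k)
  show ?case using Suc by (auto intro!: exI[of _ "\<lambda>x h. 0"])
qed auto

lemma sm_Ck_bounded_linear:
  assumes "bounded_linear f" shows "sm_Ck k U f"
proof (cases k)
  case 0 then show ?thesis using assms by (simp add: linear_continuous_on)
next
  case (Suc j)
  then show ?thesis using assms bounded_linear_imp_has_derivative[OF assms]
    by (auto intro!: exI[of _ "\<lambda>x. f"] simp: linear_continuous_on sm_Ck_const)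
qed

lemma sm_Ck_add: "sm_Ck k U f \<Longrightarrow> sm_Ck k U g \<Longrightarrow> sm_Ck k U (\<lambda>x. f x + g x)"
proof (induction k arbitrary: f g)
  case 0 then show ?case by (auto intro: continuous_intros)
next
  case (Suc k)
  from Suc.prems obtain f' g' where f': "\<forall>x\<in>U. (f has_derivative f' x) (at x)" "\<forall>h. sm_Ck k U (\<lambda>x. f' x h)" "continuous_on U f"
     and g': "\<forall>x\<in>U. (g has_derivative g' x) (at x)" "\<forall>h. sm_Ck k U (\<lambda>x. g' x h)" "continuous_on U g"
    by auto
  show ?case using f' g' Suc.IH
    by (auto intro!: exI[of _ "\<lambda>x h. f' x h + g' x h"] has_derivative_add continuous_intros)
qed

text \<open>The product rule leaves one factor undifferentiated, so the induction also needs
  \<open>f\<close> and \<open>g\<close> themselves at the lower order, which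
  \<open>sm_Ck_Suc_imp\<close> supplies.\<close>

lemma sm_Ck_bilinear:
  assumes "bounded_bilinear pr"
  shows "sm_Ck k U f \<Longrightarrow> sm_Ck k U g \<Longrightarrow> sm_Ck k U (\<lambda>x. pr (f x) (g x))"
proof (induction k arbitrary: f g)
  case 0 then show ?case using bounded_bilinear.continuous_on[OF assms] by auto
next
  case (Suc k)
  interpret bounded_bilinear pr by (rule assms)
  from Suc.prems obtain f' g' where f': "\<forall>x\<in>U. (f has_derivative f' x) (at x)" "\<forall>h. sm_Ck k U (\<lambda>x. f' x h)" "continuous_on U f"
     and g': "\<forall>x\<in>U. (g has_derivative g' x) (at x)" "\<forall>h. sm_Ck k U (\<lambda>x. g' x h)" "continuous_on U g"
    by auto
  have fg: "sm_Ck k U f" "sm_Ck k U g" using Suc.prems sm_Ck_Suc_imp by blast+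
  show ?case unfolding sm_Ck.simps
  proof (intro exI[of _ "\<lambda>x h. pr (f x) (g' x h) + pr (f' x h) (g x)"] conjI ballI allI)
    fix x assume "x \<in> U"
    then show "((\<lambda>x. pr (f x) (g x)) has_derivative (\<lambda>h. pr (f x) (g' x h) + pr (f' x h) (g x))) (at x)"
      using f' g' FDERIV by blast
  next
    fix h show "sm_Ck k U (\<lambda>x. pr (f x) (g' x h) + pr (f' x h) (g x))"
      by (intro sm_Ck_add Suc.IH fg f'(2)[rule_format] g'(2)[rule_format])
  next
    show "continuous_on U (\<lambda>x. pr (f x) (g x))" using f'(3) g'(3) by (rule continuous_on)
  qed
qed

lemma sm_Ck_sum: "(\<And>i. i \<in> I \<Longrightarrow> sm_Ck k U (f i)) \<Longrightarrow> sm_Ck k U (\<lambda>x. \<Sum>i\<in>I. f i x)"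
proof (induction I rule: infinite_finite_induct)
  case (insert i I)
  then have "sm_Ck k U (\<lambda>x. f i x + (\<Sum>i\<in>I. f i x))" by (intro sm_Ck_add) auto
  then show ?case using insert.hyps by simp
qed (simp_all add: sm_Ck_const)

lemma sm_Ck_compose:
  fixes f :: "'a::real_normed_vector \<Rightarrow> 'b::euclidean_space"
  assumes "open U"
  shows "sm_Ck k U f \<Longrightarrow> sm_Ck k V g \<Longrightarrow> f ` U \<subseteq> V \<Longrightarrow> sm_Ck k U (\<lambda>x. g (f x))"
proof (induction k arbitrary: f g)
  case 0 then show ?case by (auto intro: continuous_on_compose2)
next
  case (Suc k)
  from Suc.prems obtain f' g' where f': "\<forall>x\<in>U. (f has_derivative f' x) (at x)" "\<forall>h. sm_Ck k U (\<lambda>x. f' x h)" "continuous_on U f"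
     and g': "\<forall>x\<in>V. (g has_derivative g' x) (at x)" "\<forall>h. sm_Ck k V (\<lambda>x. g' x h)" "continuous_on V g"
    by auto
  have fk: "sm_Ck k U f" using Suc.prems sm_Ck_Suc_imp by blast
  show ?case unfolding sm_Ck.simps
  proof (intro exI[of _ "\<lambda>x h. g' (f x) (f' x h)"] conjI ballI allI)
    fix x assume "x \<in> U"
    then show "((\<lambda>x. g (f x)) has_derivative (\<lambda>h. g' (f x) (f' x h))) (at x)"
      using f'(1) g'(1) Suc.prems(3) has_derivative_compose[of f "f' x" x UNIV g "g' (f x)"] by auto
  next
    fix h
    \<comment> \<open>\<open>sm_Ck\<close> speaks only of derivatives in a fixed direction, whereas
      the chain rule puts the moving direction \<open>f' x h\<close> into \<open>g'\<close>.
      Expanding it in the basis gives fixed-direction derivatives with smooth coefficients; hence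
      the Euclidean middle space.\<close>
    have "sm_Ck k U (\<lambda>x. \<Sum>b\<in>Basis. (f' x h \<bullet> b) *\<^sub>R g' (f x) b)"
    proof (rule sm_Ck_sum)
      fix b :: 'b
      have 1: "sm_Ck k U (\<lambda>x. g' (f x) b)" by (rule Suc.IH[OF fk]) (use g' Suc.prems in auto)
      have 2: "sm_Ck k U (\<lambda>x. f' x h \<bullet> b)"
        by (rule sm_Ck_bilinear[OF bounded_bilinear_inner]) (auto simp: f' sm_Ck_const)
      show "sm_Ck k U (\<lambda>x. (f' x h \<bullet> b) *\<^sub>R g' (f x) b)"
        by (rule sm_Ck_bilinear[OF bounded_bilinear_scaleR 2 1])
    qed
    moreover have "(\<Sum>b\<in>Basis. (f' x h \<bullet> b) *\<^sub>R g' (f x) b) = g' (f x) (f' x h)" if "x \<in> U" for x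
    proof -
      have "linear (g' (f x))" using g'(1) that Suc.prems(3) has_derivative_linear by blast
      then have "g' (f x) (\<Sum>b\<in>Basis. (f' x h \<bullet> b) *\<^sub>R b) = (\<Sum>b\<in>Basis. (f' x h \<bullet> b) *\<^sub>R g' (f x) b)"
        by (simp add: linear_sum linear_cmul)
      then show ?thesis by (simp add: euclidean_representation)
    qed
    ultimately show "sm_Ck k U (\<lambda>x. g' (f x) (f' x h))" by (rule sm_Ck_cong[OF assms, rotated])
  next
    show "continuous_on U (\<lambda>x. g (f x))" using continuous_on_compose2[OF g'(3) f'(3) Suc.prems(3)] .
  qed
qed

section \<open>Smoothness on arbitrary sets through local extensions\<close>

lemma sm_smooth_on_subset: "sm_smooth_on A f \<Longrightarrow> B \<subseteq> A \<Longrightarrow> sm_smooth_on B f"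
  unfolding sm_smooth_on_def
proof
  fix p assume A: "\<forall>p\<in>A. \<exists>U F. open U \<and> p \<in> U \<and> (\<forall>k. sm_Ck k U F) \<and> (\<forall>y\<in>A \<inter> U. F y = f y)"
    and "B \<subseteq> A" "p \<in> B"
  then obtain U F where "open U" "p \<in> U" "\<forall>k. sm_Ck k U F" "\<forall>y\<in>A \<inter> U. F y = f y"
    by (meson subsetD)
  with \<open>B \<subseteq> A\<close> show "\<exists>U F. open U \<and> p \<in> U \<and> (\<forall>k. sm_Ck k U F) \<and> (\<forall>y\<in>B \<inter> U. F y = f y)"
    by (intro exI[of _ U] exI[of _ F]) auto
qed

lemma sm_smooth_on_bounded_linear: "bounded_linear f \<Longrightarrow> sm_smooth_on A f"
  unfolding sm_smooth_on_def using sm_Ck_bounded_linear[of f]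
  by (intro ballI exI[of _ UNIV] exI[of _ f]) auto

lemma sm_smooth_on_cong: "(\<And>x. x \<in> A \<Longrightarrow> f x = g x) \<Longrightarrow> sm_smooth_on A f \<Longrightarrow> sm_smooth_on A g"
  unfolding sm_smooth_on_def by simp

lemma sm_smooth_on_imp_continuous_on:
  assumes "sm_smooth_on A f" shows "continuous_on A f"
  unfolding continuous_on_eq_continuous_within
proof
  fix p assume p: "p \<in> A"
  then obtain U F where U: "open U" "p \<in> U" "\<forall>k. sm_Ck k U F" "\<forall>y\<in>A \<inter> U. F y = f y"
    using assms unfolding sm_smooth_on_def by blast
  have "continuous_on U F" using U(3) sm_Ck_imp_continuous_on[of 0 U F] by simp
  then have "isCont F p" using U continuous_on_eq_continuous_at by blast
  then have c: "continuous (at p within A) F" by (rule continuous_at_imp_continuous_within)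
  obtain e where "e > 0" "ball p e \<subseteq> U" using U openE by blast
  then show "continuous (at p within A) f"
    by (intro continuous_transform_within[OF c, of e]) (use U p in \<open>auto simp: dist_commute subset_eq\<close>)
qed

lemma sm_smooth_on_combine:
  fixes f :: "'a::real_normed_vector \<Rightarrow> 'b::real_normed_vector" and g :: "'a \<Rightarrow> 'c::real_normed_vector"
  assumes c: "\<And>k (U :: 'a set) F G. sm_Ck k U F \<Longrightarrow> sm_Ck k U G \<Longrightarrow> sm_Ck k U (\<lambda>x. c (F x) (G x))"
    and f: "sm_smooth_on A f" and g: "sm_smooth_on A g"
  shows "sm_smooth_on A (\<lambda>x. c (f x) (g x))"
  unfolding sm_smooth_on_def
proof
  fix p assume p: "p \<in> A"
  obtain U F where U: "open U" "p \<in> U" "\<forall>k. sm_Ck k U F" "\<forall>y\<in>A \<inter> U. F y = f y"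
    using f[unfolded sm_smooth_on_def, rule_format, OF p] by auto
  obtain V G where V: "open V" "p \<in> V" "\<forall>k. sm_Ck k V G" "\<forall>y\<in>A \<inter> V. G y = g y"
    using g[unfolded sm_smooth_on_def, rule_format, OF p] by auto
  have "sm_Ck k (U \<inter> V) (\<lambda>x. c (F x) (G x))" for k
    by (rule c[OF sm_Ck_subset[of k U] sm_Ck_subset[of k V]]) (use U V in auto)
  then show "\<exists>U F. open U \<and> p \<in> U \<and> (\<forall>k. sm_Ck k U F) \<and> (\<forall>y\<in>A \<inter> U. F y = c (f y) (g y))"
    using U V by (intro exI[of _ "U \<inter> V"] exI[of _ "\<lambda>x. c (F x) (G x)"]) auto
qed

lemma sm_smooth_on_bilinear:
  "bounded_bilinear pr \<Longrightarrow> sm_smooth_on A f \<Longrightarrow> sm_smooth_on A g \<Longrightarrow> sm_smooth_on A (\<lambda>x. pr (f x) (g x))"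
  by (rule sm_smooth_on_combine[OF sm_Ck_bilinear])

lemma sm_smooth_on_add: "sm_smooth_on A f \<Longrightarrow> sm_smooth_on A g \<Longrightarrow> sm_smooth_on A (\<lambda>x. f x + g x)"
  by (rule sm_smooth_on_combine[OF sm_Ck_add])

lemma sm_smooth_on_const: "sm_smooth_on A (\<lambda>x. c)"
  unfolding sm_smooth_on_def by (intro ballI exI[of _ UNIV] exI[of _ "\<lambda>x. c"]) (auto simp: sm_Ck_const)

lemma sm_smooth_on_sum:
  assumes "\<And>i. i \<in> I \<Longrightarrow> sm_smooth_on A (f i)" shows "sm_smooth_on A (\<lambda>x. \<Sum>i\<in>I. f i x)"
  using assms
proof (induction I rule: infinite_finite_induct)
  case (insert i I)
  then have "sm_smooth_on A (\<lambda>x. f i x + (\<Sum>i\<in>I. f i x))" by (intro sm_smooth_on_add) auto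
  then show ?case using insert.hyps by simp
qed (simp_all add: sm_smooth_on_const)

lemma sm_smooth_on_compose:
  fixes f :: "'a::real_normed_vector \<Rightarrow> 'b::euclidean_space"
  assumes f: "sm_smooth_on A f" and g: "sm_smooth_on B g" and AB: "f ` A \<subseteq> B"
  shows "sm_smooth_on A (\<lambda>x. g (f x))"
  unfolding sm_smooth_on_def
proof
  fix p assume p: "p \<in> A"
  obtain U F where U: "open U" "p \<in> U" "\<forall>k. sm_Ck k U F" "\<forall>y\<in>A \<inter> U. F y = f y"
    using f[unfolded sm_smooth_on_def, rule_format, OF p] by auto
  have fp: "f p \<in> B" using AB p by auto
  obtain V G where V: "open V" "f p \<in> V" "\<forall>k. sm_Ck k V G" "\<forall>y\<in>B \<inter> V. G y = g y"
    using g[unfolded sm_smooth_on_def, rule_format, OF fp] by auto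
  have cF: "continuous_on U F" using U(3) sm_Ck_imp_continuous_on[of 0 U F] by simp
  define W where "W = U \<inter> F -` V"
  have W: "open W" unfolding W_def using cF U(1) V(1) by (rule continuous_open_preimage)
  have "p \<in> W" unfolding W_def using U V p by auto
  moreover have "sm_Ck k W (\<lambda>x. G (F x))" for k
  proof (rule sm_Ck_compose[OF W])
    show "sm_Ck k W F" using U(3) sm_Ck_subset[of k U F W] by (simp add: W_def)
    show "sm_Ck k V G" using V(3) by simp
    show "F ` W \<subseteq> V" by (auto simp: W_def)
  qed
  moreover have "\<forall>y\<in>A \<inter> W. G (F y) = g (f y)" unfolding W_def using U V AB by auto
  ultimately show "\<exists>U F. open U \<and> p \<in> U \<and> (\<forall>k. sm_Ck k U F) \<and> (\<forall>y\<in>A \<inter> U. F y = g (f y))"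
    using W by (intro exI[of _ W] exI[of _ "\<lambda>x. G (F x)"]) auto
qed

text \<open>Every point of the set is the apex of a cone in the set over an open set of directions; this
  makes Frechet derivatives within the set unique, also on the boundary of a convex body.\<close>
definition cone_set :: "'a::real_normed_vector set \<Rightarrow> bool" where
  "cone_set A \<longleftrightarrow> (\<forall>x\<in>A. \<exists>V. open V \<and> V \<noteq> {} \<and>
     (\<forall>y\<in>V. \<exists>e>0. \<forall>t\<in>{0..e}. x + t *\<^sub>R (y - x) \<in> A))"

lemma cone_set_open: assumes "open A" shows "cone_set A"
  unfolding cone_set_def
proof (intro ballI exI[of _ A] conjI assms)
  fix x assume x: "x \<in> A" show "A \<noteq> {}" using x by auto
  fix y assume "y \<in> A"
  obtain e where e: "e > 0" "ball x e \<subseteq> A" using assms x openE by blast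
  define e' where "e' = e / (norm (y - x) + 1) / 2"
  have n: "norm (y - x) + 1 > 0" using norm_ge_zero[of "y-x"] by linarith
  have "e' > 0" unfolding e'_def using e n by simp
  moreover have "x + t *\<^sub>R (y - x) \<in> A" if "t \<in> {0..e'}" for t
  proof -
    have "t * norm (y - x) \<le> e' * (norm (y - x) + 1)" using that by (intro mult_mono) auto
    also have "\<dots> = e / 2" unfolding e'_def using n by (simp add: field_simps)
    finally have "t * norm (y - x) < e" using e by linarith
    then have "x + t *\<^sub>R (y - x) \<in> ball x e" using that by (simp add: dist_norm)
    then show ?thesis using e by blast
  qed
  ultimately show "\<exists>e>0. \<forall>t\<in>{0..e}. x + t *\<^sub>R (y - x) \<in> A" by blast
qed

lemma cone_set_convex: assumes "convex A" "interior A \<noteq> {}" shows "cone_set A"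
  unfolding cone_set_def
proof (intro ballI exI[of _ "interior A"] conjI open_interior assms)
  fix x y assume x: "x \<in> A" and "y \<in> interior A"
  then have y: "y \<in> A" using interior_subset by blast
  have "x + t *\<^sub>R (y - x) \<in> A" if "t \<in> {0..1}" for t
  proof -
    have "(1 - t) *\<^sub>R x + t *\<^sub>R y \<in> A" using assms(1) x y that unfolding convex_alt by auto
    then show ?thesis by (simp add: algebra_simps)
  qed
  then show "\<exists>e>0. \<forall>t\<in>{0..e}. x + t *\<^sub>R (y - x) \<in> A" by (intro exI[of _ 1]) auto
qed

text \<open>Towards each \<open>y\<close> in the open set \<open>V\<close> there is a segment in
  \<open>A\<close>, along which both candidates compute the same one-sided derivative, so they agree
  at \<open>y - x\<close>. Any vector is a multiple of a difference of two such directions, and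
  linearity does the rest.\<close>

lemma cone_set_has_derivative_unique:
  fixes f :: "'a::real_normed_vector \<Rightarrow> 'b::real_normed_vector"
  assumes "cone_set A" "x \<in> A" and A: "(f has_derivative F) (at x within A)" and B: "(f has_derivative G) (at x within A)"
  shows "F = G"
proof
  fix w :: 'a
  obtain V where V: "open V" "V \<noteq> {}" "\<forall>y\<in>V. \<exists>e>0. \<forall>t\<in>{0..e}. x + t *\<^sub>R (y - x) \<in> A"
    using assms(1,2) unfolding cone_set_def by blast
  have lF: "linear F" and lG: "linear G" using A B has_derivative_linear by auto
  have eq: "F (y - x) = G (y - x)" if y: "y \<in> V" for y
  proof -
    obtain e where e: "e > 0" "\<forall>t\<in>{0..e}. x + t *\<^sub>R (y - x) \<in> A" using V y by blast
    define c where "c = (\<lambda>t. x + t *\<^sub>R (y - x))"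
    have c: "(c has_derivative (\<lambda>t. t *\<^sub>R (y - x))) (at 0 within {0..e})"
      unfolding c_def by (auto intro!: derivative_eq_intros)
    have im: "c ` {0..e} \<subseteq> A" using e unfolding c_def by auto
    have c0: "c 0 = x" unfolding c_def by simp
    have "((\<lambda>t. f (c t)) has_vector_derivative H (y - x)) (at 0 within {0..e})"
      if H: "(f has_derivative H) (at x within A)" for H
    proof -
      have "(f has_derivative H) (at (c 0) within c ` {0..e})"
        using H im c0 has_derivative_subset by metis
      then have "((\<lambda>t. f (c t)) has_derivative (\<lambda>t. H (t *\<^sub>R (y - x)))) (at 0 within {0..e})"
        using c by (rule has_derivative_in_compose[rotated])
      then show ?thesis unfolding has_vector_derivative_def
        using has_derivative_linear[OF H] by (simp add: linear_cmul)
    qed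
    from this[OF A] this[OF B] show ?thesis
      using e by (intro vector_derivative_unique_within_closed_interval[of 0 e 0]) auto
  qed
  obtain y e where ye: "y \<in> V" "e > 0" "ball y e \<subseteq> V" using V openE by (metis all_not_in_conv)
  define s where "s = e / (norm w + 1) / 2"
  have n: "norm w + 1 > 0" using norm_ge_zero[of w] by linarith
  have s: "s > 0" unfolding s_def using ye n by simp
  have "s * norm w \<le> s * (norm w + 1)" using s by (intro mult_left_mono) auto
  also have "\<dots> = e / 2" unfolding s_def using n by (simp add: field_simps)
  finally have "s * norm w < e" using ye by linarith
  then have "y + s *\<^sub>R w \<in> V" using ye s by (auto simp: dist_norm subset_eq)
  then have "F ((y + s *\<^sub>R w - x) - (y - x)) = G ((y + s *\<^sub>R w - x) - (y - x))"
    using eq[OF \<open>y \<in> V\<close>] eq[of "y + s *\<^sub>R w"] linear_diff[OF lF, of "y + s *\<^sub>R w - x" "y - x"]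
      linear_diff[OF lG, of "y + s *\<^sub>R w - x" "y - x"] by simp
  then have "s *\<^sub>R F w = s *\<^sub>R G w" using lF lG by (simp add: linear_cmul)
  then show "F w = G w" using s by simp
qed

lemma sm_smooth_on_local_derivative:
  assumes "sm_smooth_on A f" "p \<in> A"
  obtains U F F' where "open U" "p \<in> U" "\<And>x. x \<in> U \<Longrightarrow> (F has_derivative F' x) (at x)"
    "\<And>x. x \<in> A \<inter> U \<Longrightarrow> (f has_derivative F' x) (at x within A)" 
    "\<And>h k. sm_Ck k U (\<lambda>x. F' x h)"
    "\<And>x. x \<in> A \<inter> U \<Longrightarrow> F x = f x"
proof -
  obtain U F where U: "open U" "p \<in> U" "\<forall>k. sm_Ck k U F" "\<forall>y\<in>A \<inter> U. F y = f y"
    using assms unfolding sm_smooth_on_def by blast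
  have "sm_Ck (Suc 0) U F" using U by blast
  then obtain F' where F': "\<forall>x\<in>U. (F has_derivative F' x) (at x)" by auto
  \<comment> \<open>The definition of \<open>sm_Ck\<close> may produce a different derivative for
    every order \<open>k\<close>; uniqueness on the open set \<open>U\<close> merges them into the
    single \<open>F'\<close>.\<close>
  have ck: "sm_Ck k U (\<lambda>x. F' x h)" for k h
  proof -
    have "sm_Ck (Suc k) U F" using U by blast
    then obtain G' where G': "\<forall>x\<in>U. (F has_derivative G' x) (at x)" "\<forall>h. sm_Ck k U (\<lambda>x. G' x h)" by auto
    have "G' x = F' x" if "x \<in> U" for x using that G' F' has_derivative_unique by blast
    then show ?thesis using G'(2) sm_Ck_cong[OF U(1), of "\<lambda>x. G' x h" "\<lambda>x. F' x h" k] by simp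
  qed
  have "(f has_derivative F' x) (at x within A)" if x: "x \<in> A \<inter> U" for x
  proof -
    obtain e where e: "e > 0" "ball x e \<subseteq> U" using U x openE by blast
    have "(F has_derivative F' x) (at x within A)" using F' x has_derivative_at_withinI by blast
    then show ?thesis
      by (rule has_derivative_transform_within[of _ _ _ _ e]) (use e U x in \<open>auto simp: dist_commute subset_eq\<close>)
  qed
  note d = this
  show ?thesis by (rule that[OF U(1,2) F'[rule_format] d ck U(4)[rule_format]])
qed

lemma sm_smooth_on_has_frechet_derivative:
  assumes "sm_smooth_on A f" "p \<in> A"
  shows "(f has_derivative frechet_derivative f (at p within A)) (at p within A)"
proof -
  obtain F' where "(f has_derivative F') (at p within A)" 
    using sm_smooth_on_local_derivative[OF assms] assms(2) by (metis IntI)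
  then show ?thesis using frechet_derivative_works differentiable_def by blast
qed

lemma sm_smooth_on_frechet_derivative:
  assumes f: "sm_smooth_on A f" and c: "cone_set A"
  shows "sm_smooth_on A (\<lambda>x. frechet_derivative f (at x within A) h)"
  unfolding sm_smooth_on_def
proof
  fix p assume p: "p \<in> A"
  obtain U F F' where U: "open U" "p \<in> U"
    "\<And>x. x \<in> A \<inter> U \<Longrightarrow> (f has_derivative F' x) (at x within A)" "\<And>h k. sm_Ck k U (\<lambda>x. F' x h)"
    using sm_smooth_on_local_derivative[OF f p] by metis
  have "F' y = frechet_derivative f (at y within A)" if "y \<in> A \<inter> U" for y
    by (rule cone_set_has_derivative_unique[OF c _ U(3)[OF that] sm_smooth_on_has_frechet_derivative[OF f]]) (use that in auto)
  then show "\<exists>U F. open U \<and> p \<in> U \<and> (\<forall>k. sm_Ck k U F) \<and> (\<forall>y\<in>A \<inter> U. F y = frechet_derivative f (at y within A) h)"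
    using U by (intro exI[of _ U] exI[of _ "\<lambda>x. F' x h"]) auto
qed

section \<open>Lipschitz bounds on compact convex sets\<close>

lemma norm_linear_le_sum_Basis:
  fixes f :: "'a::euclidean_space \<Rightarrow> 'b::real_normed_vector"
  assumes "linear f" shows "norm (f x) \<le> (\<Sum>b\<in>Basis. norm (f b)) * norm x"
proof -
  have "f x = f (\<Sum>b\<in>Basis. (x \<bullet> b) *\<^sub>R b)" by (simp add: euclidean_representation)
  also have "\<dots> = (\<Sum>b\<in>Basis. (x \<bullet> b) *\<^sub>R f b)" using assms by (simp add: linear_sum linear_cmul)
  finally have "norm (f x) \<le> (\<Sum>b\<in>Basis. norm ((x \<bullet> b) *\<^sub>R f b))" by (metis norm_sum)
  also have "\<dots> \<le> (\<Sum>b\<in>Basis. norm x * norm (f b))"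
    by (intro sum_mono) (auto intro!: mult_right_mono simp: Basis_le_norm)
  finally show ?thesis by (simp add: sum_distrib_left mult.commute)
qed

text \<open>The local extensions are not glued. The derivative within \<open>A\<close> is itself
  continuous, hence bounded on the compact set, and convexity turns the bound into a Lipschitz
  constant by the mean value inequality.\<close>

lemma sm_smooth_on_Lipschitz:
  fixes f :: "'a::euclidean_space \<Rightarrow> 'b::real_normed_vector"
  assumes f: "sm_smooth_on A f" and A: "compact A" "convex A" "interior A \<noteq> {}"
  obtains L where "L \<ge> 0" "\<And>x y. x \<in> A \<Longrightarrow> y \<in> A \<Longrightarrow> norm (f x - f y) \<le> L * norm (x - y)"
proof -
  define f' where "f' = (\<lambda>x. frechet_derivative f (at x within A))"
  have c: "cone_set A" using A cone_set_convex by blast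
  have d: "(f has_derivative f' x) (at x within A)" if "x \<in> A" for x
    unfolding f'_def using sm_smooth_on_has_frechet_derivative f that by blast
  have "continuous_on A (\<lambda>x. \<Sum>b\<in>Basis. norm (f' x b))"
    unfolding f'_def by (intro continuous_intros sm_smooth_on_imp_continuous_on sm_smooth_on_frechet_derivative f c)
  then have "bounded ((\<lambda>x. \<Sum>b\<in>Basis. norm (f' x b)) ` A)"
    using A(1) compact_continuous_image compact_imp_bounded by blast
  then obtain L where L: "L > 0" "\<And>x. x \<in> A \<Longrightarrow> norm (\<Sum>b\<in>Basis. norm (f' x b)) \<le> L"
    unfolding bounded_pos by auto
  have "onorm (f' x) \<le> L" if x: "x \<in> A" for x
  proof (rule onorm_le)
    fix y
    have "norm (f' x y) \<le> (\<Sum>b\<in>Basis. norm (f' x b)) * norm y"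
      using norm_linear_le_sum_Basis d[OF x] has_derivative_linear by blast
    also have "\<dots> \<le> L * norm y" using L(2)[OF x] by (intro mult_right_mono) auto
    finally show "norm (f' x y) \<le> L * norm y" .
  qed
  then have "norm (f x - f y) \<le> L * norm (x - y)" if "x \<in> A" "y \<in> A" for x y
    using differentiable_bound[OF A(2) d] that by blast
  then show ?thesis using that[of L] L by auto
qed

section \<open>Mixed derivatives and a Gronwall estimate\<close>

text \<open>The second difference over a parallelogram does not change when \<open>h\<close> and
  \<open>k\<close> are exchanged, so applying the mean value theorem first along \<open>h\<close>
  and then along \<open>k\<close> exposes the mixed derivatives of both orders as one
  number.\<close>

lemma mixed_difference_quotient:
  fixes F :: "'a::real_normed_vector \<Rightarrow> real"
  assumes s: "s > 0"
    and U: "\<And>a b. a \<in> {0..s} \<Longrightarrow> b \<in> {0..s} \<Longrightarrow> v + a *\<^sub>R h + b *\<^sub>R k \<in> U"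
    and F: "\<And>x. x \<in> U \<Longrightarrow> (F has_derivative F' x) (at x)"
    and A: "\<And>x. x \<in> U \<Longrightarrow> ((\<lambda>x. F' x h) has_derivative A x) (at x)"
  shows "\<exists>a\<in>{0..s}. \<exists>b\<in>{0..s}. F (v + s *\<^sub>R h + s *\<^sub>R k) - F (v + s *\<^sub>R h) - F (v + s *\<^sub>R k) + F v
           = s * s * A (v + a *\<^sub>R h + b *\<^sub>R k) k"
proof -
  have lF: "F' x (c *\<^sub>R y) = c * F' x y" if "x \<in> U" for x c y
    using linear_cmul[OF has_derivative_linear[OF F[OF that]]] by simp
  have lA: "A x (c *\<^sub>R y) = c * A x y" if "x \<in> U" for x c y
    using linear_cmul[OF has_derivative_linear[OF A[OF that]]] by simp
  have d1: "((\<lambda>t. F (v + t *\<^sub>R h + b *\<^sub>R k)) has_real_derivative F' (v + t *\<^sub>R h + b *\<^sub>R k) h) (at t)"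
    if "t \<in> {0..s}" "b \<in> {0..s}" for t b
  proof -
    have "((\<lambda>t. v + t *\<^sub>R h + b *\<^sub>R k) has_derivative (\<lambda>t. t *\<^sub>R h)) (at t)"
      by (auto intro!: derivative_eq_intros)
    from has_derivative_compose[OF this F[OF U[OF that]]]
    show ?thesis unfolding has_field_derivative_def
      by (rule has_derivative_eq_rhs) (use lF[OF U[OF that]] in \<open>auto simp: mult.commute\<close>)
  qed
  define \<phi> where "\<phi> t = F (v + t *\<^sub>R h + s *\<^sub>R k) - F (v + t *\<^sub>R h + 0 *\<^sub>R k)" for t
  have "\<exists>a>0. a < s \<and> \<phi> s - \<phi> 0 = (s - 0) * (F' (v + a *\<^sub>R h + s *\<^sub>R k) h - F' (v + a *\<^sub>R h + 0 *\<^sub>R k) h)"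
    unfolding \<phi>_def by (rule MVT2[OF s]) (use d1 s in \<open>auto intro!: DERIV_diff simp del: scaleR_zero_left\<close>)
  then obtain a where "a > 0" "a < s"
    "\<phi> s - \<phi> 0 = (s - 0) * (F' (v + a *\<^sub>R h + s *\<^sub>R k) h - F' (v + a *\<^sub>R h + 0 *\<^sub>R k) h)" by blast
  then have a: "a \<in> {0..s}"
    "\<phi> s - \<phi> 0 = s * (F' (v + a *\<^sub>R h + s *\<^sub>R k) h - F' (v + a *\<^sub>R h) h)" by auto
  have d2: "((\<lambda>t. F' (v + a *\<^sub>R h + t *\<^sub>R k) h) has_real_derivative A (v + a *\<^sub>R h + t *\<^sub>R k) k) (at t)"
    if "t \<in> {0..s}" for t
  proof -
    have "((\<lambda>t. v + a *\<^sub>R h + t *\<^sub>R k) has_derivative (\<lambda>t. t *\<^sub>R k)) (at t)"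
      by (auto intro!: derivative_eq_intros)
    from has_derivative_compose[OF this A[OF U[OF a(1) that]]]
    show ?thesis unfolding has_field_derivative_def
      by (rule has_derivative_eq_rhs) (use lA[OF U[OF a(1) that]] in \<open>auto simp: mult.commute\<close>)
  qed
  have "\<exists>b>0. b < s \<and> F' (v + a *\<^sub>R h + s *\<^sub>R k) h - F' (v + a *\<^sub>R h + 0 *\<^sub>R k) h = (s - 0) * A (v + a *\<^sub>R h + b *\<^sub>R k) k"
    by (rule MVT2[OF s]) (use d2 in auto)
  then obtain b where "b > 0" "b < s"
    "F' (v + a *\<^sub>R h + s *\<^sub>R k) h - F' (v + a *\<^sub>R h + 0 *\<^sub>R k) h = (s - 0) * A (v + a *\<^sub>R h + b *\<^sub>R k) k" by blast
  then have b: "b \<in> {0..s}"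
    "F' (v + a *\<^sub>R h + s *\<^sub>R k) h - F' (v + a *\<^sub>R h) h = s * A (v + a *\<^sub>R h + b *\<^sub>R k) k" by auto
  have "\<phi> s - \<phi> 0 = F (v + s *\<^sub>R h + s *\<^sub>R k) - F (v + s *\<^sub>R h) - F (v + s *\<^sub>R k) + F v"
    unfolding \<phi>_def by simp
  then show ?thesis using a b by (intro bexI[of _ a] bexI[of _ b]) auto
qed

lemma second_derivative_symmetric_real:
  fixes F :: "'a::real_normed_vector \<Rightarrow> real"
  assumes U: "open U" "v \<in> U"
    and F: "\<And>x. x \<in> U \<Longrightarrow> (F has_derivative F' x) (at x)"
    and A: "\<And>x. x \<in> U \<Longrightarrow> ((\<lambda>x. F' x h) has_derivative A x) (at x)"
    and B: "\<And>x. x \<in> U \<Longrightarrow> ((\<lambda>x. F' x k) has_derivative B x) (at x)"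
    and cA: "continuous_on U (\<lambda>x. A x k)" and cB: "continuous_on U (\<lambda>x. B x h)"
  shows "A v k = B v h"
proof (rule ccontr)
  assume "A v k \<noteq> B v h"
  \<comment> \<open>Half the gap: the common value of both difference quotients would be closer than
    \<open>e\<close> to each of two numbers that are \<open>2 * e\<close> apart.\<close>
  define e where "e = \<bar>A v k - B v h\<bar> / 2"
  have e: "e > 0" unfolding e_def using \<open>A v k \<noteq> B v h\<close> by simp
  have "isCont (\<lambda>x. A x k) v" "isCont (\<lambda>x. B x h) v"
    using cA cB U continuous_on_eq_continuous_at by blast+
  then obtain d1 d2 where d12: "d1 > 0" "\<And>x. dist x v < d1 \<Longrightarrow> dist (A x k) (A v k) < e"
      "d2 > 0" "\<And>x. dist x v < d2 \<Longrightarrow> dist (B x h) (B v h) < e"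
    using e unfolding continuous_at_eps_delta by metis
  obtain d3 where d3: "d3 > 0" "ball v d3 \<subseteq> U" using U openE by blast
  define d where "d = min d1 (min d2 d3)"
  have d: "d > 0" "\<And>x. dist x v < d \<Longrightarrow> x \<in> U \<and> dist (A x k) (A v k) < e \<and> dist (B x h) (B v h) < e"
    unfolding d_def using d12 d3 by (auto simp: subset_eq dist_commute)
  \<comment> \<open>Small enough to keep the whole parallelogram in the ball of radius
    \<open>d\<close>; the summand 1 avoids division by zero for \<open>h = k = 0\<close>.\<close>
  define s where "s = d / (norm h + norm k + 1) / 2"
  have n: "norm h + norm k + 1 > 0" using norm_ge_zero[of h] norm_ge_zero[of k] by linarith
  have s: "s > 0" unfolding s_def using d n by simp
  have near: "dist (v + a *\<^sub>R h + b *\<^sub>R k) v < d" if "a \<in> {0..s}" "b \<in> {0..s}" for a b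
  proof -
    have "norm (a *\<^sub>R h + b *\<^sub>R k) \<le> norm (a *\<^sub>R h) + norm (b *\<^sub>R k)" by (rule norm_triangle_ineq)
    also have "\<dots> \<le> s * norm h + s * norm k"
      using that by (auto intro!: add_mono mult_right_mono)
    also have "\<dots> \<le> s * (norm h + norm k + 1)" using s by (simp add: algebra_simps)
    also have "\<dots> = d / 2" unfolding s_def using n by (simp add: field_simps)
    finally show ?thesis using d by (simp add: dist_norm add.assoc)
  qed
  have near': "dist (v + a *\<^sub>R k + b *\<^sub>R h) v < d" if "a \<in> {0..s}" "b \<in> {0..s}" for a b
    using near[OF that(2) that(1)] by (simp add: algebra_simps)
  obtain a b where ab: "a \<in> {0..s}" "b \<in> {0..s}"
    "F (v + s *\<^sub>R h + s *\<^sub>R k) - F (v + s *\<^sub>R h) - F (v + s *\<^sub>R k) + F v = s * s * A (v + a *\<^sub>R h + b *\<^sub>R k) k"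
    using mixed_difference_quotient[OF s, of v h k U F F' A] F A near d by metis
  obtain a' b' where ab': "a' \<in> {0..s}" "b' \<in> {0..s}"
    "F (v + s *\<^sub>R k + s *\<^sub>R h) - F (v + s *\<^sub>R k) - F (v + s *\<^sub>R h) + F v = s * s * B (v + a' *\<^sub>R k + b' *\<^sub>R h) h"
    using mixed_difference_quotient[OF s, of v k h U F F' B] F B near' d by metis
  have sw: "v + s *\<^sub>R k + s *\<^sub>R h = v + s *\<^sub>R h + s *\<^sub>R k" by (simp add: algebra_simps)
  have "s * s * A (v + a *\<^sub>R h + b *\<^sub>R k) k = s * s * B (v + a' *\<^sub>R k + b' *\<^sub>R h) h"
    using ab(3) ab'(3) unfolding sw by linarith
  then have "A (v + a *\<^sub>R h + b *\<^sub>R k) k = B (v + a' *\<^sub>R k + b' *\<^sub>R h) h" using s by simp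
  moreover have "dist (A (v + a *\<^sub>R h + b *\<^sub>R k) k) (A v k) < e" "dist (B (v + a' *\<^sub>R k + b' *\<^sub>R h) h) (B v h) < e"
    using near[OF ab(1,2)] near'[OF ab'(1,2)] d(2) by auto
  moreover have "\<bar>A v k - B v h\<bar> \<le> \<bar>y - A v k\<bar> + \<bar>y - B v h\<bar>" for y by linarith
  from this[of "A (v + a *\<^sub>R h + b *\<^sub>R k) k"]
  have "2 * e \<le> dist (A (v + a *\<^sub>R h + b *\<^sub>R k) k) (A v k) + dist (A (v + a *\<^sub>R h + b *\<^sub>R k) k) (B v h)"
    unfolding e_def dist_real_def by simp
  ultimately show False by simp
qed

lemma second_derivative_symmetric:
  fixes F :: "'a::real_normed_vector \<Rightarrow> 'b::euclidean_space"
  assumes U: "open U" "v \<in> U"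
    and F: "\<And>x. x \<in> U \<Longrightarrow> (F has_derivative F' x) (at x)"
    and A: "\<And>x. x \<in> U \<Longrightarrow> ((\<lambda>x. F' x h) has_derivative A x) (at x)"
    and B: "\<And>x. x \<in> U \<Longrightarrow> ((\<lambda>x. F' x k) has_derivative B x) (at x)"
    and cA: "continuous_on U (\<lambda>x. A x k)" and cB: "continuous_on U (\<lambda>x. B x h)"
  shows "A v k = B v h"
proof (rule euclidean_eqI)
  fix b :: 'b
  show "A v k \<bullet> b = B v h \<bullet> b"
    by (rule second_derivative_symmetric_real[OF U, where F="\<lambda>x. F x \<bullet> b" and F'="\<lambda>x h. F' x h \<bullet> b"
        and A="\<lambda>x k. A x k \<bullet> b" and B="\<lambda>x k. B x k \<bullet> b"])
      (auto intro!: has_derivative_inner_left F A B continuous_intros cA cB)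
qed

text \<open>With the integrating factor \<open>exp (- C * t)\<close> the function becomes
  nonincreasing, and it starts at 0.\<close>

lemma Gronwall_zero:
  fixes h :: "real \<Rightarrow> real"
  assumes d: "\<And>t. t \<in> {a..b} \<Longrightarrow> (h has_real_derivative h' t) (at t within {a..b})"
    and le: "\<And>t. t \<in> {a..b} \<Longrightarrow> h' t \<le> C * h t" and 0: "h a = 0" and t: "t \<in> {a..b}"
  shows "h t \<le> 0"
proof (cases "t = a")
  case False
  then have at: "a < t" using t by auto
  define k where "k s = h s * exp (- C * s)" for s
  have dk: "(k has_real_derivative (h' s - C * h s) * exp (- C * s)) (at s within {a..t})" if "s \<in> {a..t}" for s
  proof -
    have "(h has_real_derivative h' s) (at s within {a..t})"
      using d[of s] that t by (auto intro: DERIV_subset[of h "h' s" s "{a..b}"])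
    then show ?thesis unfolding k_def
      by (auto intro!: derivative_eq_intros simp: algebra_simps)
  qed
  have "\<exists>x\<in>{a<..<t}. k t - k a = (*) ((h' x - C * h x) * exp (- C * x)) (t - a)"
    by (rule mvt_simple[OF at]) (use dk in \<open>simp add: has_field_derivative_def\<close>)
  then obtain x where x: "x \<in> {a<..<t}" "k t - k a = (t - a) * ((h' x - C * h x) * exp (- C * x))"
    by (auto simp: mult.commute)
  have "h' x - C * h x \<le> 0" using le[of x] x t by auto
  then have "(t - a) * ((h' x - C * h x) * exp (- C * x)) \<le> 0"
    using at by (intro mult_nonneg_nonpos mult_nonpos_nonneg) auto
  then have "k t \<le> 0" using x 0 unfolding k_def by simp
  then show ?thesis unfolding k_def by (simp add: mult_le_0_iff)
qed (use 0 in auto)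

section \<open>Riemannian metrics on the ball\<close>

lemma bounded_bilinear_matrix_vector_mult:
  "bounded_bilinear ((*v) :: real^'n^'m \<Rightarrow> real^'n \<Rightarrow> real^'m)"
  unfolding bilinear_conv_bounded_bilinear[symmetric] bilinear_def
  by (auto intro!: linearI simp: algebra_simps scaleR_matrix_vector_assoc)

lemma bounded_linear_transpose: "bounded_linear (transpose :: real^'n^'m \<Rightarrow> real^'m^'n)"
  unfolding linear_conv_bounded_linear[symmetric]
  by (auto intro!: linearI simp: transpose_def vec_eq_iff)

lemma inner_matrix_vector_mult_sym:
  fixes A :: "real^'n^'n"
  assumes "transpose A = A" shows "u \<bullet> (A *v v) = v \<bullet> (A *v u)"
  by (metis assms dot_lmul_matrix inner_commute transpose_matrix_vector)

lemma gip_add_left: "gip g x (u + u') v = gip g x u v + gip g x u' v"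
  and gip_add_right: "gip g x u (v + v') = gip g x u v + gip g x u v'"
  and gip_diff_left: "gip g x (u - u') v = gip g x u v - gip g x u' v"
  and gip_diff_right: "gip g x u (v - v') = gip g x u v - gip g x u v'"
  and gip_minus_left: "gip g x (- u) v = - gip g x u v"
  and gip_minus_right: "gip g x u (- v) = - gip g x u v"
  and gip_scaleR_left: "gip g x (c *\<^sub>R u) v = c * gip g x u v"
  and gip_scaleR_right: "gip g x u (c *\<^sub>R v) = c * gip g x u v"
  and gip_zero_left [simp]: "gip g x 0 v = 0"
  and gip_zero_right [simp]: "gip g x u 0 = 0"
  using matrix_vector_mult_diff_distrib[of "g x" 0 v]
  by (auto simp: gip_def inner_add_left inner_add_right inner_diff_left inner_diff_right algebra_simps matrix_vector_mult_scaleR)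

lemmas gip_linear = gip_add_left gip_add_right gip_diff_left gip_diff_right gip_minus_left
  gip_minus_right gip_scaleR_left gip_scaleR_right

abbreviation Dn :: "(real^'n::finite) set" where "Dn \<equiv> cball 0 1"

lemma cone_set_Dn: "cone_set (Dn :: (real^'n::finite) set)"
  by (rule cone_set_convex) (auto simp: interior_cball)

locale riem =
  fixes g :: "'n::finite rmetric"
  assumes riem: "riem_metric g"
begin

lemma g_smooth: "sm_smooth_on Dn g"
  using riem unfolding riem_metric_def by auto

lemma gip_sym: "x \<in> Dn \<Longrightarrow> gip g x u v = gip g x v u"
  using riem inner_matrix_vector_mult_sym unfolding riem_metric_def gip_def by blast

lemma gip_pos: "x \<in> Dn \<Longrightarrow> v \<noteq> 0 \<Longrightarrow> gip g x v v > 0"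
  using riem unfolding riem_metric_def by auto

lemma gip_nonneg: "x \<in> Dn \<Longrightarrow> gip g x v v \<ge> 0"
  using gip_pos[of x v] by (cases "v = 0") auto

lemma gip_eq_0_iff: "x \<in> Dn \<Longrightarrow> gip g x v v = 0 \<longleftrightarrow> v = 0"
  using gip_pos[of x v] by (cases "v = 0") auto

lemma gip_unit_le_1:
  assumes "x \<in> Dn" "gip g x u u = 1" "gip g x v v = 1"
  shows "gip g x u v \<le> 1" and "gip g x u v = 1 \<Longrightarrow> u = v"
proof -
  have e: "gip g x (u - v) (u - v) = 2 - 2 * gip g x u v"
    using assms gip_sym[OF assms(1), of u v] by (simp add: gip_linear)
  then show "gip g x u v \<le> 1" using gip_nonneg[OF assms(1), of "u - v"] by simp
  assume "gip g x u v = 1" then show "u = v" using e gip_eq_0_iff[OF assms(1), of "u - v"] by simp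
qed

lemma continuous_on_gip [continuous_intros]:
  assumes "continuous_on S c" "continuous_on S u" "continuous_on S v" "\<And>t. t \<in> S \<Longrightarrow> c t \<in> Dn"
  shows "continuous_on S (\<lambda>t. gip g (c t) (u t) (v t))"
proof -
  have "continuous_on S (\<lambda>t. g (c t))"
    by (rule continuous_on_compose2[OF sm_smooth_on_imp_continuous_on[OF g_smooth] assms(1)]) (use assms(4) in auto)
  then have "continuous_on S (\<lambda>t. g (c t) *v v t)"
    using bounded_bilinear.continuous_on[OF bounded_bilinear_matrix_vector_mult] assms by blast
  then show ?thesis unfolding gip_def using assms by (intro continuous_intros)
qed

lemma tendsto_gip:
  assumes "(c \<longlongrightarrow> x) F" "(u \<longlongrightarrow> u0) F" "(v \<longlongrightarrow> v0) F" "x \<in> Dn" "eventually (\<lambda>t. c t \<in> Dn) F"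
  shows "((\<lambda>t. gip g (c t) (u t) (v t)) \<longlongrightarrow> gip g x u0 v0) F"
proof -
  have "((\<lambda>t. g (c t)) \<longlongrightarrow> g x) F"
    by (rule continuous_on_tendsto_compose[OF sm_smooth_on_imp_continuous_on[OF g_smooth] assms(1,4,5)])
  then have "((\<lambda>t. g (c t) *v v t) \<longlongrightarrow> g x *v v0) F"
    using bounded_bilinear.tendsto[OF bounded_bilinear_matrix_vector_mult] assms(3) by blast
  then show ?thesis unfolding gip_def using assms by (intro tendsto_intros)
qed

lemma mderiv: "x \<in> Dn \<Longrightarrow> (g has_derivative mderiv g x) (at x within Dn)"
  unfolding mderiv_def by (rule sm_smooth_on_has_frechet_derivative[OF g_smooth])

lemma mderiv_smooth: "sm_smooth_on Dn (\<lambda>x. mderiv g x h)"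
  unfolding mderiv_def by (rule sm_smooth_on_frechet_derivative[OF g_smooth cone_set_Dn])

lemma linear_mderiv: "x \<in> Dn \<Longrightarrow> linear (mderiv g x)"
  using mderiv has_derivative_linear by blast

text \<open>Differentiation of \<open>transpose (g y) = g y\<close>; uniqueness of the derivative
  within the closed ball makes this valid at boundary points as well.\<close>

lemma mderiv_sym: assumes x: "x \<in> Dn" shows "u \<bullet> (mderiv g x h *v v) = v \<bullet> (mderiv g x h *v u)"
proof -
  have "((\<lambda>y. transpose (g y)) has_derivative (\<lambda>h. transpose (mderiv g x h))) (at x within Dn)"
    by (rule bounded_linear.has_derivative[OF bounded_linear_transpose mderiv[OF x]])
  then have "(g has_derivative (\<lambda>h. transpose (mderiv g x h))) (at x within Dn)"
    by (rule has_derivative_transform[OF x, rotated]) (use riem in \<open>auto simp: riem_metric_def\<close>)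
  then have "(\<lambda>h. transpose (mderiv g x h)) = mderiv g x"
    using cone_set_has_derivative_unique[OF cone_set_Dn x] mderiv[OF x] by blast
  then have "transpose (mderiv g x h) = mderiv g x h" by metis
  then show ?thesis by (rule inner_matrix_vector_mult_sym)
qed

text \<open>Paired with a vector \<open>J\<close>, the coordinates in the definition of
  \<open>chr\<close> collapse to the derivative of the metric in direction \<open>J\<close>, which
  is the term that a variation with field \<open>J\<close> produces.\<close>

lemma chr_inner:
  assumes x: "x \<in> Dn"
  shows "J \<bullet> chr g x w = J \<bullet> (mderiv g x w *v w) - (1/2) * (w \<bullet> (mderiv g x J *v w))"
proof -
  have "mderiv g x J = mderiv g x (\<Sum>i\<in>UNIV. (J$i) *\<^sub>R axis i 1)"
    using basis_expansion[of J] by (simp add: scalar_mult_eq_scaleR)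
  also have "\<dots> = (\<Sum>i\<in>UNIV. (J$i) *\<^sub>R mderiv g x (axis i 1))"
    using linear_mderiv[OF x] by (simp add: linear_sum linear_cmul)
  finally have 1: "mderiv g x J *v w = (\<Sum>i\<in>UNIV. (J$i) *\<^sub>R (mderiv g x (axis i 1) *v w))"
    by (simp add: bounded_bilinear.sum_left[OF bounded_bilinear_matrix_vector_mult] scaleR_matrix_vector_assoc)
  have "w \<bullet> (mderiv g x J *v w) = (\<Sum>i\<in>UNIV. J$i * (w \<bullet> (mderiv g x (axis i 1) *v w)))"
    unfolding 1 by (simp add: inner_sum_right)
  moreover have "J \<bullet> (\<chi> i. (1/2) * (w \<bullet> (mderiv g x (axis i 1) *v w))) = (\<Sum>i\<in>UNIV. J$i * ((1/2) * (w \<bullet> (mderiv g x (axis i 1) *v w))))"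
    by (simp add: inner_vec_def)
  ultimately show ?thesis unfolding chr_def by (simp add: inner_diff_right sum_distrib_left algebra_simps)
qed

lemma chr_scaleR: assumes "x \<in> Dn" shows "chr g x (c *\<^sub>R w) = c\<^sup>2 *\<^sub>R chr g x w"
proof (rule euclidean_eqI)
  fix b :: "real^'n"
  have "b \<bullet> chr g x (c *\<^sub>R w) = b \<bullet> (c\<^sup>2 *\<^sub>R chr g x w)"
    using assms linear_mderiv[OF assms]
    by (simp add: chr_inner linear_cmul matrix_vector_mult_scaleR scaleR_matrix_vector_assoc[symmetric] power2_eq_square algebra_simps)
  then show "chr g x (c *\<^sub>R w) \<bullet> b = (c\<^sup>2 *\<^sub>R chr g x w) \<bullet> b" by (simp add: inner_commute)
qed

lemma chr_smooth: "sm_smooth_on (Dn \<times> UNIV) (\<lambda>z. chr g (fst z) (snd z))"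
proof -
  have m: "sm_smooth_on (Dn \<times> UNIV) (\<lambda>z. mderiv g (fst z) h)" for h
    by (rule sm_smooth_on_compose[OF sm_smooth_on_bounded_linear[OF bounded_linear_fst] mderiv_smooth]) auto
  have w: "sm_smooth_on (Dn \<times> UNIV) snd" by (rule sm_smooth_on_bounded_linear[OF bounded_linear_snd])
  note vm = sm_smooth_on_bilinear[OF bounded_bilinear_matrix_vector_mult]
    and sc = sm_smooth_on_bilinear[OF bounded_bilinear_scaleR]
    and inn = sm_smooth_on_bilinear[OF bounded_bilinear_inner]
  \<comment> \<open>Only \<open>mderiv g x h\<close> with constant \<open>h\<close> is known to be
    smooth, so the moving direction is expanded in a basis.\<close>
  have "sm_smooth_on (Dn \<times> UNIV) (\<lambda>z. (\<Sum>b\<in>Basis. (snd z \<bullet> b) *\<^sub>R mderiv g (fst z) b) *v snd z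
     + (\<Sum>i\<in>UNIV. (snd z \<bullet> (mderiv g (fst z) (axis i 1) *v snd z)) *\<^sub>R axis i (- 1/2)))"
    by (intro sm_smooth_on_add vm sc inn sm_smooth_on_sum sm_smooth_on_const m w)
  then show ?thesis
  proof (rule sm_smooth_on_cong[rotated])
    fix z :: "(real^'n) \<times> (real^'n)" assume "z \<in> Dn \<times> UNIV"
    then have lin: "linear (mderiv g (fst z))" using linear_mderiv by auto
    have "(\<Sum>b\<in>Basis. (snd z \<bullet> b) *\<^sub>R mderiv g (fst z) b) = mderiv g (fst z) (\<Sum>b\<in>Basis. (snd z \<bullet> b) *\<^sub>R b)"
      by (simp add: linear_sum[OF lin] linear_cmul[OF lin])
    then have m: "(\<Sum>b\<in>Basis. (snd z \<bullet> b) *\<^sub>R mderiv g (fst z) b) = mderiv g (fst z) (snd z)"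
      by (simp only: euclidean_representation)
    show "(\<Sum>b\<in>Basis. (snd z \<bullet> b) *\<^sub>R mderiv g (fst z) b) *v snd z
       + (\<Sum>i\<in>UNIV. (snd z \<bullet> (mderiv g (fst z) (axis i 1) *v snd z)) *\<^sub>R axis i (- 1/2)) = chr g (fst z) (snd z)"
      unfolding chr_def m by (simp add: vec_eq_iff axis_def if_distrib cong: if_cong)
  qed
qed

text \<open>Minimum of the quadratic form over the compact set of points of the ball paired with
  Euclidean unit vectors, extended by homogeneity. It stands in for the inverse matrix of
  \<open>g x\<close> in later estimates.\<close>

lemma coercive:
  obtains l where "l > 0" "\<And>x v. x \<in> Dn \<Longrightarrow> l * (norm v)\<^sup>2 \<le> gip g x v v"
proof -
  have c: "compact ((Dn :: (real^'n) set) \<times> sphere (0::real^'n) 1)" by (intro compact_Times) auto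
  have "(axis undefined 1 :: real^'n) \<in> sphere 0 1" by (simp add: norm_axis_1)
  then have ne: "(Dn :: (real^'n) set) \<times> sphere (0::real^'n) 1 \<noteq> {}" by fastforce
  have "continuous_on ((Dn :: (real^'n) set) \<times> sphere (0::real^'n) 1) (\<lambda>z. gip g (fst z) (snd z) (snd z))"
    by (intro continuous_on_gip continuous_intros) auto
  from continuous_attains_inf[OF c ne this]
  obtain x0 v0 where m: "x0 \<in> Dn" "v0 \<in> sphere 0 1" "\<And>x v. x \<in> Dn \<Longrightarrow> v \<in> sphere 0 1 \<Longrightarrow> gip g x0 v0 v0 \<le> gip g x v v"
    by fastforce
  have "v0 \<noteq> 0" using m(2) by auto
  show ?thesis
  proof (rule that[of "gip g x0 v0 v0"])
    show "gip g x0 v0 v0 > 0" using gip_pos m(1) \<open>v0 \<noteq> 0\<close> by blast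
    fix x v :: "real^'n" assume x: "x \<in> Dn"
    show "gip g x0 v0 v0 * (norm v)\<^sup>2 \<le> gip g x v v"
    proof (cases "v = 0")
      case False
      then have "(1 / norm v) *\<^sub>R v \<in> sphere 0 1" by simp
      from m(3)[OF x this] have "gip g x0 v0 v0 \<le> gip g x v v / (norm v)\<^sup>2"
        by (simp add: gip_linear power2_eq_square)
      then show ?thesis using False by (simp add: pos_le_divide_eq)
    qed auto
  qed
qed

end

section \<open>Geodesics\<close>

context riem
begin

lemma gip_has_derivative:
  assumes F: "(F has_derivative F') (at x within S)" and S: "F ` S \<subseteq> Dn" "x \<in> S"
    and u: "(u has_derivative u') (at x within S)" and v: "(v has_derivative v') (at x within S)"
  shows "((\<lambda>x. gip g (F x) (u x) (v x)) has_derivative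
    (\<lambda>h. gip g (F x) (u' h) (v x) + u x \<bullet> (mderiv g (F x) (F' h) *v v x) + gip g (F x) (u x) (v' h))) (at x within S)"
proof -
  have "(g has_derivative mderiv g (F x)) (at (F x) within F ` S)"
    using mderiv S has_derivative_subset by blast
  from has_derivative_in_compose[OF F this]
  have "((\<lambda>x. g (F x)) has_derivative (\<lambda>h. mderiv g (F x) (F' h))) (at x within S)" .
  from bounded_bilinear.FDERIV[OF bounded_bilinear_matrix_vector_mult this v]
  have "((\<lambda>x. g (F x) *v v x) has_derivative (\<lambda>h. g (F x) *v v' h + mderiv g (F x) (F' h) *v v x)) (at x within S)" .
  from has_derivative_inner[OF u this] show ?thesis unfolding gip_def
    by (rule has_derivative_eq_rhs) (auto simp: algebra_simps inner_add_right inner_commute)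
qed

lemma gip_has_vector_derivative:
  assumes F: "(F has_vector_derivative F') (at x within S)" and S: "F ` S \<subseteq> Dn" "x \<in> S"
    and u: "(u has_vector_derivative u') (at x within S)" and v: "(v has_vector_derivative v') (at x within S)"
  shows "((\<lambda>x. gip g (F x) (u x) (v x)) has_vector_derivative
    (gip g (F x) u' (v x) + u x \<bullet> (mderiv g (F x) F' *v v x) + gip g (F x) (u x) v')) (at x within S)"
proof -
  have "F x \<in> Dn" using S by auto
  from linear_mderiv[OF this] show ?thesis
    using gip_has_derivative[OF F[unfolded has_vector_derivative_def] S u[unfolded has_vector_derivative_def] v[unfolded has_vector_derivative_def]]
    unfolding has_vector_derivative_def
    by (elim has_derivative_eq_rhs) (auto simp: gip_linear linear_cmul scaleR_matrix_vector_assoc[symmetric] algebra_simps)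
qed

lemma rgeodesicE:
  assumes "rgeodesic g \<gamma> \<gamma>' a b"
  obtains \<gamma>'' where "a < b" "\<And>t. t \<in> {a..b} \<Longrightarrow> \<gamma> t \<in> Dn"
    "\<And>t. t \<in> {a..b} \<Longrightarrow> (\<gamma> has_vector_derivative \<gamma>' t) (at t within {a..b})"
    "\<And>t. t \<in> {a..b} \<Longrightarrow> (\<gamma>' has_vector_derivative \<gamma>'' t) (at t within {a..b})"
    "\<And>t. t \<in> {a..b} \<Longrightarrow> g (\<gamma> t) *v \<gamma>'' t + chr g (\<gamma> t) (\<gamma>' t) = 0"
  using assms unfolding rgeodesic_def by metis

lemma rgeodesicD:
  assumes "rgeodesic g \<gamma> \<gamma>' a b"
  shows "a < b" "t \<in> {a..b} \<Longrightarrow> \<gamma> t \<in> Dn"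
    "t \<in> {a..b} \<Longrightarrow> (\<gamma> has_vector_derivative \<gamma>' t) (at t within {a..b})"
    "continuous_on {a..b} \<gamma>" "continuous_on {a..b} \<gamma>'"
proof -
  obtain \<gamma>'' where *: "a < b" "\<And>t. t \<in> {a..b} \<Longrightarrow> \<gamma> t \<in> Dn"
    "\<And>t. t \<in> {a..b} \<Longrightarrow> (\<gamma> has_vector_derivative \<gamma>' t) (at t within {a..b})"
    "\<And>t. t \<in> {a..b} \<Longrightarrow> (\<gamma>' has_vector_derivative \<gamma>'' t) (at t within {a..b})"
    "\<And>t. t \<in> {a..b} \<Longrightarrow> g (\<gamma> t) *v \<gamma>'' t + chr g (\<gamma> t) (\<gamma>' t) = 0"
    by (rule rgeodesicE[OF assms]) blast
  show "a < b" "t \<in> {a..b} \<Longrightarrow> \<gamma> t \<in> Dn" "t \<in> {a..b} \<Longrightarrow> (\<gamma> has_vector_derivative \<gamma>' t) (at t within {a..b})"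
    using * by auto
  show "continuous_on {a..b} \<gamma>" "continuous_on {a..b} \<gamma>'"
    using *(3,4) has_vector_derivative_continuous continuous_on_eq_continuous_within by blast+
qed

text \<open>The factor \<open>c\<close> may be negative, so one statement covers shifts, changes of
  speed and reversal of time. The equation survives because both of its terms scale with the square
  of \<open>c\<close>.\<close>

lemma rgeodesic_affine:
  assumes "rgeodesic g \<gamma> \<gamma>' a b" and c: "a' < b'" "\<And>t. t \<in> {a'..b'} \<Longrightarrow> c * t + e \<in> {a..b}"
  shows "rgeodesic g (\<lambda>t. \<gamma> (c * t + e)) (\<lambda>t. c *\<^sub>R \<gamma>' (c * t + e)) a' b'"
proof -
  obtain \<gamma>'' where G: "a < b" "\<And>t. t \<in> {a..b} \<Longrightarrow> \<gamma> t \<in> Dn"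
    "\<And>t. t \<in> {a..b} \<Longrightarrow> (\<gamma> has_vector_derivative \<gamma>' t) (at t within {a..b})"
    "\<And>t. t \<in> {a..b} \<Longrightarrow> (\<gamma>' has_vector_derivative \<gamma>'' t) (at t within {a..b})"
    "\<And>t. t \<in> {a..b} \<Longrightarrow> g (\<gamma> t) *v \<gamma>'' t + chr g (\<gamma> t) (\<gamma>' t) = 0"
    by (rule rgeodesicE[OF assms(1)]) blast
  have comp: "((\<lambda>t. f (c * t + e)) has_vector_derivative c *\<^sub>R f' (c * t + e)) (at t within {a'..b'})"
    if "\<And>t. t \<in> {a..b} \<Longrightarrow> (f has_vector_derivative f' t) (at t within {a..b})" "t \<in> {a'..b'}" for f f' :: "real \<Rightarrow> real^'n" and t
  proof -
    have 1: "((\<lambda>t. c * t + e) has_vector_derivative c) (at t within {a'..b'})"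
      unfolding has_real_derivative_iff_has_vector_derivative[symmetric] by (auto intro!: derivative_eq_intros)
    have "(f has_vector_derivative f' (c * t + e)) (at (c * t + e) within (\<lambda>t. c * t + e) ` {a'..b'})"
      by (rule has_vector_derivative_within_subset[OF that(1)]) (use c(2) that(2) in auto)
    from vector_diff_chain_within[OF 1 this] show ?thesis by (simp add: o_def)
  qed
  show ?thesis unfolding rgeodesic_def
  proof (intro conjI exI[of _ "\<lambda>t. c *\<^sub>R c *\<^sub>R \<gamma>'' (c * t + e)"] ballI c(1))
    fix t assume t: "t \<in> {a'..b'}"
    show "\<gamma> (c * t + e) \<in> Dn" using G(2) c(2) t by blast
    show "((\<lambda>t. \<gamma> (c * t + e)) has_vector_derivative c *\<^sub>R \<gamma>' (c * t + e)) (at t within {a'..b'})"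
      using comp[OF G(3)] t by blast
    have "((\<lambda>t. \<gamma>' (c * t + e)) has_vector_derivative c *\<^sub>R \<gamma>'' (c * t + e)) (at t within {a'..b'})"
      using comp[OF G(4)] t by blast
    then show "((\<lambda>t. c *\<^sub>R \<gamma>' (c * t + e)) has_vector_derivative c *\<^sub>R c *\<^sub>R \<gamma>'' (c * t + e)) (at t within {a'..b'})"
      by (rule has_vector_derivative_scaleR[where f="\<lambda>_. c" and f'=0, simplified])
    have "g (\<gamma> (c * t + e)) *v (c *\<^sub>R c *\<^sub>R \<gamma>'' (c * t + e)) + c\<^sup>2 *\<^sub>R chr g (\<gamma> (c * t + e)) (\<gamma>' (c * t + e)) 
       = c\<^sup>2 *\<^sub>R (g (\<gamma> (c * t + e)) *v \<gamma>'' (c * t + e) + chr g (\<gamma> (c * t + e)) (\<gamma>' (c * t + e)))"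
      by (simp add: matrix_vector_mult_scaleR power2_eq_square algebra_simps)
    also have "\<dots> = 0" using G(5) c(2) t by simp
    finally show "g (\<gamma> (c * t + e)) *v (c *\<^sub>R c *\<^sub>R \<gamma>'' (c * t + e)) + chr g (\<gamma> (c * t + e)) (c *\<^sub>R \<gamma>' (c * t + e)) = 0"
      using chr_scaleR G(2) c(2) t by simp
  qed
qed

lemma rgeodesic_subinterval:
  assumes "rgeodesic g \<gamma> \<gamma>' a b" "a' < b'" "a \<le> a'" "b' \<le> b"
  shows "rgeodesic g \<gamma> \<gamma>' a' b'"
  using rgeodesic_affine[OF assms(1,2), of 1 0] assms by simp

text \<open>Pairing the geodesic equation with the velocity gives minus half the derivative of the
  metric along the curve. This occurs twice and cancels the term from differentiating the metric
  itself.\<close>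

lemma rgeodesic_constant_speed:
  assumes "rgeodesic g \<gamma> \<gamma>' a b" "s \<in> {a..b}" "t \<in> {a..b}"
  shows "gip g (\<gamma> s) (\<gamma>' s) (\<gamma>' s) = gip g (\<gamma> t) (\<gamma>' t) (\<gamma>' t)"
proof -
  obtain \<gamma>'' where G: "a < b" "\<And>t. t \<in> {a..b} \<Longrightarrow> \<gamma> t \<in> Dn"
    "\<And>t. t \<in> {a..b} \<Longrightarrow> (\<gamma> has_vector_derivative \<gamma>' t) (at t within {a..b})"
    "\<And>t. t \<in> {a..b} \<Longrightarrow> (\<gamma>' has_vector_derivative \<gamma>'' t) (at t within {a..b})"
    "\<And>t. t \<in> {a..b} \<Longrightarrow> g (\<gamma> t) *v \<gamma>'' t + chr g (\<gamma> t) (\<gamma>' t) = 0"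
    by (rule rgeodesicE[OF assms(1)]) blast
  have "((\<lambda>t. gip g (\<gamma> t) (\<gamma>' t) (\<gamma>' t)) has_vector_derivative 0) (at t within {a..b})" if t: "t \<in> {a..b}" for t
  proof -
    have x: "\<gamma> t \<in> Dn" using G t by blast
    have e: "g (\<gamma> t) *v \<gamma>'' t = - chr g (\<gamma> t) (\<gamma>' t)" using G(5)[OF t] by (simp add: eq_neg_iff_add_eq_0)
    have "gip g (\<gamma> t) (\<gamma>' t) (\<gamma>'' t) = - (1/2) * (\<gamma>' t \<bullet> (mderiv g (\<gamma> t) (\<gamma>' t) *v \<gamma>' t))"
      unfolding gip_def e using chr_inner[OF x, of "\<gamma>' t" "\<gamma>' t"] by simp
    then have "gip g (\<gamma> t) (\<gamma>'' t) (\<gamma>' t) + \<gamma>' t \<bullet> (mderiv g (\<gamma> t) (\<gamma>' t) *v \<gamma>' t) + gip g (\<gamma> t) (\<gamma>' t) (\<gamma>'' t) = 0"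
      using gip_sym[OF x, of "\<gamma>' t" "\<gamma>'' t"] by simp
    then show ?thesis
      using gip_has_vector_derivative[OF G(3)[OF t] _ t G(4)[OF t] G(4)[OF t]] G(2) by (metis image_subsetI)
  qed
  then have "\<exists>c. \<forall>t\<in>{a..b}. gip g (\<gamma> t) (\<gamma>' t) (\<gamma>' t) = c"
    using has_vector_derivative_zero_constant[OF convex_real_interval(5), of a b "\<lambda>t. gip g (\<gamma> t) (\<gamma>' t) (\<gamma>' t)"] by metis
  then show ?thesis using assms(2,3) by metis
qed

lemma g_inj: assumes "x \<in> Dn" "g x *v u = g x *v v" shows "u = v"
proof -
  have "gip g x (u - v) (u - v) = 0" unfolding gip_def using assms by (simp add: matrix_vector_mult_diff_distrib)
  then show ?thesis using gip_eq_0_iff[OF assms(1), of "u - v"] by simp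
qed

text \<open>The glued curve needs matching accelerations at \<open>b\<close>. These are forced:
  since \<open>g x\<close> is injective, the equation determines the acceleration from point and
  velocity.\<close>

lemma rgeodesic_concat:
  assumes 1: "rgeodesic g \<gamma> \<gamma>' a b" and 2: "rgeodesic g \<delta> \<delta>' b c" and e: "\<gamma> b = \<delta> b" "\<gamma>' b = \<delta>' b"
  shows "rgeodesic g (\<lambda>t. if t \<in> {a..b} then \<gamma> t else \<delta> t) (\<lambda>t. if t \<in> {a..b} then \<gamma>' t else \<delta>' t) a c"
proof -
  obtain \<gamma>'' where G: "a < b" "\<And>t. t \<in> {a..b} \<Longrightarrow> \<gamma> t \<in> Dn"
    "\<And>t. t \<in> {a..b} \<Longrightarrow> (\<gamma> has_vector_derivative \<gamma>' t) (at t within {a..b})"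
    "\<And>t. t \<in> {a..b} \<Longrightarrow> (\<gamma>' has_vector_derivative \<gamma>'' t) (at t within {a..b})"
    "\<And>t. t \<in> {a..b} \<Longrightarrow> g (\<gamma> t) *v \<gamma>'' t + chr g (\<gamma> t) (\<gamma>' t) = 0"
    by (rule rgeodesicE[OF 1]) blast
  obtain \<delta>'' where H: "b < c" "\<And>t. t \<in> {b..c} \<Longrightarrow> \<delta> t \<in> Dn"
    "\<And>t. t \<in> {b..c} \<Longrightarrow> (\<delta> has_vector_derivative \<delta>' t) (at t within {b..c})"
    "\<And>t. t \<in> {b..c} \<Longrightarrow> (\<delta>' has_vector_derivative \<delta>'' t) (at t within {b..c})"
    "\<And>t. t \<in> {b..c} \<Longrightarrow> g (\<delta> t) *v \<delta>'' t + chr g (\<delta> t) (\<delta>' t) = 0"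
    by (rule rgeodesicE[OF 2]) blast
  have "g (\<gamma> b) *v \<gamma>'' b = g (\<gamma> b) *v \<delta>'' b"
    using G(5)[of b] H(5)[of b] G(1) H(1) e by (metis add_right_cancel atLeastAtMost_iff less_eq_real_def)
  then have e2: "\<gamma>'' b = \<delta>'' b" using g_inj[of "\<gamma> b" "\<gamma>'' b" "\<delta>'' b"] G(1) G(2)[of b] by auto
  have un: "{a..c} = {a..b} \<union> {b..c}" using G(1) H(1) by auto
  have cl: "{a..b} \<union> (closure {a..b} \<inter> closure {b..c}) = {a..b}" "{b..c} \<union> (closure {a..b} \<inter> closure {b..c}) = {b..c}"
    using G(1) H(1) by auto
  have glue: "((\<lambda>t. if t \<in> {a..b} then f t else f2 t) has_vector_derivative (if t \<in> {a..b} then f' t else f2' t)) (at t within {a..c})"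
    if "\<And>t. t \<in> {a..b} \<Longrightarrow> (f has_vector_derivative f' t) (at t within {a..b})"
      "\<And>t. t \<in> {b..c} \<Longrightarrow> (f2 has_vector_derivative f2' t) (at t within {b..c})"
      "f b = f2 b" "f' b = f2' b" "t \<in> {a..c}"  for f f' f2 f2' :: "real \<Rightarrow> real^'n" and t
  proof (rule has_vector_derivative_If_within_closures[OF _ un])
    show "t \<in> {a..b} \<union> {b..c}" using that un by simp
    have "t = b" if "t \<in> closure {a..b}" "t \<in> closure {b..c}" using that by auto
    then show "t \<in> closure {a..b} \<Longrightarrow> t \<in> closure {b..c} \<Longrightarrow> f t = f2 t" 
      "t \<in> closure {a..b} \<Longrightarrow> t \<in> closure {b..c} \<Longrightarrow> f' t = f2' t" using that by blast+
    show "t \<in> {a..b} \<union> (closure {a..b} \<inter> closure {b..c}) \<Longrightarrow> (f has_vector_derivative f' t) (at t within {a..b} \<union> (closure {a..b} \<inter> closure {b..c}))"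
      unfolding cl by (rule that(1))
    show "t \<in> {b..c} \<union> (closure {a..b} \<inter> closure {b..c}) \<Longrightarrow> (f2 has_vector_derivative f2' t) (at t within {b..c} \<union> (closure {a..b} \<inter> closure {b..c}))"
      unfolding cl by (rule that(2))
  qed
  show ?thesis unfolding rgeodesic_def
    by (intro conjI exI[of _ "\<lambda>t. if t \<in> {a..b} then \<gamma>'' t else \<delta>'' t"] ballI glue G(3,4) H(3,4) e e2)
      (use G H e e2 in auto)
qed

text \<open>The Christoffel term is quadratic in \<open>w\<close>, so its bound on Euclidean unit
  vectors scales. This controls accelerations by the squared speed, with one constant for the whole
  ball.\<close>

lemma chr_bound:
  obtains C where "C > 0" "\<And>x w. x \<in> Dn \<Longrightarrow> (norm w)\<^sup>2 \<le> C * gip g x w w"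
    "\<And>x w a. x \<in> Dn \<Longrightarrow> g x *v a + chr g x w = 0 \<Longrightarrow> norm a \<le> C * gip g x w w"
proof -
  obtain l where l: "l > 0" "\<And>x v. x \<in> Dn \<Longrightarrow> l * (norm v)\<^sup>2 \<le> gip g x v v" using coercive by blast
  have "compact ((\<lambda>z. chr g (fst z) (snd z)) ` ((Dn :: (real^'n) set) \<times> sphere 0 1))"
    by (intro compact_continuous_image compact_Times compact_cball compact_sphere
        continuous_on_subset[OF sm_smooth_on_imp_continuous_on[OF chr_smooth]]) auto
  from compact_imp_bounded[OF this] obtain B where B0: "B > 0"
    "\<And>y. y \<in> (\<lambda>z. chr g (fst z) (snd z)) ` ((Dn :: (real^'n) set) \<times> sphere 0 1) \<Longrightarrow> norm y \<le> B"
    unfolding bounded_pos by blast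
  have B: "B > 0" "\<And>x w. x \<in> Dn \<Longrightarrow> norm w = 1 \<Longrightarrow> norm (chr g x w) \<le> B"
    using B0(1) by (auto intro!: B0(2) image_eqI[where x="(x, w)" for x w])
  have w: "(norm w)\<^sup>2 \<le> (1 / l) * gip g x w w" if "x \<in> Dn" for x w
    using l(2)[OF that, of w] l(1) by (simp add: field_simps)
  have a: "norm a \<le> (B / l / l) * gip g x w w" if x: "x \<in> Dn" and e: "g x *v a + chr g x w = 0" for x w a
  proof (cases "w = 0")
    case True
    then have "g x *v a = g x *v 0" using e chr_scaleR[OF x, of 0 0] by simp
    then show ?thesis using g_inj[OF x] True by (metis gip_zero_left mult_zero_right norm_zero order_refl)
  next
    case False
    have "chr g x w = (norm w)\<^sup>2 *\<^sub>R chr g x ((1 / norm w) *\<^sub>R w)" using chr_scaleR[OF x, of "1 / norm w" w] False by (simp add: power2_eq_square)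
    then have c: "norm (chr g x w) \<le> (norm w)\<^sup>2 * B" using B(2)[OF x, of "(1 / norm w) *\<^sub>R w"] False by (simp add: mult_left_mono)
    \<comment> \<open>Testing the equation with \<open>a\<close> itself and using coercivity bounds
      \<open>a\<close> without inverting the matrix.\<close>
    have "gip g x a a = a \<bullet> (- chr g x w)" unfolding gip_def using e by (simp add: eq_neg_iff_add_eq_0[symmetric])
    also have "\<dots> \<le> norm a * ((norm w)\<^sup>2 * B)" using norm_cauchy_schwarz[of a "- chr g x w"] mult_left_mono[OF c, of "norm a"] by simp
    finally have "norm a * (l * norm a) \<le> norm a * ((norm w)\<^sup>2 * B)" using l(2)[OF x, of a] by (simp add: power2_eq_square algebra_simps)
    then have "a \<noteq> 0 \<Longrightarrow> l * norm a \<le> (norm w)\<^sup>2 * B" by simp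
    then have "l * norm a \<le> (norm w)\<^sup>2 * B" using B(1) by (cases "a = 0") auto
    also have "\<dots> \<le> (1 / l) * gip g x w w * B" using w[OF x] B(1) by (intro mult_right_mono) auto
    finally show ?thesis using l(1) by (simp add: field_simps)
  qed
  define C where "C = max (1 / l) (B / l / l)"
  have "(1 / l) * gip g x w w \<le> C * gip g x w w" "(B / l / l) * gip g x w w \<le> C * gip g x w w" if "x \<in> Dn" for x w
    unfolding C_def by (rule mult_right_mono[OF max.cobounded1 gip_nonneg[OF that]])
      (rule mult_right_mono[OF max.cobounded2 gip_nonneg[OF that]])
  moreover have "C > 0" unfolding C_def using l(1) by (simp add: less_max_iff_disj)
  ultimately show ?thesis by (intro that[of C]) (blast intro: order_trans[OF w] order_trans[OF a])+
qed

text \<open>Gronwall for the squared Euclidean distance of positions and velocities. The equation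
  gives accelerations only implicitly, through \<open>g\<close>, so their difference is estimated by
  coercivity and by Lipschitz constants of \<open>g\<close> and of the Christoffel term.\<close>

lemma rgeodesic_unique:
  assumes 1: "rgeodesic g \<gamma> \<gamma>' a b" and 2: "rgeodesic g \<delta> \<delta>' a b" and e: "\<gamma> a = \<delta> a" "\<gamma>' a = \<delta>' a"
    and t: "t \<in> {a..b}"
  shows "\<gamma> t = \<delta> t" "\<gamma>' t = \<delta>' t"
proof -
  obtain \<gamma>'' where G: "a < b" "\<And>t. t \<in> {a..b} \<Longrightarrow> \<gamma> t \<in> Dn"
    "\<And>t. t \<in> {a..b} \<Longrightarrow> (\<gamma> has_vector_derivative \<gamma>' t) (at t within {a..b})"
    "\<And>t. t \<in> {a..b} \<Longrightarrow> (\<gamma>' has_vector_derivative \<gamma>'' t) (at t within {a..b})"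
    "\<And>t. t \<in> {a..b} \<Longrightarrow> g (\<gamma> t) *v \<gamma>'' t + chr g (\<gamma> t) (\<gamma>' t) = 0"
    by (rule rgeodesicE[OF 1]) blast
  obtain \<delta>'' where H: "a < b" "\<And>t. t \<in> {a..b} \<Longrightarrow> \<delta> t \<in> Dn"
    "\<And>t. t \<in> {a..b} \<Longrightarrow> (\<delta> has_vector_derivative \<delta>' t) (at t within {a..b})"
    "\<And>t. t \<in> {a..b} \<Longrightarrow> (\<delta>' has_vector_derivative \<delta>'' t) (at t within {a..b})"
    "\<And>t. t \<in> {a..b} \<Longrightarrow> g (\<delta> t) *v \<delta>'' t + chr g (\<delta> t) (\<delta>' t) = 0"
    by (rule rgeodesicE[OF 2]) blast
  obtain C where C: "C > 0" "\<And>x w. x \<in> Dn \<Longrightarrow> (norm w)\<^sup>2 \<le> C * gip g x w w"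
    "\<And>x w a. x \<in> Dn \<Longrightarrow> g x *v a + chr g x w = 0 \<Longrightarrow> norm a \<le> C * gip g x w w" using chr_bound by metis
  obtain l where l: "l > 0" "\<And>x v. x \<in> Dn \<Longrightarrow> l * (norm v)\<^sup>2 \<le> gip g x v v" using coercive by blast
  define s where "s = gip g (\<gamma> a) (\<gamma>' a) (\<gamma>' a)"
  have sp: "gip g (\<gamma> t) (\<gamma>' t) (\<gamma>' t) = s" "gip g (\<delta> t) (\<delta>' t) (\<delta>' t) = s" if "t \<in> {a..b}" for t
    using rgeodesic_constant_speed[OF 1, of t a] rgeodesic_constant_speed[OF 2, of t a] that e unfolding s_def by auto
  \<comment> \<open>Both curves have the same conserved squared speed \<open>s\<close>, so their
    velocities stay in one Euclidean ball, and the Christoffel term is Lipschitz on the compact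
    region in question. The summand 1 keeps the radius positive at speed zero.\<close>
  define R where "R = sqrt (C * s) + 1"
  have s: "s \<ge> 0" unfolding s_def using gip_nonneg G by auto
  then have R0: "R > 0" unfolding R_def using C(1) by (intro add_nonneg_pos) auto
  have nR: "\<gamma>' t \<in> cball 0 R" "\<delta>' t \<in> cball 0 R" if "t \<in> {a..b}" for t
    using real_le_rsqrt[OF C(2)[OF G(2)[OF that], of "\<gamma>' t"]] real_le_rsqrt[OF C(2)[OF H(2)[OF that], of "\<delta>' t"]] sp[OF that]
    unfolding R_def by auto
  obtain K :: real where K: "K > 0" "\<And>(A::real^'n^'n) u. norm (A *v u) \<le> norm A * norm u * K"
    using bounded_bilinear.pos_bounded[OF bounded_bilinear_matrix_vector_mult] by blast
  obtain L where L: "L \<ge> 0" "\<And>x y. x \<in> Dn \<Longrightarrow> y \<in> Dn \<Longrightarrow> norm (g x - g y) \<le> L * norm (x - y)"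
    using sm_smooth_on_Lipschitz[OF g_smooth] by (auto simp: interior_cball)
  let ?D = "(Dn :: (real^'n) set) \<times> cball (0::real^'n) R"
  have sm: "sm_smooth_on ?D (\<lambda>z. chr g (fst z) (snd z))" by (rule sm_smooth_on_subset[OF chr_smooth]) auto
  have D: "compact ?D" "convex ?D" "interior ?D \<noteq> {}"
    using R0 by (auto simp: interior_Times interior_cball intro: compact_Times convex_Times)
  from sm_smooth_on_Lipschitz[OF sm D] obtain P where P: "P \<ge> 0" "\<And>x y. x \<in> ?D \<Longrightarrow> y \<in> ?D \<Longrightarrow> norm (chr g (fst x) (snd x) - chr g (fst y) (snd y)) \<le> P * norm (x - y)"
    by blast
  define M where "M = (P + L * (C * s) * K) / l"
  have M0: "M \<ge> 0" "P + L * (C * s) * K = l * M" unfolding M_def using K(1) L(1) P(1) C(1) s l(1) by auto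
  have acc: "norm (\<gamma>'' t - \<delta>'' t) \<le> M * (norm (\<gamma> t - \<delta> t) + norm (\<gamma>' t - \<delta>' t))" if t: "t \<in> {a..b}" for t
  proof -
    define r where "r = \<gamma>'' t - \<delta>'' t"
    define n where "n = norm (\<gamma> t - \<delta> t) + norm (\<gamma>' t - \<delta>' t)"
    have x: "\<gamma> t \<in> Dn" "\<delta> t \<in> Dn" using G(2) H(2) t by auto
    have eqs: "g (\<gamma> t) *v \<gamma>'' t = - chr g (\<gamma> t) (\<gamma>' t)" "g (\<delta> t) *v \<delta>'' t = - chr g (\<delta> t) (\<delta>' t)"
      using G(5)[OF t] H(5)[OF t] by (auto simp: eq_neg_iff_add_eq_0)
    \<comment> \<open>The two equations carry different matrices; the mismatch is moved to the
      acceleration of the second curve, whose norm is at most \<open>C * s\<close>.\<close>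
    have "g (\<gamma> t) *v r = g (\<gamma> t) *v \<gamma>'' t - g (\<delta> t) *v \<delta>'' t - (g (\<gamma> t) - g (\<delta> t)) *v \<delta>'' t"
      unfolding r_def by (simp add: algebra_simps)
    then have gr: "g (\<gamma> t) *v r = - (chr g (\<gamma> t) (\<gamma>' t) - chr g (\<delta> t) (\<delta>' t)) - (g (\<gamma> t) - g (\<delta> t)) *v \<delta>'' t"
      unfolding eqs by simp
    have "norm (chr g (\<gamma> t) (\<gamma>' t) - chr g (\<delta> t) (\<delta>' t)) \<le> P * norm (\<gamma> t - \<delta> t, \<gamma>' t - \<delta>' t)"
      using P(2)[of "(\<gamma> t, \<gamma>' t)" "(\<delta> t, \<delta>' t)"] x nR[OF t] by simp
    also have "\<dots> \<le> P * n" unfolding n_def norm_Pair by (intro mult_left_mono sqrt_sum_squares_le_sum P) auto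
    finally have 1: "norm (chr g (\<gamma> t) (\<gamma>' t) - chr g (\<delta> t) (\<delta>' t)) \<le> P * n" .
    have "norm ((g (\<gamma> t) - g (\<delta> t)) *v \<delta>'' t) \<le> norm (g (\<gamma> t) - g (\<delta> t)) * norm (\<delta>'' t) * K" by (rule K)
    also have "\<dots> \<le> (L * n) * (C * s) * K"
      using C(3)[OF x(2) H(5)[OF t]] sp(2)[OF t] K(1) order_trans[OF L(2)[OF x] mult_left_mono[OF _ L(1), of _ n]] L(1)
      by (intro mult_right_mono mult_mono) (auto simp: n_def)
    finally have "norm (g (\<gamma> t) *v r) \<le> P * n + (L * n) * (C * s) * K"
      unfolding gr using 1 norm_triangle_ineq4[of "- (chr g (\<gamma> t) (\<gamma>' t) - chr g (\<delta> t) (\<delta>' t))" "(g (\<gamma> t) - g (\<delta> t)) *v \<delta>'' t"]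
      unfolding norm_minus_cancel by linarith
    also have "\<dots> = (P + L * (C * s) * K) * n" by (simp add: algebra_simps)
    finally have "norm (g (\<gamma> t) *v r) \<le> l * (M * n)" unfolding M0(2) by simp
    then have "gip g (\<gamma> t) r r \<le> norm r * (l * (M * n))" unfolding gip_def
      by (rule order_trans[OF norm_cauchy_schwarz mult_left_mono[OF _ norm_ge_zero]])
    then have "(l * norm r) * norm r \<le> (l * norm r) * (M * n)"
      using l(2)[OF x(1), of r] by (simp add: power2_eq_square algebra_simps)
    then have "r \<noteq> 0 \<Longrightarrow> norm r \<le> M * n" using l(1) by (simp add: mult_le_cancel_left)
    then show ?thesis using M0(1) unfolding r_def[symmetric] n_def[symmetric] by (cases "r = 0") (auto simp: n_def)
  qed
  define h where "h t = (\<gamma> t - \<delta> t) \<bullet> (\<gamma> t - \<delta> t) + (\<gamma>' t - \<delta>' t) \<bullet> (\<gamma>' t - \<delta>' t)" for t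
  define h' where "h' t = 2 * ((\<gamma> t - \<delta> t) \<bullet> (\<gamma>' t - \<delta>' t)) + 2 * ((\<gamma>' t - \<delta>' t) \<bullet> (\<gamma>'' t - \<delta>'' t))" for t
  have dh: "(h has_real_derivative h' t) (at t within {a..b})" if t: "t \<in> {a..b}" for t
  proof -
    have 1: "((\<lambda>t. \<gamma> t - \<delta> t) has_vector_derivative \<gamma>' t - \<delta>' t) (at t within {a..b})"
      using G(3)[OF t] H(3)[OF t] by (rule has_vector_derivative_diff)
    have 2: "((\<lambda>t. \<gamma>' t - \<delta>' t) has_vector_derivative \<gamma>'' t - \<delta>'' t) (at t within {a..b})"
      using G(4)[OF t] H(4)[OF t] by (rule has_vector_derivative_diff)
    from has_vector_derivative_add[OF bounded_bilinear.has_vector_derivative[OF bounded_bilinear_inner 1 1] bounded_bilinear.has_vector_derivative[OF bounded_bilinear_inner 2 2]]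
    show ?thesis unfolding has_real_derivative_iff_has_vector_derivative h_def[abs_def] h'_def
      by (simp add: inner_commute)
  qed
  \<comment> \<open>With \<open>p\<close> and \<open>q\<close> the norms of the two differences,
    \<open>2 * p * q\<close> and \<open>q * q\<close> are both at most \<open>h t\<close>; the terms
    \<open>2 * p * q\<close>, \<open>M * (2 * p * q)\<close> and \<open>2 * M * q * q\<close> then
    add up to the factor \<open>1 + 3 * M\<close>.\<close>
  have le: "h' t \<le> (1 + 3 * M) * h t" if t: "t \<in> {a..b}" for t
  proof -
    let ?p = "norm (\<gamma> t - \<delta> t)" and ?q = "norm (\<gamma>' t - \<delta>' t)"
    have ht: "h t = ?p * ?p + ?q * ?q" unfolding h_def by (simp add: dot_square_norm power2_eq_square)
    have pq: "2 * (?p * ?q) \<le> h t" unfolding ht using sum_squares_bound[of ?p ?q] by (simp add: power2_eq_square)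
    have qq: "?q * ?q \<le> h t" unfolding ht by simp
    have "(\<gamma> t - \<delta> t) \<bullet> (\<gamma>' t - \<delta>' t) \<le> ?p * ?q" by (rule norm_cauchy_schwarz)
    moreover have "(\<gamma>' t - \<delta>' t) \<bullet> (\<gamma>'' t - \<delta>'' t) \<le> ?q * (M * (?p + ?q))"
      by (rule order_trans[OF norm_cauchy_schwarz]) (intro mult_left_mono acc t norm_ge_zero)
    ultimately have "h' t \<le> 2 * (?p * ?q) + M * (2 * (?p * ?q)) + 2 * (M * (?q * ?q))"
      unfolding h'_def by (simp add: algebra_simps)
    also have "\<dots> \<le> h t + M * h t + 2 * (M * h t)"
      using pq mult_left_mono[OF pq M0(1)] mult_left_mono[OF qq M0(1)] by linarith
    finally show ?thesis by (simp add: algebra_simps)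
  qed
  have "h a = 0" unfolding h_def using e by simp
  from Gronwall_zero[OF dh le this t] have "h t \<le> 0" .
  moreover have "(\<gamma> t - \<delta> t) \<bullet> (\<gamma> t - \<delta> t) \<ge> 0" "(\<gamma>' t - \<delta>' t) \<bullet> (\<gamma>' t - \<delta>' t) \<ge> 0" by auto
  ultimately have "(\<gamma> t - \<delta> t) \<bullet> (\<gamma> t - \<delta> t) = 0" "(\<gamma>' t - \<delta>' t) \<bullet> (\<gamma>' t - \<delta>' t) = 0" unfolding h_def by linarith+
  then show "\<gamma> t = \<delta> t" "\<gamma>' t = \<delta>' t" by auto
qed

text \<open>Unit speed bounds the acceleration uniformly, so one constant serves all geodesics at
  once. Chords of short geodesics therefore approximate initial directions uniformly, on which the
  continuity of directions rests.\<close>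

lemma unit_geodesic_Taylor:
  obtains C where "C > 0" "\<And>\<gamma> \<gamma>' a b t. rgeodesic g \<gamma> \<gamma>' a b \<Longrightarrow> gip g (\<gamma> a) (\<gamma>' a) (\<gamma>' a) = 1 \<Longrightarrow> t \<in> {a..b} \<Longrightarrow>
     norm (\<gamma> t - \<gamma> a - (t - a) *\<^sub>R \<gamma>' a) \<le> C * (t - a)\<^sup>2"
proof -
  obtain C where C: "C > 0" "\<And>x w a. x \<in> Dn \<Longrightarrow> g x *v a + chr g x w = 0 \<Longrightarrow> norm a \<le> C * gip g x w w" using chr_bound by metis
  show ?thesis
  proof (rule that[OF C(1)])
    fix \<gamma> \<gamma>' a b t assume geo: "rgeodesic g \<gamma> \<gamma>' a b" and un: "gip g (\<gamma> a) (\<gamma>' a) (\<gamma>' a) = 1" and t: "t \<in> {a..b}"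
    obtain \<gamma>'' where G: "a < b" "\<And>t. t \<in> {a..b} \<Longrightarrow> \<gamma> t \<in> Dn"
      "\<And>t. t \<in> {a..b} \<Longrightarrow> (\<gamma> has_vector_derivative \<gamma>' t) (at t within {a..b})"
      "\<And>t. t \<in> {a..b} \<Longrightarrow> (\<gamma>' has_vector_derivative \<gamma>'' t) (at t within {a..b})"
      "\<And>t. t \<in> {a..b} \<Longrightarrow> g (\<gamma> t) *v \<gamma>'' t + chr g (\<gamma> t) (\<gamma>' t) = 0"
      by (rule rgeodesicE[OF geo]) blast
    have n2: "norm (\<gamma>'' s) \<le> C" if s: "s \<in> {a..b}" for s
      using C(2)[OF G(2)[OF s] G(5)[OF s]] rgeodesic_constant_speed[OF geo s, of a] un G(1) by simp
    have v: "norm (\<gamma>' s - \<gamma>' a) \<le> C * (s - a)" if s: "s \<in> {a..b}" for s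
    proof -
      have "norm (\<gamma>' s - \<gamma>' a) \<le> C * norm (s - a)"
      proof (rule differentiable_bound[of "{a..b}"])
        show "(\<gamma>' has_derivative (\<lambda>h. h *\<^sub>R \<gamma>'' x)) (at x within {a..b})" if "x \<in> {a..b}" for x
          using G(4)[OF that] unfolding has_vector_derivative_def .
        show "onorm (\<lambda>h. h *\<^sub>R \<gamma>'' x) \<le> C" if "x \<in> {a..b}" for x
          by (rule onorm_le) (use mult_left_mono[OF n2[OF that] abs_ge_zero] in \<open>simp add: mult.commute\<close>)
      qed (use s in auto)
      then show ?thesis using s by simp
    qed
    have "norm ((\<gamma> t - t *\<^sub>R \<gamma>' a) - (\<gamma> a - a *\<^sub>R \<gamma>' a)) \<le> (C * (t - a)) * norm (t - a)"
    proof (rule differentiable_bound[of "{a..t}"])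
      show "((\<lambda>s. \<gamma> s - s *\<^sub>R \<gamma>' a) has_derivative (\<lambda>h. h *\<^sub>R (\<gamma>' x - \<gamma>' a))) (at x within {a..t})" if x: "x \<in> {a..t}" for x
      proof -
        have "(\<gamma> has_derivative (\<lambda>h. h *\<^sub>R \<gamma>' x)) (at x within {a..t})"
          using G(3)[of x] x t has_derivative_subset[of \<gamma> _ x "{a..b}" "{a..t}"] unfolding has_vector_derivative_def by auto
        then show ?thesis by (auto intro!: derivative_eq_intros simp: algebra_simps)
      qed
      show "onorm (\<lambda>h. h *\<^sub>R (\<gamma>' x - \<gamma>' a)) \<le> C * (t - a)" if x: "x \<in> {a..t}" for x
      proof -
        have "C * (x - a) \<le> C * (t - a)" using x C(1) by auto
        then have "norm (\<gamma>' x - \<gamma>' a) \<le> C * (t - a)" using v[of x] x t by force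
        then show ?thesis by (intro onorm_le) (auto simp: mult.commute intro: mult_left_mono)
      qed
    qed (use t in auto)
    moreover have "(\<gamma> t - t *\<^sub>R \<gamma>' a) - (\<gamma> a - a *\<^sub>R \<gamma>' a) = \<gamma> t - \<gamma> a - (t - a) *\<^sub>R \<gamma>' a" by (simp add: algebra_simps)
    ultimately show "norm (\<gamma> t - \<gamma> a - (t - a) *\<^sub>R \<gamma>' a) \<le> C * (t - a)\<^sup>2"
      using t by (simp add: power2_eq_square)
  qed
qed

end

section \<open>Strict convexity and the exponential map\<close>

context riem
begin

section \<open>Points reached by the geodesic flow\<close>

lemma flow_point_pos: "flow_point g x v t p \<Longrightarrow> t > 0"
  unfolding flow_point_def using rgeodesicD(1) by blast

lemma flow_point_in_Dn: "flow_point g x v t p \<Longrightarrow> x \<in> Dn \<and> p \<in> Dn"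
  unfolding flow_point_def using rgeodesicD(1,2) by (metis atLeastAtMost_iff less_eq_real_def)

lemma flow_point_unique:
  assumes "flow_point g x v t p" "flow_point g x v t q" shows "p = q"
proof -
  obtain \<gamma> \<gamma>' \<delta> \<delta>' where "rgeodesic g \<gamma> \<gamma>' 0 t" "\<gamma> 0 = x" "\<gamma>' 0 = v" "\<gamma> t = p"
    "rgeodesic g \<delta> \<delta>' 0 t" "\<delta> 0 = x" "\<delta>' 0 = v" "\<delta> t = q"
    using assms unfolding flow_point_def by blast
  then show ?thesis using rgeodesic_unique(1)[of \<gamma> \<gamma>' 0 t \<delta> \<delta>' t] flow_point_pos[OF assms(1)] by auto
qed

lemma rgeodesic_flow_point:
  assumes "rgeodesic g \<gamma> \<gamma>' a b" "s \<in> {a..b}" "t \<in> {a..b}" "s < t" "c > 0"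
  shows "flow_point g (\<gamma> s) (c *\<^sub>R \<gamma>' s) ((t - s) / c) (\<gamma> t)"
proof -
  have "rgeodesic g (\<lambda>r. \<gamma> (c * r + s)) (\<lambda>r. c *\<^sub>R \<gamma>' (c * r + s)) 0 ((t - s) / c)"
    by (rule rgeodesic_affine[OF assms(1)]) (use assms in \<open>auto simp: field_simps intro: order_trans[of _ s] add_nonneg_nonneg\<close>)
  then show ?thesis unfolding flow_point_def
    using assms(5) by (intro exI conjI) (assumption | simp)+
qed

lemma rgeodesic_flow_point_reverse:
  assumes "rgeodesic g \<gamma> \<gamma>' a b" "s \<in> {a..b}" "t \<in> {a..b}" "s < t" "c > 0"
  shows "flow_point g (\<gamma> t) (- (c *\<^sub>R \<gamma>' t)) ((t - s) / c) (\<gamma> s)"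
proof -
  have "rgeodesic g (\<lambda>r. \<gamma> ((- c) * r + t)) (\<lambda>r. (- c) *\<^sub>R \<gamma>' ((- c) * r + t)) 0 ((t - s) / c)"
  proof (rule rgeodesic_affine[OF assms(1)])
    fix r assume r: "r \<in> {0..(t - s) / c}"
    then have "c * r \<le> t - s" "c * r \<ge> 0" using assms(5) by (auto simp: field_simps)
    then show "- c * r + t \<in> {a..b}" using assms(2,3) by auto
  qed (use assms in auto)
  then show ?thesis unfolding flow_point_def
    using assms(5) by (intro exI conjI) (assumption | simp)+
qed

lemma flow_point_scale:
  assumes "flow_point g x v t p" "c > 0" shows "flow_point g x (c *\<^sub>R v) (t / c) p"
proof -
  obtain \<gamma> \<gamma>' where "rgeodesic g \<gamma> \<gamma>' 0 t" "\<gamma> 0 = x" "\<gamma>' 0 = v" "\<gamma> t = p"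
    using assms unfolding flow_point_def by blast
  then show ?thesis using rgeodesic_flow_point[of \<gamma> \<gamma>' 0 t 0 t c] flow_point_pos[OF assms(1)] assms(2) by auto
qed

lemma flow_point_zero: assumes "x \<in> Dn" "t > 0" shows "flow_point g x 0 t x"
proof -
  have "chr g x 0 = 0" using chr_scaleR[OF assms(1), of 0 0] by simp
  then have "rgeodesic g (\<lambda>_. x) (\<lambda>_. 0) 0 t"
    unfolding rgeodesic_def using assms by (auto intro!: exI[of _ "\<lambda>_. 0"])
  then show ?thesis unfolding flow_point_def by blast
qed

text \<open>The defining conditions force \<open>g x\<close> to map the normal to a negative
  multiple of \<open>x\<close>. Inner products with the normal thus become Euclidean ones with
  \<open>x\<close>, and the description by \<open>THE\<close> is resolved here once.\<close>

lemma inward_normal_props: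
  assumes x: "x \<in> sphere 0 1"
  obtains k where "k > 0" "g x *v inward_normal g x = - k *\<^sub>R x" "gip g x (inward_normal g x) (inward_normal g x) = 1"
proof -
  have xD: "x \<in> Dn" and nx: "x \<bullet> x = 1" using x by (auto simp: dot_square_norm)
  have lin: "linear ((*v) (g x))" by simp
  have "inj ((*v) (g x))" using g_inj[OF xD] by (auto intro: injI)
  then obtain y where y: "g x *v y = x" using linear_injective_imp_surjective[OF lin] unfolding surj_def by metis
  have y0: "y \<noteq> 0" using y nx by auto
  have yx: "y \<bullet> x > 0" using gip_pos[OF xD y0] unfolding gip_def y .
  \<comment> \<open>Normalises \<open>y\<close>, the preimage of \<open>x\<close>, whose squared
    length in the metric is \<open>y \<bullet> x\<close>.\<close>
  define k where "k = 1 / sqrt (y \<bullet> x)"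
  have k: "k > 0" unfolding k_def using yx by simp
  have kk: "k * k * (y \<bullet> x) = 1" unfolding k_def using yx by (simp add: field_simps)
  define n where "n = - k *\<^sub>R y"
  have gn: "g x *v n = - k *\<^sub>R x" unfolding n_def using y matrix_vector_mult_scaleR[of "g x" "-k" y] by simp
  have P: "gip g x n n = 1 \<and> n \<bullet> x < 0 \<and> (\<forall>w. w \<bullet> x = 0 \<longrightarrow> gip g x w n = 0)"
    unfolding gip_def gn using kk k yx by (auto simp: n_def)
  have "inward_normal g x = n" unfolding inward_normal_def
  proof (rule the_equality)
    show "gip g x n n = 1 \<and> n \<bullet> x < 0 \<and> (\<forall>w. w \<bullet> x = 0 \<longrightarrow> gip g x w n = 0)" by (rule P)
  next
    fix m assume m: "gip g x m m = 1 \<and> m \<bullet> x < 0 \<and> (\<forall>w. w \<bullet> x = 0 \<longrightarrow> gip g x w m = 0)"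
    define c where "c = x \<bullet> (g x *v m)"
    define w where "w = g x *v m - c *\<^sub>R x"
    have "x \<bullet> w = 0" unfolding w_def c_def by (simp add: inner_diff_right nx)
    then have wx: "w \<bullet> x = 0" by (simp add: inner_commute)
    then have "w \<bullet> (g x *v m) = 0" using m unfolding gip_def by blast
    moreover have "w \<bullet> w = w \<bullet> (g x *v m) - c * (w \<bullet> x)"
      by (subst (2) w_def) (simp add: inner_diff_right)
    ultimately have "w \<bullet> w = 0" using wx by simp
    then have "g x *v m = g x *v (c *\<^sub>R y)" unfolding w_def using y by (simp add: matrix_vector_mult_scaleR)
    then have mc: "m = c *\<^sub>R y" using g_inj[OF xD] by blast
    have "gip g x m m = c * c * (y \<bullet> x)" unfolding mc gip_linear by (simp add: gip_def y)
    then have "c * c = k * k" using m kk yx by (metis mult_right_cancel less_irrefl)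
    moreover have "c < 0" using m yx unfolding mc by (simp add: mult_less_0_iff)
    ultimately have "c = - k" using k by (smt (verit) square_eq_iff)
    then show "m = n" unfolding mc n_def by simp
  qed
  then show ?thesis using that[OF k] gn P by simp
qed

lemma gip_inward_normal_pos_iff:
  assumes "x \<in> sphere 0 1" shows "gip g x u (inward_normal g x) > 0 \<longleftrightarrow> u \<bullet> x < 0"
    "gip g x u (inward_normal g x) = 0 \<longleftrightarrow> u \<bullet> x = 0"
proof -
  obtain k where "k > 0" "g x *v inward_normal g x = - k *\<^sub>R x" using inward_normal_props[OF assms] by metis
  then show "gip g x u (inward_normal g x) > 0 \<longleftrightarrow> u \<bullet> x < 0" "gip g x u (inward_normal g x) = 0 \<longleftrightarrow> u \<bullet> x = 0"
    unfolding gip_def by (auto simp: zero_less_mult_iff mult_less_0_iff)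
qed

end

locale simple =
  fixes g :: "'n::finite rmetric"
  assumes simple: "simple_metric g"

sublocale simple \<subseteq> riem
  using simple by unfold_locales (simp add: simple_metric_def)

context simple
begin

text \<open>The quantity is half the second derivative of the squared Euclidean norm along the
  geodesic with tangential velocity \<open>w\<close> and acceleration \<open>a\<close>. Strict
  convexity means that such a geodesic bends out of the ball.\<close>

lemma second_fundamental_form_pos:
  assumes x: "x \<in> sphere 0 1" and w: "w \<bullet> x = 0" "w \<noteq> 0" and a: "g x *v a + chr g x w = 0"
  shows "x \<bullet> a + w \<bullet> w > 0"
proof -
  obtain k where k: "k > 0" "g x *v inward_normal g x = - k *\<^sub>R x" using inward_normal_props[OF x] by metis
  have xD: "x \<in> Dn" using x by auto
  have nx: "x \<bullet> x = 1" using x by (simp add: dot_square_norm)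
  have c: "chr g x w = - (g x *v a)" using a by (simp add: add_eq_0_iff)
  have "sff g x w > 0" using simple x w unfolding simple_metric_def strictly_convex_boundary_def by blast
  moreover have "inward_normal g x \<bullet> chr g x w = - gip g x a (inward_normal g x)"
    unfolding c using gip_sym[OF xD, of a "inward_normal g x"] unfolding gip_def by simp
  ultimately have "k * (a \<bullet> x) + k * (w \<bullet> w) > 0"
    unfolding sff_def gip_def k by (simp add: nx mult.commute)
  then have "k * (x \<bullet> a + w \<bullet> w) > 0" by (simp add: algebra_simps inner_commute)
  then show ?thesis using k(1) by (simp add: zero_less_mult_iff)
qed

text \<open>Half the squared Euclidean norm has derivative \<open>k\<close>. If \<open>k t\<close>
  is positive, or zero with convexity making \<open>k\<close> increase, the norm would exceed 1
  immediately after \<open>t\<close>.\<close>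

lemma geodesic_leaves_sphere_inward:
  assumes geo: "rgeodesic g \<gamma> \<gamma>' a b" and t: "t \<in> {a..b}" "t < b" and x: "\<gamma> t \<in> sphere 0 1" and nz: "\<gamma>' t \<noteq> 0"
  shows "\<gamma>' t \<bullet> \<gamma> t < 0"
proof (rule ccontr)
  assume c: "\<not> \<gamma>' t \<bullet> \<gamma> t < 0"
  obtain \<gamma>'' where G: "a < b" "\<And>t. t \<in> {a..b} \<Longrightarrow> \<gamma> t \<in> Dn"
    "\<And>t. t \<in> {a..b} \<Longrightarrow> (\<gamma> has_vector_derivative \<gamma>' t) (at t within {a..b})"
    "\<And>t. t \<in> {a..b} \<Longrightarrow> (\<gamma>' has_vector_derivative \<gamma>'' t) (at t within {a..b})"
    "\<And>t. t \<in> {a..b} \<Longrightarrow> g (\<gamma> t) *v \<gamma>'' t + chr g (\<gamma> t) (\<gamma>' t) = 0"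
    by (rule rgeodesicE[OF geo]) blast
  define k where "k s = \<gamma>' s \<bullet> \<gamma> s" for s
  have dk: "(k has_real_derivative (\<gamma>' s \<bullet> \<gamma>' s + \<gamma>'' s \<bullet> \<gamma> s)) (at s within {a..b})" if "s \<in> {a..b}" for s
    unfolding has_real_derivative_iff_has_vector_derivative k_def[abs_def]
    using bounded_bilinear.has_vector_derivative[OF bounded_bilinear_inner G(4)[OF that] G(3)[OF that]] .
  have "\<exists>d>0. \<forall>h>0. t + h \<in> {a..b} \<longrightarrow> h < d \<longrightarrow> 0 < k (t + h)"
  proof (cases "k t = 0")
    case True
    have "\<gamma>' t \<bullet> \<gamma>' t + \<gamma>'' t \<bullet> \<gamma> t > 0"
      using second_fundamental_form_pos[OF x _ nz G(5)[OF t(1)]] True unfolding k_def by (simp add: inner_commute)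
    from has_real_derivative_pos_inc_right[OF dk[OF t(1)] this] show ?thesis using True by simp
  next
    case False
    then have kt: "k t > 0" using c unfolding k_def by linarith
    have "continuous (at t within {a..b}) k" using dk[OF t(1)] DERIV_continuous by blast
    then obtain d where "d > 0" "\<And>s. s \<in> {a..b} \<Longrightarrow> dist s t < d \<Longrightarrow> dist (k s) (k t) < k t"
      using kt unfolding continuous_within_eps_delta by metis
    then show ?thesis by (intro exI[of _ d]) (auto simp: dist_real_def abs_if split: if_splits, smt (verit))
  qed
  then obtain d where d: "d > 0" "\<And>h. h > 0 \<Longrightarrow> t + h \<in> {a..b} \<Longrightarrow> h < d \<Longrightarrow> k (t + h) > 0" by blast
  define s where "s = min b (t + d / 2)"
  have s: "t < s" "s \<le> b" "s < t + d" unfolding s_def using t d by auto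
  have "\<exists>r\<in>{t<..<s}. \<gamma> s \<bullet> \<gamma> s - \<gamma> t \<bullet> \<gamma> t = (\<lambda>h. h *\<^sub>R (\<gamma> r \<bullet> \<gamma>' r + \<gamma>' r \<bullet> \<gamma> r)) (s - t)"
  proof (rule mvt_simple[OF s(1)])
    fix r assume r: "t \<le> r" "r \<le> s"
    then have r': "r \<in> {a..b}" using t s by auto
    have "((\<lambda>s. \<gamma> s \<bullet> \<gamma> s) has_vector_derivative (\<gamma> r \<bullet> \<gamma>' r + \<gamma>' r \<bullet> \<gamma> r)) (at r within {a..b})"
      using bounded_bilinear.has_vector_derivative[OF bounded_bilinear_inner G(3)[OF r'] G(3)[OF r']] .
    then have "((\<lambda>s. \<gamma> s \<bullet> \<gamma> s) has_vector_derivative (\<gamma> r \<bullet> \<gamma>' r + \<gamma>' r \<bullet> \<gamma> r)) (at r within {t..s})"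
      by (rule has_vector_derivative_within_subset) (use t s in auto)
    then show "((\<lambda>s. \<gamma> s \<bullet> \<gamma> s) has_derivative (\<lambda>h. h *\<^sub>R (\<gamma> r \<bullet> \<gamma>' r + \<gamma>' r \<bullet> \<gamma> r))) (at r within {t..s})"
      unfolding has_vector_derivative_def .
  qed
  then obtain r where r: "t < r" "r < s" "\<gamma> s \<bullet> \<gamma> s - \<gamma> t \<bullet> \<gamma> t = (s - t) * (2 * k r)"
    unfolding k_def by (auto simp: inner_commute)
  have "k r > 0" using d(2)[of "r - t"] r s t by auto
  then have "\<gamma> s \<bullet> \<gamma> s > \<gamma> t \<bullet> \<gamma> t" using r s by (smt (verit) mult_pos_pos)
  moreover have "\<gamma> t \<bullet> \<gamma> t = 1" using x by (simp add: dot_square_norm)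
  moreover have "\<gamma> s \<bullet> \<gamma> s \<le> 1" using G(2)[of s] s t by (simp add: dot_square_norm power_le_one)
  ultimately show False by linarith
qed

lemma geodesic_hits_sphere_outward:
  assumes geo: "rgeodesic g \<gamma> \<gamma>' a b" and t: "t \<in> {a..b}" "a < t" and x: "\<gamma> t \<in> sphere 0 1" and nz: "\<gamma>' t \<noteq> 0"
  shows "\<gamma>' t \<bullet> \<gamma> t > 0"
proof -
  have "rgeodesic g (\<lambda>s. \<gamma> ((-1) * s + (a + b))) (\<lambda>s. (-1) *\<^sub>R \<gamma>' ((-1) * s + (a + b))) a b"
    by (rule rgeodesic_affine[OF geo rgeodesicD(1)[OF geo]]) auto
  from geodesic_leaves_sphere_inward[OF this, of "a + b - t"] show ?thesis
    using t x nz by simp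
qed

lemma geodesic_interior:
  assumes geo: "rgeodesic g \<gamma> \<gamma>' a b" and t: "t \<in> {a<..<b}" and nz: "\<gamma>' t \<noteq> 0"
  shows "\<gamma> t \<in> ball 0 1"
proof -
  have "\<gamma> t \<notin> sphere 0 1"
    using geodesic_leaves_sphere_inward[OF geo, of t] geodesic_hits_sphere_outward[OF geo, of t] t nz by force
  moreover have "\<gamma> t \<in> Dn" using rgeodesicD(2)[OF geo] t by simp
  ultimately show ?thesis by (auto simp: dist_norm)
qed

section \<open>Logarithm, distance and direction of the connecting geodesic\<close>

definition rlog :: "real^'n \<Rightarrow> real^'n \<Rightarrow> real^'n" where "rlog x = inv_into (exp_dom g x) (expm g x)"
text \<open>The length of the unique connecting geodesic, not an infimum over curves; its triangle
  inequality has to be derived from the Gauss lemma.\<close>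

definition rdist :: "real^'n \<Rightarrow> real^'n \<Rightarrow> real" where "rdist x y = sqrt (gip g x (rlog x y) (rlog x y))"
text \<open>Division by zero makes this the zero vector for \<open>y = x\<close>, so that
  \<open>rlog x y = rdist x y *\<^sub>R udir x y\<close> holds for all pairs in the ball.\<close>

definition udir :: "real^'n \<Rightarrow> real^'n \<Rightarrow> real^'n" where "udir x y = (1 / rdist x y) *\<^sub>R rlog x y"

lemma expm_bij: "x \<in> Dn \<Longrightarrow> bij_betw (expm g x) (exp_dom g x) Dn"
  and expm_smooth: "x \<in> Dn \<Longrightarrow> sm_smooth_on (exp_dom g x) (expm g x)"
  and rlog_smooth: "x \<in> Dn \<Longrightarrow> sm_smooth_on Dn (rlog x)"
  using simple unfolding simple_metric_def sm_diffeo_def rlog_def by blast+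

lemma expm_eq: assumes "flow_point g x v 1 p" shows "v \<in> exp_dom g x" "expm g x v = p"
proof -
  show "v \<in> exp_dom g x" using assms unfolding exp_dom_def by blast
  show "expm g x v = p" unfolding expm_def using flow_point_unique assms by (metis someI)
qed

lemma flow_point_expm: "v \<in> exp_dom g x \<Longrightarrow> flow_point g x v 1 (expm g x v)"
  unfolding exp_dom_def using expm_eq(2) by blast

lemma rlog_in: "x \<in> Dn \<Longrightarrow> y \<in> Dn \<Longrightarrow> rlog x y \<in> exp_dom g x"
  and expm_rlog: "x \<in> Dn \<Longrightarrow> y \<in> Dn \<Longrightarrow> expm g x (rlog x y) = y"
  unfolding rlog_def using expm_bij[of x] by (auto simp: bij_betw_def intro: inv_into_into f_inv_into_f)

lemma flow_point_rlog: "x \<in> Dn \<Longrightarrow> y \<in> Dn \<Longrightarrow> flow_point g x (rlog x y) 1 y"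
  using flow_point_expm[OF rlog_in] expm_rlog by metis

lemma rlog_unique: assumes "flow_point g x v 1 y" shows "rlog x y = v"
proof -
  have "x \<in> Dn" using flow_point_in_Dn[OF assms] by blast
  then show ?thesis using expm_eq[OF assms] expm_bij[of x] unfolding rlog_def bij_betw_def by (metis inv_into_f_f)
qed

lemma rlog_self [simp]: "x \<in> Dn \<Longrightarrow> rlog x x = 0"
  using rlog_unique[OF flow_point_zero] by simp

lemma rlog_eq_0_iff: "x \<in> Dn \<Longrightarrow> y \<in> Dn \<Longrightarrow> rlog x y = 0 \<longleftrightarrow> x = y"
  using flow_point_rlog[of x y] flow_point_zero[of x 1] flow_point_unique[of x 0 1 x y] by auto

lemma rdist_nonneg: "x \<in> Dn \<Longrightarrow> rdist x y \<ge> 0"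
  unfolding rdist_def using gip_nonneg by simp

lemma rdist_eq_0_iff: "x \<in> Dn \<Longrightarrow> y \<in> Dn \<Longrightarrow> rdist x y = 0 \<longleftrightarrow> x = y"
  unfolding rdist_def using gip_eq_0_iff rlog_eq_0_iff by simp

lemma rdist_pos: "x \<in> Dn \<Longrightarrow> y \<in> Dn \<Longrightarrow> x \<noteq> y \<Longrightarrow> rdist x y > 0"
  using rdist_nonneg[of x y] rdist_eq_0_iff[of x y] by linarith

lemma rlog_eq: "x \<in> Dn \<Longrightarrow> y \<in> Dn \<Longrightarrow> rlog x y = rdist x y *\<^sub>R udir x y"
  unfolding udir_def using rdist_eq_0_iff[of x y] by (cases "x = y") auto

lemma rdist_square: "x \<in> Dn \<Longrightarrow> gip g x (rlog x y) (rlog x y) = (rdist x y)\<^sup>2"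
  unfolding rdist_def using gip_nonneg by simp

lemma udir_unit: "x \<in> Dn \<Longrightarrow> y \<in> Dn \<Longrightarrow> x \<noteq> y \<Longrightarrow> gip g x (udir x y) (udir x y) = 1"
  unfolding udir_def gip_linear rdist_square using rdist_pos[of x y] by (simp add: power2_eq_square)

lemma flow_point_udir: "x \<in> Dn \<Longrightarrow> y \<in> Dn \<Longrightarrow> x \<noteq> y \<Longrightarrow> flow_point g x (udir x y) (rdist x y) y"
  using flow_point_scale[OF flow_point_rlog, of x y "1 / rdist x y"] rdist_pos[of x y] unfolding udir_def by simp

text \<open>Injectivity of the exponential map leaves no other geodesic to compare with. This is how
  the times in the broken scattering relation are read as distances.\<close>

lemma flow_point_unit:
  assumes "flow_point g x v t y" "gip g x v v = 1"
  shows "rdist x y = t" "udir x y = v" "x \<noteq> y"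
proof -
  have t: "t > 0" using flow_point_pos[OF assms(1)] .
  have rlogE: "rlog x y = t *\<^sub>R v" using rlog_unique flow_point_scale[OF assms(1) t] t by simp
  show 1: "rdist x y = t" unfolding rdist_def rlogE gip_linear using assms(2) t by simp
  show "udir x y = v" unfolding udir_def rlogE 1 using t by simp
  have "x \<in> Dn" "y \<in> Dn" using flow_point_in_Dn[OF assms(1)] by auto
  then show "x \<noteq> y" using 1 t rdist_eq_0_iff by force
qed

lemma unit_geodesic:
  assumes geo: "rgeodesic g \<gamma> \<gamma>' a b" and unit: "gip g (\<gamma> a) (\<gamma>' a) (\<gamma>' a) = 1"
    and s: "s \<in> {a..b}" "t \<in> {a..b}" "s < t"
  shows "rdist (\<gamma> s) (\<gamma> t) = t - s" "rdist (\<gamma> t) (\<gamma> s) = t - s" "udir (\<gamma> s) (\<gamma> t) = \<gamma>' s" "udir (\<gamma> t) (\<gamma> s) = - \<gamma>' t" "\<gamma> s \<noteq> \<gamma> t"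
proof -
  have a: "a \<in> {a..b}" using rgeodesicD(1)[OF geo] by auto
  have "flow_point g (\<gamma> s) (\<gamma>' s) (t - s) (\<gamma> t)" "flow_point g (\<gamma> t) (- \<gamma>' t) (t - s) (\<gamma> s)"
    using rgeodesic_flow_point[OF geo s, of 1] rgeodesic_flow_point_reverse[OF geo s, of 1] by auto
  moreover have "gip g (\<gamma> s) (\<gamma>' s) (\<gamma>' s) = 1" "gip g (\<gamma> t) (- \<gamma>' t) (- \<gamma>' t) = 1"
    using rgeodesic_constant_speed[OF geo s(1) a] rgeodesic_constant_speed[OF geo s(2) a] unit by (auto simp: gip_linear)
  ultimately show "rdist (\<gamma> s) (\<gamma> t) = t - s" "rdist (\<gamma> t) (\<gamma> s) = t - s" "udir (\<gamma> s) (\<gamma> t) = \<gamma>' s" "udir (\<gamma> t) (\<gamma> s) = - \<gamma>' t" "\<gamma> s \<noteq> \<gamma> t"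
    using flow_point_unit by auto
qed

lemma unit_geodesic_exists:
  assumes "x \<in> Dn" "y \<in> Dn" "x \<noteq> y"
  obtains \<gamma> \<gamma>' where "rgeodesic g \<gamma> \<gamma>' 0 (rdist x y)" "\<gamma> 0 = x" "\<gamma> (rdist x y) = y" "\<gamma>' 0 = udir x y" "\<gamma>' (rdist x y) = - udir y x"
    "gip g (\<gamma> 0) (\<gamma>' 0) (\<gamma>' 0) = 1"
proof -
  obtain \<gamma> \<gamma>' where G: "rgeodesic g \<gamma> \<gamma>' 0 (rdist x y)" "\<gamma> 0 = x" "\<gamma>' 0 = udir x y" "\<gamma> (rdist x y) = y"
    using flow_point_udir[OF assms] unfolding flow_point_def by blast
  have u: "gip g (\<gamma> 0) (\<gamma>' 0) (\<gamma>' 0) = 1" using udir_unit[OF assms] G by simp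
  have "\<gamma>' (rdist x y) = - udir y x" using unit_geodesic(4)[OF G(1) u, of 0 "rdist x y"] rdist_pos[OF assms] G by simp
  then show ?thesis using that G u by blast
qed

lemma rdist_sym: assumes "x \<in> Dn" "y \<in> Dn" shows "rdist x y = rdist y x"
proof (cases "x = y")
  case False
  from unit_geodesic_exists[OF assms False] obtain \<gamma> \<gamma>' where G: "rgeodesic g \<gamma> \<gamma>' 0 (rdist x y)" "\<gamma> 0 = x" "\<gamma> (rdist x y) = y"
    "gip g (\<gamma> 0) (\<gamma>' 0) (\<gamma>' 0) = 1" by metis
  then show ?thesis using unit_geodesic(2)[OF G(1,4), of 0 "rdist x y"] rdist_pos[OF assms False] by simp
qed simp

lemma udir_inward:
  assumes "x \<in> sphere 0 1" "y \<in> Dn" "x \<noteq> y" shows "udir x y \<bullet> x < 0"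
proof -
  have x: "x \<in> Dn" using assms by auto
  from unit_geodesic_exists[OF x assms(2,3)] obtain \<gamma> \<gamma>' where G: "rgeodesic g \<gamma> \<gamma>' 0 (rdist x y)" "\<gamma> 0 = x" "\<gamma>' 0 = udir x y" by metis
  have "udir x y \<noteq> 0" using udir_unit[OF x assms(2,3)] by auto
  then show ?thesis using geodesic_leaves_sphere_inward[OF G(1), of 0] G rdist_pos[OF x assms(2,3)] assms(1) by simp
qed

end

section \<open>The Gauss lemma\<close>

context simple
begin

lemma rgeodesic_rlog:
  assumes "x \<in> Dn" "y \<in> Dn"
  obtains \<gamma> \<gamma>' where "rgeodesic g \<gamma> \<gamma>' 0 1" "\<gamma> 0 = x" "\<gamma> 1 = y" "\<gamma>' 0 = rlog x y"
    "\<And>t. t \<in> {0..1} \<Longrightarrow> rlog x (\<gamma> t) = t *\<^sub>R rlog x y" "\<And>t. t \<in> {0<..1} \<Longrightarrow> rlog (\<gamma> t) x = - (t *\<^sub>R \<gamma>' t)"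
proof -
  obtain \<gamma> \<gamma>' where G: "rgeodesic g \<gamma> \<gamma>' 0 1" "\<gamma> 0 = x" "\<gamma> 1 = y" "\<gamma>' 0 = rlog x y"
    using flow_point_rlog[OF assms] unfolding flow_point_def by blast
  show ?thesis
  proof (rule that[OF G])
    fix t :: real assume t: "t \<in> {0..1}"
    show "rlog x (\<gamma> t) = t *\<^sub>R rlog x y"
    proof (cases "t = 0")
      case False
      then have "flow_point g x (t *\<^sub>R rlog x y) 1 (\<gamma> t)"
        using rgeodesic_flow_point[OF G(1), of 0 t t] G t by simp
      then show ?thesis by (rule rlog_unique)
    qed (use G assms in simp)
  next
    fix t :: real assume t: "t \<in> {0<..1}"
    then have "flow_point g (\<gamma> t) (- (t *\<^sub>R \<gamma>' t)) 1 x"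
      using rgeodesic_flow_point_reverse[OF G(1), of 0 t t] G by simp
    then show "rlog (\<gamma> t) x = - (t *\<^sub>R \<gamma>' t)" by (rule rlog_unique)
  qed
qed

section \<open>The exponential map over the open ball\<close>

lemma rlog_continuous: "x \<in> Dn \<Longrightarrow> continuous_on Dn (rlog x)"
  using rlog_smooth sm_smooth_on_imp_continuous_on by blast

lemma rlog_inj: "x \<in> Dn \<Longrightarrow> inj_on (rlog x) Dn"
  by (metis expm_rlog inj_onI)

text \<open>Invariance of domain provides an open set on which \<open>expm g x\<close> has full
  derivatives and its second derivatives commute, although \<open>exp_dom g x\<close> itself is
  closed.\<close>

lemma open_rlog_ball: assumes "x \<in> Dn" shows "open (rlog x ` ball 0 1)"
proof (rule invariance_of_domain_gen[OF open_ball])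
  show "continuous_on (ball 0 1) (rlog x)" using rlog_continuous[OF assms] ball_subset_cball by (rule continuous_on_subset)
  show "inj_on (rlog x) (ball 0 1)" using rlog_inj[OF assms] ball_subset_cball by (rule inj_on_subset)
qed simp

lemma rlog_ball_subset: "x \<in> Dn \<Longrightarrow> rlog x ` ball 0 1 \<subseteq> exp_dom g x"
  using rlog_in by (auto simp: subset_eq)

text \<open>By strict convexity a nonconstant geodesic ending in the open ball has no boundary point
  except possibly its start. Time 0 is excluded since \<open>x\<close> may lie on the
  sphere.\<close>

lemma rlog_ball_star:
  assumes x: "x \<in> Dn" and v: "v \<in> rlog x ` ball 0 1" and t: "t \<in> {0<..1}"
  shows "t *\<^sub>R v \<in> rlog x ` ball 0 1"
proof (cases "v = 0 \<or> t = 1")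
  case False
  obtain y where y: "y \<in> ball 0 1" "v = rlog x y" using v by blast
  have yD: "y \<in> Dn" using y by auto
  obtain \<gamma> \<gamma>' where G: "rgeodesic g \<gamma> \<gamma>' 0 1" "\<gamma> 0 = x" "\<gamma>' 0 = rlog x y" "\<And>t. t \<in> {0..1} \<Longrightarrow> rlog x (\<gamma> t) = t *\<^sub>R rlog x y"
    using rgeodesic_rlog[OF x yD] by metis
  have "\<gamma>' t \<noteq> 0"
    using rgeodesic_constant_speed[OF G(1), of 0 t] t G(2,3) False y gip_eq_0_iff[OF x, of v] by auto
  then have "\<gamma> t \<in> ball 0 1" using geodesic_interior[OF G(1), of t] t False by auto
  then show ?thesis using G(4)[of t] t y by (intro image_eqI[of _ _ "\<gamma> t"]) auto
qed (use v in auto)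

lemma geodesic_in_ball_rlog:
  assumes x: "x \<in> Dn" and v: "v \<in> rlog x ` ball 0 1"
  obtains \<gamma> \<gamma>' where "rgeodesic g \<gamma> \<gamma>' 0 1" "\<gamma> 0 = x" "\<gamma>' 0 = v"
    "\<And>t. t \<in> {0..1} \<Longrightarrow> \<gamma> t = expm g x (t *\<^sub>R v)" "\<And>t. t \<in> {0<..1} \<Longrightarrow> rlog (\<gamma> t) x = - (t *\<^sub>R \<gamma>' t)"
proof -
  obtain y where y: "y \<in> ball 0 1" "v = rlog x y" using v by blast
  have yD: "y \<in> Dn" using y by auto
  obtain \<gamma> \<gamma>' where G: "rgeodesic g \<gamma> \<gamma>' 0 1" "\<gamma> 0 = x" "\<gamma>' 0 = rlog x y" "\<And>t. t \<in> {0..1} \<Longrightarrow> rlog x (\<gamma> t) = t *\<^sub>R rlog x y"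
    "\<And>t. t \<in> {0<..1} \<Longrightarrow> rlog (\<gamma> t) x = - (t *\<^sub>R \<gamma>' t)"
    using rgeodesic_rlog[OF x yD] by metis
  show ?thesis
  proof (rule that[OF G(1,2)])
    show "\<gamma>' 0 = v" using G y by simp
    fix t :: real assume t: "t \<in> {0..1}"
    show "\<gamma> t = expm g x (t *\<^sub>R v)" using expm_rlog[OF x rgeodesicD(2)[OF G(1) t]] G(4)[OF t] y by simp
  qed (use G in auto)
qed

definition dexp :: "real^'n \<Rightarrow> real^'n \<Rightarrow> real^'n \<Rightarrow> real^'n" where
  "dexp x v = frechet_derivative (expm g x) (at v within rlog x ` ball 0 1)"

lemma dexp: assumes x: "x \<in> Dn" and v: "v \<in> rlog x ` ball 0 1" shows "(expm g x has_derivative dexp x v) (at v)"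
proof -
  have "(expm g x has_derivative dexp x v) (at v within rlog x ` ball 0 1)" unfolding dexp_def
    using sm_smooth_on_has_frechet_derivative[OF sm_smooth_on_subset[OF expm_smooth[OF x] rlog_ball_subset[OF x]] v] .
  then show ?thesis using at_within_open[OF v open_rlog_ball[OF x]] by simp
qed

lemma dexp_smooth: assumes x: "x \<in> Dn" shows "sm_smooth_on (rlog x ` ball 0 1) (\<lambda>v. dexp x v h)"
  unfolding dexp_def
  by (rule sm_smooth_on_frechet_derivative[OF sm_smooth_on_subset[OF expm_smooth[OF x] rlog_ball_subset[OF x]] cone_set_open[OF open_rlog_ball[OF x]]])

definition ddexp :: "real^'n \<Rightarrow> real^'n \<Rightarrow> real^'n \<Rightarrow> real^'n \<Rightarrow> real^'n" where
  "ddexp x h v = frechet_derivative (\<lambda>v. dexp x v h) (at v within rlog x ` ball 0 1)"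

lemma ddexp: assumes x: "x \<in> Dn" and v: "v \<in> rlog x ` ball 0 1" shows "((\<lambda>v. dexp x v h) has_derivative ddexp x h v) (at v)"
proof -
  have "((\<lambda>v. dexp x v h) has_derivative ddexp x h v) (at v within rlog x ` ball 0 1)" unfolding ddexp_def
    using sm_smooth_on_has_frechet_derivative[OF dexp_smooth[OF x] v] .
  then show ?thesis using at_within_open[OF v open_rlog_ball[OF x]] by simp
qed

text \<open>Exchanges the derivative along a radial geodesic with the derivative across a family of
  them, the role played by the symmetry of the connection in the usual proof of the Gauss
  lemma.\<close>

lemma ddexp_sym: assumes x: "x \<in> Dn" and v: "v \<in> rlog x ` ball 0 1" shows "ddexp x h v k = ddexp x k v h"
proof (rule second_derivative_symmetric[OF open_rlog_ball[OF x] v dexp[OF x] ddexp[OF x] ddexp[OF x]])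
  have "continuous_on (rlog x ` ball 0 1) (\<lambda>v. ddexp x h v k)" for h k unfolding ddexp_def
    by (rule sm_smooth_on_imp_continuous_on[OF sm_smooth_on_frechet_derivative[OF dexp_smooth[OF x] cone_set_open[OF open_rlog_ball[OF x]]]])
  then show "continuous_on (rlog x ` ball 0 1) (\<lambda>v. ddexp x h v k)" "continuous_on (rlog x ` ball 0 1) (\<lambda>v. ddexp x k v h)" by blast+
qed

lemma linear_dexp: "x \<in> Dn \<Longrightarrow> v \<in> rlog x ` ball 0 1 \<Longrightarrow> linear (dexp x v)"
  using dexp has_derivative_linear by blast

lemma geodesic_velocity_dexp:
  assumes x: "x \<in> Dn" and v: "v \<in> rlog x ` ball 0 1" and G: "rgeodesic g \<gamma> \<gamma>' 0 1" "\<And>t. t \<in> {0..1} \<Longrightarrow> \<gamma> t = expm g x (t *\<^sub>R v)"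
    and t: "t \<in> {0<..1}"
  shows "\<gamma>' t = dexp x (t *\<^sub>R v) v"
proof -
  have tv: "t *\<^sub>R v \<in> rlog x ` ball 0 1" by (rule rlog_ball_star[OF x v t])
  have 1: "((\<lambda>t. t *\<^sub>R v) has_derivative (\<lambda>h. h *\<^sub>R v)) (at t within {0..1})" by (auto intro!: derivative_eq_intros)
  have "((\<lambda>t. expm g x (t *\<^sub>R v)) has_derivative (\<lambda>h. dexp x (t *\<^sub>R v) (h *\<^sub>R v))) (at t within {0..1})"
    by (rule has_derivative_compose[OF 1 dexp[OF x tv]])
  then have "((\<lambda>t. expm g x (t *\<^sub>R v)) has_vector_derivative dexp x (t *\<^sub>R v) v) (at t within {0..1})"
    unfolding has_vector_derivative_def using linear_dexp[OF x tv] by (simp add: linear_cmul)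
  then have "(\<gamma> has_vector_derivative dexp x (t *\<^sub>R v) v) (at t within {0..1})"
    by (rule has_vector_derivative_transform[rotated 2]) (use G t in auto)
  then show ?thesis using rgeodesicD(3)[OF G(1), of t] t
    by (intro vector_derivative_unique_within_closed_interval[of 0 1 t]) auto
qed

lemma dexp_speed:
  assumes x: "x \<in> Dn" and v: "v \<in> rlog x ` ball 0 1"
  shows "gip g (expm g x v) (dexp x v v) (dexp x v v) = gip g x v v"
proof -
  obtain \<gamma> \<gamma>' where G: "rgeodesic g \<gamma> \<gamma>' 0 1" "\<gamma> 0 = x" "\<gamma>' 0 = v" "\<And>t. t \<in> {0..1} \<Longrightarrow> \<gamma> t = expm g x (t *\<^sub>R v)"
    by (rule geodesic_in_ball_rlog[OF x v]) blast
  show ?thesis using rgeodesic_constant_speed[OF G(1), of 1 0] geodesic_velocity_dexp[OF x v G(1,4), of 1] G(2,3) G(4)[of 1] by simp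
qed

text \<open>The derivative of the conserved speed along the variation \<open>s \<mapsto> t (v + s h)\<close> of a radial geodesic.\<close>
lemma dexp_speed_variation:
  assumes x: "x \<in> Dn" and v: "v \<in> rlog x ` ball 0 1" and t: "t \<in> {0<..1}"
  defines "w \<equiv> t *\<^sub>R v"
  shows "2 * gip g (expm g x w) (dexp x w v) (dexp x w h + t *\<^sub>R ddexp x v w h)
     + dexp x w v \<bullet> (mderiv g (expm g x w) (t *\<^sub>R dexp x w h) *v dexp x w v) = 2 * gip g x v h"
proof -
  define B where "B = rlog x ` ball 0 1"
  have B: "open B" unfolding B_def by (rule open_rlog_ball[OF x])
  have w: "w \<in> B" unfolding w_def B_def by (rule rlog_ball_star[OF x v t])
  have t0: "t > 0" using t by simp
  define l where "l s = w + s *\<^sub>R t *\<^sub>R h" for s :: real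
  define S where "S = l -` B"
  have l': "(l has_derivative (\<lambda>r. r *\<^sub>R t *\<^sub>R h)) (at s)" for s unfolding l_def[abs_def] by (auto intro!: derivative_eq_intros)
  have S: "open S" unfolding S_def l_def[abs_def] by (intro open_vimage[OF B] continuous_intros)
  have S0: "0 \<in> S" unfolding S_def l_def using w by simp
  have l0: "l 0 = w" unfolding l_def by simp
  have wB: "w \<in> rlog x ` ball 0 1" using w unfolding B_def .
  have xw: "expm g x w \<in> Dn" using wB expm_rlog[OF x] by (auto simp: subset_eq)
  have Bx: "z \<in> B \<Longrightarrow> expm g x z \<in> Dn" for z unfolding B_def using expm_rlog[OF x] by auto
  \<comment> \<open>\<open>l s\<close> equals \<open>t *\<^sub>R (v + s *\<^sub>R h)\<close>, so
    \<open>u s\<close> is the velocity at time \<open>t\<close> of the geodesic with initial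
    velocity \<open>v + s *\<^sub>R h\<close>. Its squared length is therefore an explicit quadratic
    polynomial in \<open>s\<close>; both descriptions are differentiated at 0.\<close>
  define u where "u s = dexp x (l s) v + s *\<^sub>R dexp x (l s) h" for s
  have du: "((\<lambda>s. dexp x (l s) k) has_vector_derivative ddexp x k w (t *\<^sub>R h)) (at 0)" for k
  proof -
    have "((\<lambda>s. dexp x (l s) k) has_derivative (\<lambda>r. ddexp x k w (r *\<^sub>R t *\<^sub>R h))) (at 0)"
      using has_derivative_compose[OF l'[of 0], of "\<lambda>v. dexp x v k" "ddexp x k w"] ddexp[OF x wB, of k] l0 by simp
    then show ?thesis unfolding has_vector_derivative_def
      using has_derivative_linear[OF ddexp[OF x wB, of k]] by (simp add: linear_cmul)
  qed
  have u': "(u has_vector_derivative (ddexp x v w (t *\<^sub>R h) + dexp x w h)) (at 0)"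
    unfolding u_def[abs_def]
    using has_vector_derivative_add[OF du[of v] has_vector_derivative_scaleR[OF DERIV_ident du[of h]]] l0 by simp
  have c': "((\<lambda>s. expm g x (l s)) has_vector_derivative (t *\<^sub>R dexp x w h)) (at 0)"
  proof -
    have "((\<lambda>s. expm g x (l s)) has_derivative (\<lambda>r. dexp x w (r *\<^sub>R t *\<^sub>R h))) (at 0)"
      using has_derivative_compose[OF l'[of 0], of "expm g x" "dexp x w"] dexp[OF x wB] l0 by simp
    then show ?thesis unfolding has_vector_derivative_def
      using linear_dexp[OF x wB] by (simp add: linear_cmul)
  qed
  have at0: "at 0 within S = at 0" using at_within_open[OF S0 S] .
  have dL: "((\<lambda>s. gip g (expm g x (l s)) (u s) (u s)) has_vector_derivative
     (gip g (expm g x (l 0)) (ddexp x v w (t *\<^sub>R h) + dexp x w h) (u 0) + u 0 \<bullet> (mderiv g (expm g x (l 0)) (t *\<^sub>R dexp x w h) *v u 0)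
      + gip g (expm g x (l 0)) (u 0) (ddexp x v w (t *\<^sub>R h) + dexp x w h))) (at 0 within S)"
  proof (rule gip_has_vector_derivative)
    show "((\<lambda>s. expm g x (l s)) has_vector_derivative (t *\<^sub>R dexp x w h)) (at 0 within S)" unfolding at0 by (rule c')
    show "(\<lambda>s. expm g x (l s)) ` S \<subseteq> Dn" using Bx by (auto simp: S_def)
  qed (use S0 in \<open>simp_all only: at0 u'\<close>)
  have eq: "gip g (expm g x (l s)) (u s) (u s) = gip g x (v + s *\<^sub>R h) (v + s *\<^sub>R h)" if s: "s \<in> S" for s
  proof -
    have ls: "l s \<in> rlog x ` ball 0 1" using s unfolding S_def B_def by simp
    have lt: "l s = t *\<^sub>R (v + s *\<^sub>R h)" unfolding l_def w_def by (simp add: algebra_simps)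
    have "dexp x (l s) (l s) = t *\<^sub>R dexp x (l s) (v + s *\<^sub>R h)"
      using linear_cmul[OF linear_dexp[OF x ls], of t "v + s *\<^sub>R h"] lt by simp
    also have "\<dots> = t *\<^sub>R u s" unfolding u_def using linear_dexp[OF x ls] by (simp add: linear_add linear_cmul)
    finally have "gip g (expm g x (l s)) (t *\<^sub>R u s) (t *\<^sub>R u s) = gip g x (l s) (l s)" using dexp_speed[OF x ls] by simp
    then show ?thesis unfolding lt gip_scaleR_left gip_scaleR_right using t0 by simp
  qed
  have "((\<lambda>s. gip g x (v + s *\<^sub>R h) (v + s *\<^sub>R h)) has_vector_derivative (2 * gip g x v h)) (at 0)"
  proof -
    have "(\<lambda>s. gip g x (v + s *\<^sub>R h) (v + s *\<^sub>R h)) = (\<lambda>s. gip g x v v + 2 * s * gip g x v h + s * s * gip g x h h)"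
      using gip_sym[OF x, of h v] by (auto simp: gip_linear algebra_simps)
    then show ?thesis unfolding has_real_derivative_iff_has_vector_derivative[symmetric]
      by (auto intro!: derivative_eq_intros)
  qed
  then have dR: "((\<lambda>s. gip g x (v + s *\<^sub>R h) (v + s *\<^sub>R h)) has_vector_derivative (2 * gip g x v h)) (at 0 within S)" using at0 by simp
  have "((\<lambda>s. gip g x (v + s *\<^sub>R h) (v + s *\<^sub>R h)) has_vector_derivative
     (gip g (expm g x (l 0)) (ddexp x v w (t *\<^sub>R h) + dexp x w h) (u 0) + u 0 \<bullet> (mderiv g (expm g x (l 0)) (t *\<^sub>R dexp x w h) *v u 0)
      + gip g (expm g x (l 0)) (u 0) (ddexp x v w (t *\<^sub>R h) + dexp x w h))) (at 0 within S)"
    by (rule has_vector_derivative_transform[OF S0 _ dL]) (simp only: eq)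
  then have "gip g (expm g x (l 0)) (ddexp x v w (t *\<^sub>R h) + dexp x w h) (u 0) + u 0 \<bullet> (mderiv g (expm g x (l 0)) (t *\<^sub>R dexp x w h) *v u 0)
      + gip g (expm g x (l 0)) (u 0) (ddexp x v w (t *\<^sub>R h) + dexp x w h) = 2 * gip g x v h"
    using dR unfolding at0 by (rule vector_derivative_unique_at)
  moreover have "u 0 = dexp x w v" unfolding u_def l0 by simp
  moreover have "ddexp x v w (t *\<^sub>R h) = t *\<^sub>R ddexp x v w h"
    using has_derivative_linear[OF ddexp[OF x wB, of v]] by (simp add: linear_cmul)
  ultimately have "gip g (expm g x w) (t *\<^sub>R ddexp x v w h + dexp x w h) (dexp x w v)
      + dexp x w v \<bullet> (mderiv g (expm g x w) (t *\<^sub>R dexp x w h) *v dexp x w v)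
      + gip g (expm g x w) (dexp x w v) (t *\<^sub>R ddexp x v w h + dexp x w h) = 2 * gip g x v h"
    unfolding l0 by simp
  then show ?thesis
    using gip_sym[OF xw, of "t *\<^sub>R ddexp x v w h + dexp x w h" "dexp x w v"] by (simp add: add.commute)
qed

end

text \<open>Applied where a limit can be recognised only through equations that every cluster point
  satisfies.\<close>

lemma compact_LIMSEQ_unique_limit:
  fixes f :: "nat \<Rightarrow> 'a::metric_space"
  assumes K: "compact K" "\<And>k. f k \<in> K" and lim: "\<And>r l. strict_mono r \<Longrightarrow> (f \<circ> r) \<longlonglongrightarrow> l \<Longrightarrow> l = m"
  shows "f \<longlonglongrightarrow> m"
proof (rule ccontr)
  assume "\<not> f \<longlonglongrightarrow> m"
  then obtain e where e: "e > 0" "\<And>N. \<exists>n\<ge>N. dist (f n) m \<ge> e"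
    unfolding lim_sequentially by (meson not_le)
  have "infinite {n. dist (f n) m \<ge> e}"
    unfolding infinite_nat_iff_unbounded_le using e(2) by auto
  then obtain r :: "nat \<Rightarrow> nat" where r: "strict_mono r" "\<And>n. dist (f (r n)) m \<ge> e"
    using infinite_enumerate by blast
  obtain l r' where l: "strict_mono r'" "((f \<circ> r) \<circ> r') \<longlonglongrightarrow> l"
    using K unfolding compact_def by (metis comp_apply)
  then have "l = m" using lim[of "r \<circ> r'" l] r(1) strict_mono_o by (metis comp_assoc)
  then have "(\<lambda>n. dist (f (r (r' n))) m) \<longlonglongrightarrow> 0" using tendsto_dist[OF l(2) tendsto_const[of m]] by (simp add: o_def)
  then have "e \<le> 0" by (rule LIMSEQ_le_const) (use r in auto)
  then show False using e by simp
qed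

context simple
begin

text \<open>For \<open>x\<close> on the sphere, 0 is not in the open image of the ball, so
  continuity of \<open>dexp\<close> says nothing there. The local smooth extension of
  \<open>expm g x\<close> around 0 supplies the limit.\<close>

lemma dexp_bounded_near_zero:
  assumes x: "x \<in> Dn" and v: "v \<in> rlog x ` ball 0 1"
  obtains k where "((\<lambda>t. dexp x (t *\<^sub>R v) h) \<longlongrightarrow> k) (at_right 0)"
proof -
  have "0 \<in> exp_dom g x" using rlog_in[OF x x] x by simp
  from sm_smooth_on_local_derivative[OF expm_smooth[OF x] this]
  obtain V F F' where V: "open V" "0 \<in> V" "\<And>z. z \<in> V \<Longrightarrow> (F has_derivative F' z) (at z)"
     "\<And>z. z \<in> exp_dom g x \<inter> V \<Longrightarrow> (expm g x has_derivative F' z) (at z within exp_dom g x)"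
     "\<And>h k. sm_Ck k V (\<lambda>z. F' z h)" by metis
  have "continuous_on V (\<lambda>z. F' z h)" using V(5)[of 0 h] by simp
  then have "isCont (\<lambda>z. F' z h) 0" using V continuous_on_eq_continuous_at by blast
  then have c: "((\<lambda>z. F' z h) \<longlongrightarrow> F' 0 h) (nhds 0)" by (simp add: isCont_def tendsto_nhds_iff)
  have t0: "((\<lambda>t. t *\<^sub>R v) \<longlongrightarrow> 0) (at_right 0)" by (auto intro!: tendsto_eq_intros)
  have lim: "((\<lambda>t. F' (t *\<^sub>R v) h) \<longlongrightarrow> F' 0 h) (at_right 0)" using filterlim_compose[OF c t0] .
  have "eventually (\<lambda>t. t *\<^sub>R v \<in> V) (at_right 0)" using topological_tendstoD[OF t0 V(1)] V(2) by simp
  moreover have "eventually (\<lambda>t::real. t \<in> {0<..<1}) (at_right 0)" by (rule eventually_at_right_real) simp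
  ultimately have "eventually (\<lambda>t. F' (t *\<^sub>R v) h = dexp x (t *\<^sub>R v) h) (at_right 0)"
  proof eventually_elim
    case (elim t)
    have B: "t *\<^sub>R v \<in> rlog x ` ball 0 1" using rlog_ball_star[OF x v] elim by auto
    then have "(expm g x has_derivative F' (t *\<^sub>R v)) (at (t *\<^sub>R v) within rlog x ` ball 0 1)"
      using V(4)[of "t *\<^sub>R v"] elim rlog_ball_subset[OF x] has_derivative_subset by blast
    then have "(expm g x has_derivative F' (t *\<^sub>R v)) (at (t *\<^sub>R v))" using at_within_open[OF B open_rlog_ball[OF x]] by simp
    then show ?case using dexp[OF x B] has_derivative_unique by metis
  qed
  then have "((\<lambda>t. dexp x (t *\<^sub>R v) h) \<longlongrightarrow> F' 0 h) (at_right 0)" using lim tendsto_cong by fast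
  then show ?thesis by (rule that)
qed

text \<open>\<open>J\<close> is the Jacobi field of the variation with initial velocities
  \<open>v + s *\<^sub>R h\<close>. Its inner product with the velocity has the constant derivative
  \<open>gip g x v h\<close> by conservation of speed, and it tends to 0 at time 0; time 1 gives the
  identity.\<close>

lemma Gauss_lemma:
  assumes x: "x \<in> Dn" and y: "y \<in> ball 0 1"
  shows "gip g y (- rlog y x) (dexp x (rlog x y) h) = gip g x (rlog x y) h"
proof -
  define v where "v = rlog x y"
  have yD: "y \<in> Dn" using y by auto
  have v: "v \<in> rlog x ` ball 0 1" unfolding v_def using y by blast
  obtain \<gamma> \<gamma>' where G0: "rgeodesic g \<gamma> \<gamma>' 0 1" "\<gamma> 0 = x" "\<gamma>' 0 = v" "\<And>t. t \<in> {0..1} \<Longrightarrow> \<gamma> t = expm g x (t *\<^sub>R v)"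
     "\<And>t. t \<in> {0<..1} \<Longrightarrow> rlog (\<gamma> t) x = - (t *\<^sub>R \<gamma>' t)"
    by (rule geodesic_in_ball_rlog[OF x v]) blast
  have y1: "\<gamma> 1 = y" using G0(4)[of 1] expm_rlog[OF x yD] v_def by simp
  have vel: "\<gamma>' t = dexp x (t *\<^sub>R v) v" if "t \<in> {0<..1}" for t
    by (rule geodesic_velocity_dexp[OF x v G0(1,4) that])
  obtain \<gamma>'' where G: "\<And>t. t \<in> {0..1} \<Longrightarrow> \<gamma> t \<in> Dn"
    "\<And>t. t \<in> {0..1} \<Longrightarrow> (\<gamma> has_vector_derivative \<gamma>' t) (at t within {0..1})"
    "\<And>t. t \<in> {0..1} \<Longrightarrow> (\<gamma>' has_vector_derivative \<gamma>'' t) (at t within {0..1})"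
    "\<And>t. t \<in> {0..1} \<Longrightarrow> g (\<gamma> t) *v \<gamma>'' t + chr g (\<gamma> t) (\<gamma>' t) = 0"
    by (rule rgeodesicE[OF G0(1)]) blast
  define J where "J t = t *\<^sub>R dexp x (t *\<^sub>R v) h" for t
  define \<phi> where "\<phi> t = gip g (\<gamma> t) (\<gamma>' t) (J t) - t * gip g x v h" for t
  have d\<phi>: "(\<phi> has_vector_derivative 0) (at t within {0<..1})" if t: "t \<in> {0<..1}" for t
  proof -
    have B: "t *\<^sub>R v \<in> rlog x ` ball 0 1" by (rule rlog_ball_star[OF x v t])
    have t': "t \<in> {0..1}" using t by auto
    have gt: "\<gamma> t = expm g x (t *\<^sub>R v)" by (rule G0(4)[OF t'])
    define J' where "J' = dexp x (t *\<^sub>R v) h + t *\<^sub>R ddexp x v (t *\<^sub>R v) h"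
    have 1: "((\<lambda>t. t *\<^sub>R v) has_derivative (\<lambda>r. r *\<^sub>R v)) (at t within {0<..1})" by (auto intro!: derivative_eq_intros)
    have "((\<lambda>t. dexp x (t *\<^sub>R v) h) has_vector_derivative ddexp x h (t *\<^sub>R v) v) (at t within {0<..1})"
      unfolding has_vector_derivative_def
      using has_derivative_compose[OF 1 ddexp[OF x B, of h]] has_derivative_linear[OF ddexp[OF x B, of h]] by (simp add: linear_cmul)
    from has_vector_derivative_scaleR[OF DERIV_ident this]
    have dJ: "(J has_vector_derivative J') (at t within {0<..1})"
      unfolding J_def[abs_def] J'_def by (simp add: ddexp_sym[OF x B, of h v] add.commute)
    have sub: "{0<..1} \<subseteq> {0..1::real}" by auto
    have "((\<lambda>t. gip g (\<gamma> t) (\<gamma>' t) (J t)) has_vector_derivative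
       (gip g (\<gamma> t) (\<gamma>'' t) (J t) + \<gamma>' t \<bullet> (mderiv g (\<gamma> t) (\<gamma>' t) *v J t) + gip g (\<gamma> t) (\<gamma>' t) J')) (at t within {0<..1})"
    proof (rule gip_has_vector_derivative[OF _ _ t _ dJ])
      show "(\<gamma> has_vector_derivative \<gamma>' t) (at t within {0<..1})" "(\<gamma>' has_vector_derivative \<gamma>'' t) (at t within {0<..1})"
        using has_vector_derivative_within_subset[OF G(2)[OF t'] sub] has_vector_derivative_within_subset[OF G(3)[OF t'] sub] by auto
      show "\<gamma> ` {0<..1} \<subseteq> Dn" using G(1) sub by blast
    qed
    moreover have "gip g (\<gamma> t) (\<gamma>'' t) (J t) + \<gamma>' t \<bullet> (mderiv g (\<gamma> t) (\<gamma>' t) *v J t) + gip g (\<gamma> t) (\<gamma>' t) J' = gip g x v h"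
    proof -
      have D: "\<gamma> t \<in> Dn" by (rule G(1)[OF t'])
      have e: "g (\<gamma> t) *v \<gamma>'' t = - chr g (\<gamma> t) (\<gamma>' t)" using G(4)[OF t'] by (simp add: eq_neg_iff_add_eq_0)
      have "gip g (\<gamma> t) (\<gamma>'' t) (J t) = gip g (\<gamma> t) (J t) (\<gamma>'' t)" by (rule gip_sym[OF D])
      also have "\<dots> = - (J t \<bullet> chr g (\<gamma> t) (\<gamma>' t))" unfolding gip_def e by simp
      also have "\<dots> = (1/2) * (\<gamma>' t \<bullet> (mderiv g (\<gamma> t) (J t) *v \<gamma>' t)) - J t \<bullet> (mderiv g (\<gamma> t) (\<gamma>' t) *v \<gamma>' t)"
        using chr_inner[OF D] by simp
      also have "J t \<bullet> (mderiv g (\<gamma> t) (\<gamma>' t) *v \<gamma>' t) = \<gamma>' t \<bullet> (mderiv g (\<gamma> t) (\<gamma>' t) *v J t)"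
        by (rule mderiv_sym[OF D])
      finally have a: "gip g (\<gamma> t) (\<gamma>'' t) (J t) = (1/2) * (\<gamma>' t \<bullet> (mderiv g (\<gamma> t) (J t) *v \<gamma>' t)) - \<gamma>' t \<bullet> (mderiv g (\<gamma> t) (\<gamma>' t) *v J t)" .
      \<comment> \<open>After the two terms with the derivative of the metric along the curve
        cancel, half of this identity is all that remains.\<close>
      have "2 * gip g (\<gamma> t) (\<gamma>' t) J' + \<gamma>' t \<bullet> (mderiv g (\<gamma> t) (J t) *v \<gamma>' t) = 2 * gip g x v h"
        using dexp_speed_variation[OF x v t, of h] unfolding vel[OF t] gt J_def J'_def .
      then show ?thesis unfolding a by linarith
    qed
    ultimately have "((\<lambda>t. gip g (\<gamma> t) (\<gamma>' t) (J t)) has_vector_derivative gip g x v h) (at t within {0<..1})" by simp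
    moreover have "((\<lambda>t. t * gip g x v h) has_vector_derivative gip g x v h) (at t within {0<..1})"
      unfolding has_real_derivative_iff_has_vector_derivative[symmetric] by (auto intro!: derivative_eq_intros)
    ultimately show ?thesis unfolding \<phi>_def[abs_def] using has_vector_derivative_diff by fastforce
  qed
  have "\<exists>c. \<forall>t\<in>{0<..1}. \<phi> t = c"
    using has_vector_derivative_zero_constant[of "{0<..1}" \<phi>] d\<phi> convex_real_interval by metis
  then obtain c where c: "\<And>t. t \<in> {0<..1} \<Longrightarrow> \<phi> t = c" by blast
  obtain k where k: "((\<lambda>t. dexp x (t *\<^sub>R v) h) \<longlongrightarrow> k) (at_right 0)" by (rule dexp_bounded_near_zero[OF x v])
  have J0: "(J \<longlongrightarrow> 0) (at_right 0)" unfolding J_def[abs_def]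
    using tendsto_scaleR[OF tendsto_ident_at k] by simp
  have le: "at_right 0 \<le> at (0::real) within {0..1}" by (simp add: at_within_Icc_at_right)
  have "(\<gamma> \<longlongrightarrow> \<gamma> 0) (at 0 within {0..1})" "(\<gamma>' \<longlongrightarrow> \<gamma>' 0) (at 0 within {0..1})"
    using rgeodesicD(4,5)[OF G0(1)] by (auto simp: continuous_on_def)
  then have lims: "(\<gamma> \<longlongrightarrow> x) (at_right 0)" "(\<gamma>' \<longlongrightarrow> v) (at_right 0)" using le tendsto_mono G0(2,3) by metis+
  have ev: "eventually (\<lambda>t::real. t \<in> {0<..<1}) (at_right 0)" by (rule eventually_at_right_real) simp
  have "((\<lambda>t. gip g (\<gamma> t) (\<gamma>' t) (J t)) \<longlongrightarrow> gip g x v 0) (at_right 0)"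
    by (rule tendsto_gip[OF lims J0 x]) (rule eventually_mono[OF ev], use G(1) in auto)
  then have "((\<lambda>t. gip g (\<gamma> t) (\<gamma>' t) (J t) - t * gip g x v h) \<longlongrightarrow> gip g x v 0 - 0 * gip g x v h) (at_right 0)"
    by (intro tendsto_intros)
  then have p: "(\<phi> \<longlongrightarrow> 0) (at_right 0)" unfolding \<phi>_def[abs_def] by simp
  have "eventually (\<lambda>t. \<phi> t = c) (at_right 0)" by (rule eventually_mono[OF ev]) (use c in auto)
  from tendsto_cong[OF this] p have "((\<lambda>t. c) \<longlongrightarrow> 0) (at_right (0::real))" by simp
  then have "c = 0" using tendsto_unique[OF trivial_limit_at_right_real _ tendsto_const] by metis
  then have "\<phi> 1 = 0" using c[of 1] by simp
  moreover have "\<gamma>' 1 = - rlog y x" using G0(5)[of 1] y1 by simp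
  ultimately show ?thesis unfolding \<phi>_def J_def y1 v_def by simp
qed

section \<open>Derivative of the logarithm and gradient of the distance\<close>

definition drlog :: "real^'n \<Rightarrow> real^'n \<Rightarrow> real^'n \<Rightarrow> real^'n" where
  "drlog x y = frechet_derivative (rlog x) (at y within Dn)"

lemma drlog: "x \<in> Dn \<Longrightarrow> y \<in> Dn \<Longrightarrow> (rlog x has_derivative drlog x y) (at y within Dn)"
  unfolding drlog_def using sm_smooth_on_has_frechet_derivative rlog_smooth by blast

lemma drlog_continuous: "x \<in> Dn \<Longrightarrow> continuous_on Dn (\<lambda>y. drlog x y k)"
  unfolding drlog_def using sm_smooth_on_imp_continuous_on sm_smooth_on_frechet_derivative[OF rlog_smooth cone_set_Dn] by blast

lemma dexp_drlog: assumes x: "x \<in> Dn" and y: "y \<in> ball 0 1" shows "dexp x (rlog x y) (drlog x y k) = k"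
proof -
  have yD: "y \<in> Dn" using y by auto
  have "(rlog x has_derivative drlog x y) (at y within ball 0 1)"
    using drlog[OF x yD] ball_subset_cball has_derivative_subset by blast
  from has_derivative_compose[OF this dexp[OF x]] y
  have "((\<lambda>z. expm g x (rlog x z)) has_derivative (\<lambda>k. dexp x (rlog x y) (drlog x y k))) (at y within ball 0 1)" by blast
  then have "((\<lambda>z. z) has_derivative (\<lambda>k. dexp x (rlog x y) (drlog x y k))) (at y within ball 0 1)"
    by (rule has_derivative_transform[OF y, rotated]) (use expm_rlog[OF x] in auto)
  then have "((\<lambda>z. z) has_derivative (\<lambda>k. dexp x (rlog x y) (drlog x y k))) (at y)"
    using at_within_open[OF y open_ball] by simp
  then have "(\<lambda>k. dexp x (rlog x y) (drlog x y k)) = (\<lambda>k. k)" using has_derivative_ident has_derivative_unique by blast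
  then show ?thesis by metis
qed

text \<open>On the boundary sphere, the identity is inherited from the interior along the connecting geodesic.\<close>
lemma Gauss_lemma_rlog:
  assumes x: "x \<in> Dn" and y: "y \<in> Dn" and xy: "x \<noteq> y"
  shows "gip g x (rlog x y) (drlog x y k) = gip g y (- rlog y x) k"
proof -
  obtain \<gamma> \<gamma>' where G: "rgeodesic g \<gamma> \<gamma>' 0 1" "\<gamma> 0 = x" "\<gamma> 1 = y" "\<gamma>' 0 = rlog x y"
    "\<And>t. t \<in> {0..1} \<Longrightarrow> rlog x (\<gamma> t) = t *\<^sub>R rlog x y" "\<And>t. t \<in> {0<..1} \<Longrightarrow> rlog (\<gamma> t) x = - (t *\<^sub>R \<gamma>' t)"
    by (rule rgeodesic_rlog[OF x y]) blast
  have ev: "eventually (\<lambda>t::real. t \<in> {0<..<1}) (at_left 1)" by (rule eventually_at_left_real) simp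
  have eq: "eventually (\<lambda>t. gip g x (t *\<^sub>R rlog x y) (drlog x (\<gamma> t) k) = gip g (\<gamma> t) (t *\<^sub>R \<gamma>' t) k) (at_left 1)"
  proof (rule eventually_mono[OF ev])
    fix t :: real assume t: "t \<in> {0<..<1}"
    have "\<gamma>' t \<noteq> 0"
      using rgeodesic_constant_speed[OF G(1), of 0 t] t G(2,4) rlog_eq_0_iff[OF x y] xy gip_eq_0_iff[OF x, of "rlog x y"] by auto
    then have b: "\<gamma> t \<in> ball 0 1" by (rule geodesic_interior[OF G(1) t])
    from Gauss_lemma[OF x b, of "drlog x (\<gamma> t) k"] 
    show "gip g x (t *\<^sub>R rlog x y) (drlog x (\<gamma> t) k) = gip g (\<gamma> t) (t *\<^sub>R \<gamma>' t) k"
      unfolding dexp_drlog[OF x b] using G(5)[of t] G(6)[of t] t by simp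
  qed
  have le: "at_left 1 \<le> at (1::real) within {0..1}" by (simp add: at_within_Icc_at_left)
  have "(\<gamma> \<longlongrightarrow> \<gamma> 1) (at 1 within {0..1})" "(\<gamma>' \<longlongrightarrow> \<gamma>' 1) (at 1 within {0..1})"
    using rgeodesicD(4,5)[OF G(1)] by (auto simp: continuous_on_def)
  then have lims: "(\<gamma> \<longlongrightarrow> y) (at_left 1)" "(\<gamma>' \<longlongrightarrow> \<gamma>' 1) (at_left 1)" using le tendsto_mono G(3) by metis+
  have ev2: "eventually (\<lambda>t. \<gamma> t \<in> Dn) (at_left 1)"
    by (rule eventually_mono[OF ev]) (use rgeodesicD(2)[OF G(1)] in auto)
  have s: "((\<lambda>t. t *\<^sub>R \<gamma>' t) \<longlongrightarrow> 1 *\<^sub>R \<gamma>' 1) (at_left 1)" by (intro tendsto_intros lims)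
  have R: "((\<lambda>t. gip g (\<gamma> t) (t *\<^sub>R \<gamma>' t) k) \<longlongrightarrow> gip g y (1 *\<^sub>R \<gamma>' 1) k) (at_left 1)"
    by (rule tendsto_gip[OF lims(1) s tendsto_const y ev2])
  have L1: "((\<lambda>t. drlog x (\<gamma> t) k) \<longlongrightarrow> drlog x y k) (at_left 1)"
    by (rule continuous_on_tendsto_compose[OF drlog_continuous[OF x] lims(1) y ev2])
  have L2: "((\<lambda>t. t *\<^sub>R rlog x y) \<longlongrightarrow> 1 *\<^sub>R rlog x y) (at_left 1)" by (intro tendsto_intros)
  have "((\<lambda>t. gip g x (t *\<^sub>R rlog x y) (drlog x (\<gamma> t) k)) \<longlongrightarrow> gip g x (1 *\<^sub>R rlog x y) (drlog x y k)) (at_left 1)"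
    by (rule tendsto_gip[OF tendsto_const L2 L1 x]) (use x in simp)
  then have "((\<lambda>t. gip g (\<gamma> t) (t *\<^sub>R \<gamma>' t) k) \<longlongrightarrow> gip g x (1 *\<^sub>R rlog x y) (drlog x y k)) (at_left 1)"
    using tendsto_cong[OF eq] by simp
  from tendsto_unique[OF trivial_limit_at_left_real this R]
  have "gip g x (rlog x y) (drlog x y k) = gip g y (\<gamma>' 1) k" by simp
  moreover have "\<gamma>' 1 = - rlog y x" using G(6)[of 1] G(3) by simp
  ultimately show ?thesis by simp
qed

text \<open>The Gauss lemma gives the derivative of the squared distance, and the square root is
  harmless away from \<open>x\<close>. This is the first variation formula, with the unit vector
  pointing away from \<open>x\<close> as gradient.\<close>

lemma rdist_has_derivative:
  assumes x: "x \<in> Dn" and y: "y \<in> Dn" and xy: "x \<noteq> y"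
  shows "(rdist x has_derivative (\<lambda>k. - gip g y (udir y x) k)) (at y within Dn)"
proof -
  define q where "q z = gip g x (rlog x z) (rlog x z)" for z
  have dgx: "((\<lambda>z. g x *v rlog x z) has_derivative (\<lambda>k. g x *v drlog x y k)) (at y within Dn)"
    by (rule bounded_linear.has_derivative[OF matrix_vector_mul_bounded_linear drlog[OF x y]])
  have "(q has_derivative (\<lambda>k. rlog x y \<bullet> (g x *v drlog x y k) + drlog x y k \<bullet> (g x *v rlog x y))) (at y within Dn)"
    unfolding q_def[abs_def] gip_def by (rule has_derivative_inner[OF drlog[OF x y] dgx])
  then have dq: "(q has_derivative (\<lambda>k. 2 * gip g y (- rlog y x) k)) (at y within Dn)"
  proof (rule has_derivative_eq_rhs)
    show "(\<lambda>k. rlog x y \<bullet> (g x *v drlog x y k) + drlog x y k \<bullet> (g x *v rlog x y)) = (\<lambda>k. 2 * gip g y (- rlog y x) k)"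
      using Gauss_lemma_rlog[OF x y xy] gip_sym[OF x] unfolding gip_def by (auto simp: fun_eq_iff)
  qed
  have qp: "q y > 0" unfolding q_def rdist_square[OF x] using rdist_pos[OF x y xy] by simp
  have sq: "sqrt (q y) = rdist x y" unfolding q_def rdist_def by simp
  have "((\<lambda>z. sqrt (q z)) has_derivative (\<lambda>k. (2 * gip g y (- rlog y x) k) * (1 / (sqrt (q y) * 2)))) (at y within Dn)"
    by (rule has_derivative_real_sqrt[OF qp dq, THEN has_derivative_eq_rhs]) (auto simp: field_simps)
  then show ?thesis
  proof (rule has_derivative_transform[OF y, rotated, THEN has_derivative_eq_rhs])
    show "(\<lambda>k. (2 * gip g y (- rlog y x) k) * (1 / (sqrt (q y) * 2))) = (\<lambda>k. - gip g y (udir y x) k)"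
      using rlog_eq[OF y x] rdist_sym[OF x y] rdist_pos[OF x y xy] unfolding sq
      by (auto simp: gip_linear fun_eq_iff)
  qed (auto simp: q_def rdist_def)
qed

lemma rdist_continuous: "x \<in> Dn \<Longrightarrow> continuous_on Dn (rdist x)"
  unfolding rdist_def[abs_def] by (intro continuous_intros rlog_continuous) auto

end

section \<open>The distance function\<close>

context simple
begin

lemma rdist_self [simp]: "x \<in> Dn \<Longrightarrow> rdist x x = 0"
  by (simp add: rdist_eq_0_iff)

lemma rdist_along_geodesic:
  assumes geo: "rgeodesic g c c' a b" and x: "x \<in> Dn" and t: "t \<in> {a..b}" and ne: "c t \<noteq> x"
  shows "((\<lambda>s. rdist x (c s)) has_real_derivative - gip g (c t) (udir (c t) x) (c' t)) (at t within {a..b})"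
proof -
  have ct: "c t \<in> Dn" using rgeodesicD(2)[OF geo t] .
  have "(rdist x has_derivative (\<lambda>k. - gip g (c t) (udir (c t) x) k)) (at (c t) within c ` {a..b})"
    by (rule has_derivative_subset[OF rdist_has_derivative[OF x ct]]) (use ne rgeodesicD(2)[OF geo] in auto)
  from has_derivative_in_compose[OF rgeodesicD(3)[OF geo t, unfolded has_vector_derivative_def] this]
  show ?thesis unfolding has_field_derivative_def
    by (rule has_derivative_eq_rhs) (auto simp: gip_linear)
qed

lemma rdist_geodesic_speed:
  assumes geo: "rgeodesic g c c' a b" and unit: "gip g (c a) (c' a) (c' a) = 1" and x: "x \<in> Dn" and t: "t \<in> {a..b}" and ne: "c t \<noteq> x"
  shows "- gip g (c t) (udir (c t) x) (c' t) \<le> 1" "- gip g (c t) (udir (c t) x) (c' t) = 1 \<Longrightarrow> c' t = - udir (c t) x"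
proof -
  have ct: "c t \<in> Dn" using rgeodesicD(2)[OF geo t] .
  have 1: "gip g (c t) (- udir (c t) x) (- udir (c t) x) = 1" using udir_unit[OF ct x ne] by (simp add: gip_linear)
  have 2: "gip g (c t) (c' t) (c' t) = 1" using rgeodesic_constant_speed[OF geo t, of a] unit rgeodesicD(1)[OF geo] by simp
  show "- gip g (c t) (udir (c t) x) (c' t) \<le> 1" "- gip g (c t) (udir (c t) x) (c' t) = 1 \<Longrightarrow> c' t = - udir (c t) x"
    using gip_unit_le_1[OF ct 1 2] by (auto simp: gip_linear)
qed

lemma rdist_along_geodesic_mono:
  assumes geo: "rgeodesic g c c' a b" and unit: "gip g (c a) (c' a) (c' a) = 1" and x: "x \<in> Dn" and ne: "\<And>t. t \<in> {a..b} \<Longrightarrow> c t \<noteq> x"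
    and st: "a \<le> s" "s \<le> t" "t \<le> b"
  shows "rdist x (c t) - rdist x (c s) \<le> t - s"
proof (cases "s = t")
  case False
  then have lt: "s < t" using st by simp
  have "\<exists>r\<in>{s<..<t}. rdist x (c t) - rdist x (c s) = (*) (- gip g (c r) (udir (c r) x) (c' r)) (t - s)"
  proof (rule mvt_simple[OF lt])
    fix r assume "s \<le> r" "r \<le> t"
    then have r: "r \<in> {a..b}" using st by auto
    have "((\<lambda>s. rdist x (c s)) has_real_derivative - gip g (c r) (udir (c r) x) (c' r)) (at r within {s..t})"
      by (rule DERIV_subset[OF rdist_along_geodesic[OF geo x r ne[OF r]]]) (use st in auto)
    then show "((\<lambda>s. rdist x (c s)) has_derivative (*) (- gip g (c r) (udir (c r) x) (c' r))) (at r within {s..t})"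
      unfolding has_field_derivative_def .
  qed
  then obtain r where r: "r \<in> {s<..<t}" "rdist x (c t) - rdist x (c s) = (- gip g (c r) (udir (c r) x) (c' r)) * (t - s)" by blast
  have rab: "r \<in> {a..b}" using r st by auto
  have "(- gip g (c r) (udir (c r) x) (c' r)) * (t - s) \<le> 1 * (t - s)"
    using rdist_geodesic_speed(1)[OF geo unit x rab ne[OF rab]] lt by (intro mult_right_mono) auto
  then show ?thesis using r by simp
qed simp

text \<open>Along the geodesic from \<open>y\<close> to \<open>z\<close> the distance from
  \<open>x\<close> grows at most at unit rate, since its gradient is a unit vector. A geodesic
  passing through \<open>x\<close>, where no derivative is available, is treated separately: then
  \<open>z\<close> is at most \<open>rdist y z\<close> away.\<close>

lemma rdist_triangle:
  assumes x: "x \<in> Dn" and y: "y \<in> Dn" and z: "z \<in> Dn"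
  shows "rdist x z \<le> rdist x y + rdist y z"
proof (cases "y = z")
  case False
  obtain c c' where G: "rgeodesic g c c' 0 (rdist y z)" "c 0 = y" "c (rdist y z) = z" "gip g (c 0) (c' 0) (c' 0) = 1"
    using unit_geodesic_exists[OF y z False] by metis
  have p: "rdist y z > 0" using rdist_pos[OF y z False] .
  show ?thesis
  proof (cases "\<exists>t\<in>{0..rdist y z}. c t = x")
    case True
    then obtain t where t: "t \<in> {0..rdist y z}" "c t = x" by blast
    have "rdist x z \<le> rdist y z"
    proof (cases "t = rdist y z")
      case True then show ?thesis using t G p z by (simp add: rdist_eq_0_iff)
    next
      case False
      then show ?thesis using unit_geodesic(1)[OF G(1,4) t(1), of "rdist y z"] t G p by simp
    qed
    then show ?thesis using rdist_nonneg[OF x, of y] by simp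
  next
    case False
    then show ?thesis using rdist_along_geodesic_mono[OF G(1,4) x, of 0 "rdist y z"] G p by auto
  qed
qed (use assms in \<open>simp add: rdist_eq_0_iff\<close>)

text \<open>Equality forces the distance from \<open>x\<close> to grow at the full unit rate along
  the second geodesic, so its velocity points straight away from \<open>x\<close> and the two pieces
  join to one geodesic. The form with \<open>rlog\<close> lets \<open>y\<close> be recovered by the
  exponential map.\<close>

lemma rdist_triangle_equality:
  assumes x: "x \<in> Dn" and y: "y \<in> Dn" and z: "z \<in> Dn" and xy: "x \<noteq> y" and yz: "y \<noteq> z"
    and eq: "rdist x z = rdist x y + rdist y z"
  shows "rlog x y = rdist x y *\<^sub>R udir x z"
proof -
  define l where "l = rdist y z"
  obtain c c' where G: "rgeodesic g c c' 0 l" "c 0 = y" "c l = z" "gip g (c 0) (c' 0) (c' 0) = 1"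
    using unit_geodesic_exists[OF y z yz] unfolding l_def by metis
  have p: "l > 0" "rdist x y > 0" unfolding l_def using rdist_pos x y z xy yz by auto
  have ne: "c t \<noteq> x" if t: "t \<in> {0..l}" for t
  proof
    assume ct: "c t = x"
    have t0: "t > 0" using ct G(2) xy t by (cases "t = 0") auto
    have 1: "rdist x y = t" using unit_geodesic(2)[OF G(1,4), of 0 t] t t0 ct G(2) by simp
    show False
    proof (cases "t = l")
      case True
      then have "x = z" using ct G by simp
      then show False using eq p x unfolding l_def by (simp add: rdist_eq_0_iff)
    next
      case False
      then have "rdist x z = l - t" using unit_geodesic(1)[OF G(1,4) t, of l] t ct G(3) by simp
      then show False using 1 eq t0 unfolding l_def by simp
    qed
  qed
  \<comment> \<open>Each part of the geodesic gains at most its own length and the whole gains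
    exactly \<open>l\<close>, so no part falls short.\<close>
  have dct: "rdist x (c t) = rdist x y + t" if t: "t \<in> {0..l}" for t
    using rdist_along_geodesic_mono[OF G(1,4) x ne, of 0 t] rdist_along_geodesic_mono[OF G(1,4) x ne, of t l] t G eq unfolding l_def by auto
  have main: "rlog x (c t) = rdist x (c t) *\<^sub>R udir x z" if t: "t \<in> {0<..<l}" for t
  proof -
    have tl: "t \<in> {0..l}" using t by auto
    have ct: "c t \<in> Dn" using rgeodesicD(2)[OF G(1) tl] .
    have "((\<lambda>s. rdist x (c s)) has_vector_derivative - gip g (c t) (udir (c t) x) (c' t)) (at t within {0..l})"
      using rdist_along_geodesic[OF G(1) x tl ne[OF tl]] unfolding has_real_derivative_iff_has_vector_derivative .
    moreover have "((\<lambda>s. rdist x (c s)) has_vector_derivative 1) (at t within {0..l})"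
    proof (rule has_vector_derivative_transform[OF tl])
      show "rdist x (c s) = rdist x y + s" if "s \<in> {0..l}" for s by (rule dct[OF that])
      show "((\<lambda>s. rdist x y + s) has_vector_derivative 1) (at t within {0..l})"
        unfolding has_real_derivative_iff_has_vector_derivative[symmetric] by (auto intro!: derivative_eq_intros)
    qed
    ultimately have "- gip g (c t) (udir (c t) x) (c' t) = 1"
      using vector_derivative_unique_within_closed_interval[of 0 l t, unfolded cbox_interval] p tl by blast
    then have vel: "c' t = - udir (c t) x" using rdist_geodesic_speed(2)[OF G(1,4) x tl ne[OF tl]] by simp
    define e where "e = rdist x (c t)"
    obtain r r' where R: "rgeodesic g r r' 0 e" "r 0 = x" "r e = c t" "r' 0 = udir x (c t)" "r' e = - udir (c t) x"
      "gip g (r 0) (r' 0) (r' 0) = 1"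
      using unit_geodesic_exists[OF x ct ne[OF tl, symmetric]] unfolding e_def by metis
    have e: "e > 0" unfolding e_def using rdist_pos[OF x ct ne[OF tl, symmetric]] .
    have sh: "rgeodesic g (\<lambda>s. c (1 * s + (t - e))) (\<lambda>s. 1 *\<^sub>R c' (1 * s + (t - e))) e (e + l - t)"
      by (rule rgeodesic_affine[OF G(1)]) (use t e in auto)
    from rgeodesic_concat[OF R(1) sh] R(3,5) vel
    have cc: "rgeodesic g (\<lambda>s. if s \<in> {0..e} then r s else c (1 * s + (t - e))) (\<lambda>s. if s \<in> {0..e} then r' s else 1 *\<^sub>R c' (1 * s + (t - e))) 0 (e + l - t)"
      by simp
    from unit_geodesic(3)[OF cc, of 0 "e + l - t"] have "udir x z = r' 0"
      using R(2,6) e t G(3) by simp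
    then show ?thesis using rlog_eq[OF x ct] R(4) by simp
  qed
  have ev: "eventually (\<lambda>t. t \<in> {0<..<l}) (at_right 0)" using p by (intro eventually_at_right_real)
  have ev2: "eventually (\<lambda>t. c t \<in> Dn) (at_right 0)" by (rule eventually_mono[OF ev]) (use rgeodesicD(2)[OF G(1)] in auto)
  have le: "at_right 0 \<le> at (0::real) within {0..l}" using p by (simp add: at_within_Icc_at_right)
  have "(c \<longlongrightarrow> c 0) (at 0 within {0..l})" using rgeodesicD(4)[OF G(1)] p by (auto simp: continuous_on_def)
  then have lim: "(c \<longlongrightarrow> y) (at_right 0)" using le tendsto_mono G(2) by metis
  have 1: "((\<lambda>t. rlog x (c t)) \<longlongrightarrow> rlog x y) (at_right 0)"
    by (rule continuous_on_tendsto_compose[OF rlog_continuous[OF x] lim y ev2])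
  have 2: "((\<lambda>t. rdist x (c t) *\<^sub>R udir x z) \<longlongrightarrow> rdist x y *\<^sub>R udir x z) (at_right 0)"
    by (intro tendsto_intros continuous_on_tendsto_compose[OF rdist_continuous[OF x] lim y ev2])
  have "eventually (\<lambda>t. rlog x (c t) = rdist x (c t) *\<^sub>R udir x z) (at_right 0)"
    by (rule eventually_mono[OF ev main])
  then have "((\<lambda>t. rlog x (c t)) \<longlongrightarrow> rdist x y *\<^sub>R udir x z) (at_right 0)"
    using 2 by (simp add: tendsto_cong)
  from tendsto_unique[OF trivial_limit_at_right_real 1 this] show ?thesis .
qed

section \<open>Joint continuity of distances and directions\<close>

lemma rdist_tendsto:
  assumes p: "(p \<longlongrightarrow> x) F" "(q \<longlongrightarrow> y) F" and D: "eventually (\<lambda>k. p k \<in> Dn) F" "eventually (\<lambda>k. q k \<in> Dn) F" "x \<in> Dn" "y \<in> Dn"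
  shows "((\<lambda>k. rdist (p k) (q k)) \<longlongrightarrow> rdist x y) F"
proof (rule Lim_transform_bound[where g="\<lambda>k. rdist x (p k) + rdist y (q k)", THEN Lim_null[THEN iffD2]])
  show "eventually (\<lambda>k. norm (rdist (p k) (q k) - rdist x y) \<le> norm (rdist x (p k) + rdist y (q k))) F"
    using D(1,2)
  proof eventually_elim
    case (elim k)
    have "rdist (p k) (q k) \<le> rdist (p k) x + (rdist x y + rdist y (q k))"
      using rdist_triangle[of "p k" x "q k"] rdist_triangle[of x y "q k"] elim D by force
    moreover have "rdist x y \<le> rdist x (p k) + (rdist (p k) (q k) + rdist (q k) y)"
      using rdist_triangle[of x "p k" y] rdist_triangle[of "p k" "q k" y] elim D by force
    ultimately show ?case using rdist_sym[of x "p k"] rdist_sym[of y "q k"] elim D by (simp add: abs_le_iff)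
  qed
  have "((\<lambda>k. rdist x (p k) + rdist y (q k)) \<longlongrightarrow> rdist x x + rdist y y) F"
    by (intro tendsto_add continuous_on_tendsto_compose[OF rdist_continuous] assms)
  then show "((\<lambda>k. rdist x (p k) + rdist y (q k)) \<longlongrightarrow> 0) F" using D by (simp add: rdist_eq_0_iff)
qed

text \<open>The direction is replaced by a chord: the point \<open>M a b\<close> at distance
  \<open>e\<close> from \<open>a\<close> on the way to \<open>b\<close> gives a difference quotient
  with error at most \<open>C * e\<close>. These points converge, since every cluster point splits
  the limit distance with equality in the triangle inequality and is thereby determined.\<close>

lemma udir_tendsto:
  assumes p: "p \<longlonglongrightarrow> x" and q: "q \<longlonglongrightarrow> y" and D: "\<And>k. p k \<in> Dn" "\<And>k. q k \<in> Dn" "x \<in> Dn" "y \<in> Dn" and xy: "x \<noteq> y"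
  shows "(\<lambda>k. udir (p k) (q k)) \<longlonglongrightarrow> udir x y"
proof (rule LIMSEQ_I)
  fix r :: real assume r: "r > 0"
  obtain C where C: "C > 0" "\<And>\<gamma> \<gamma>' a b t. rgeodesic g \<gamma> \<gamma>' a b \<Longrightarrow> gip g (\<gamma> a) (\<gamma>' a) (\<gamma>' a) = 1 \<Longrightarrow> t \<in> {a..b} \<Longrightarrow>
     norm (\<gamma> t - \<gamma> a - (t - a) *\<^sub>R \<gamma>' a) \<le> C * (t - a)\<^sup>2" using unit_geodesic_Taylor by metis
  define l where "l = rdist x y"
  have l: "l > 0" unfolding l_def using rdist_pos D xy by blast
  \<comment> \<open>Staying below the limit distance leaves room for the intermediate point;
    \<open>C * e \<le> r / 4\<close> gives each of the two chord errors a quarter of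
    \<open>r\<close>, with another quarter for the convergence of the chords.\<close>
  define e where "e = min (l / 2) (r / (4 * C))"
  have e: "e > 0" "e < l" "C * e \<le> r / 4" unfolding e_def using l r C(1) by (auto simp: min_def field_simps)
  have T: "\<exists>m\<in>Dn. rdist a m = e \<and> rdist m b = rdist a b - e \<and> norm ((1 / e) *\<^sub>R (m - a) - udir a b) \<le> C * e \<and> m = expm g a (e *\<^sub>R udir a b)"
    if ab: "a \<in> Dn" "b \<in> Dn" "rdist a b > e" for a b
  proof -
    have ne: "a \<noteq> b" using ab e(1) by (auto simp: rdist_eq_0_iff)
    obtain \<gamma> \<gamma>' where G: "rgeodesic g \<gamma> \<gamma>' 0 (rdist a b)" "\<gamma> 0 = a" "\<gamma> (rdist a b) = b" "\<gamma>' 0 = udir a b" "gip g (\<gamma> 0) (\<gamma>' 0) (\<gamma>' 0) = 1"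
      using unit_geodesic_exists[OF ab(1,2) ne] by metis
    have eI: "e \<in> {0..rdist a b}" using e ab by simp
    have "norm (\<gamma> e - a - e *\<^sub>R udir a b) \<le> C * e\<^sup>2" using C(2)[OF G(1,5) eI] G by simp
    then have "(1 / e) * norm (\<gamma> e - a - e *\<^sub>R udir a b) \<le> (1 / e) * (C * e\<^sup>2)" using e(1) by (intro mult_left_mono) auto
    then have "norm ((1 / e) *\<^sub>R (\<gamma> e - a - e *\<^sub>R udir a b)) \<le> (1 / e) * (C * e\<^sup>2)" using e(1) by simp
    moreover have "(1 / e) *\<^sub>R (\<gamma> e - a - e *\<^sub>R udir a b) = (1 / e) *\<^sub>R (\<gamma> e - a) - udir a b" using e(1) by (simp add: algebra_simps)
    ultimately have "norm ((1 / e) *\<^sub>R (\<gamma> e - a) - udir a b) \<le> C * e" using e(1) by (simp add: power2_eq_square)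
    moreover have "rdist a (\<gamma> e) = e" "rdist (\<gamma> e) b = rdist a b - e"
      using unit_geodesic(1)[OF G(1,5), of 0 e] unit_geodesic(1)[OF G(1,5), of e "rdist a b"] G e ab eI by auto
    moreover have "expm g a (e *\<^sub>R udir a b) = \<gamma> e"
      using expm_eq(2)[of a "e *\<^sub>R udir a b" "\<gamma> e"] rgeodesic_flow_point[OF G(1), of 0 e e] eI e G by simp
    ultimately show ?thesis using rgeodesicD(2)[OF G(1) eI] by auto
  qed
  define M where "M a b = expm g a (e *\<^sub>R udir a b)" for a b
  have M: "M a b \<in> Dn \<and> rdist a (M a b) = e \<and> rdist (M a b) b = rdist a b - e \<and>
     norm ((1 / e) *\<^sub>R (M a b - a) - udir a b) \<le> C * e" if "a \<in> Dn" "b \<in> Dn" "rdist a b > e" for a b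
    using T[OF that] unfolding M_def by auto
  \<comment> \<open>The value \<open>x\<close> for pairs too close together is a filler: it keeps
    the sequence in the compact ball and occurs only finitely often.\<close>
  define m where "m k = (if rdist (p k) (q k) > e then M (p k) (q k) else x)" for k
  have dl: "(\<lambda>k. rdist (p k) (q k)) \<longlonglongrightarrow> l" unfolding l_def by (rule rdist_tendsto[OF p q]) (use D in auto)
  then have ev: "eventually (\<lambda>k. rdist (p k) (q k) > e) sequentially" using e(2) order_tendstoD(1) by blast
  have Mxy: "M x y \<in> Dn \<and> rdist x (M x y) = e \<and>
     rdist (M x y) y = rdist x y - e \<and> norm ((1 / e) *\<^sub>R (M x y - x) - udir x y) \<le> C * e"
    using M[of x y] D e unfolding l_def by blast
  have mD: "m k \<in> Dn" for k unfolding m_def using M[of "p k" "q k"] D by auto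
  have mlim: "m \<longlonglongrightarrow> M x y"
  proof (rule compact_LIMSEQ_unique_limit[OF compact_cball mD])
    fix s :: "nat \<Rightarrow> nat" and w assume s: "strict_mono s" and w: "(m \<circ> s) \<longlonglongrightarrow> w"
    have wD: "w \<in> Dn" by (rule closed_sequentially[OF closed_cball _ w]) (use mD in simp)
    have ps: "(p \<circ> s) \<longlonglongrightarrow> x" "(q \<circ> s) \<longlonglongrightarrow> y" using p q s LIMSEQ_subseq_LIMSEQ by blast+
    have evs: "eventually (\<lambda>k. rdist (p (s k)) (q (s k)) > e) sequentially"
      by (rule eventually_subseq[OF s ev])
    have lim1: "(\<lambda>k. rdist ((p \<circ> s) k) ((m \<circ> s) k)) \<longlonglongrightarrow> rdist x w"
      by (rule rdist_tendsto[OF ps(1) w]) (use D wD mD in auto)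
    have ev1: "eventually (\<lambda>k. rdist ((p \<circ> s) k) ((m \<circ> s) k) = e) sequentially"
      by (rule eventually_mono[OF evs]) (use M D in \<open>auto simp: m_def\<close>)
    have 1: "rdist x w = e" by (rule LIMSEQ_unique[OF lim1 tendsto_eventually[OF ev1]])
    have lim2: "(\<lambda>k. rdist ((m \<circ> s) k) ((q \<circ> s) k)) \<longlonglongrightarrow> rdist w y"
      by (rule rdist_tendsto[OF w ps(2)]) (use D wD mD in auto)
    have ev2: "eventually (\<lambda>k. rdist ((m \<circ> s) k) ((q \<circ> s) k) = rdist ((p \<circ> s) k) ((q \<circ> s) k) - e) sequentially"
      by (rule eventually_mono[OF evs]) (use M D in \<open>auto simp: m_def\<close>)
    have lim3: "(\<lambda>k. rdist ((p \<circ> s) k) ((q \<circ> s) k) - e) \<longlonglongrightarrow> l - e"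
      using LIMSEQ_subseq_LIMSEQ[OF dl s] by (intro tendsto_intros) (simp add: o_def)
    have 2: "rdist w y = l - e" by (rule LIMSEQ_unique[OF lim2[unfolded tendsto_cong[OF ev2]] lim3])
    have "x \<noteq> w" "w \<noteq> y" using 1 2 e D by (auto simp: rdist_eq_0_iff)
    then have "rlog x w = e *\<^sub>R udir x y"
      using rdist_triangle_equality[OF D(3) wD D(4)] 1 2 unfolding l_def by simp
    then show "w = M x y" using expm_rlog[OF D(3) wD] by (simp add: M_def)
  qed
  have "(\<lambda>k. (1 / e) *\<^sub>R (m k - p k)) \<longlonglongrightarrow> (1 / e) *\<^sub>R (M x y - x)" by (intro tendsto_intros mlim p)
  then have "eventually (\<lambda>k. dist ((1 / e) *\<^sub>R (m k - p k)) ((1 / e) *\<^sub>R (M x y - x)) < r / 4) sequentially"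
    using r by (intro tendstoD) auto
  with ev have "eventually (\<lambda>k. norm (udir (p k) (q k) - udir x y) < r) sequentially"
  proof eventually_elim
    case (elim k)
    have "norm ((1 / e) *\<^sub>R (m k - p k) - udir (p k) (q k)) \<le> r / 4"
      using M[OF D(1) D(2) elim(1)] elim(1) e(3) unfolding m_def by auto
    moreover have "norm ((1 / e) *\<^sub>R (M x y - x) - udir x y) \<le> r / 4" using Mxy e(3) by linarith
    moreover have "norm ((1 / e) *\<^sub>R (m k - p k) - (1 / e) *\<^sub>R (M x y - x)) < r / 4" using elim(2) by (simp add: dist_norm)
    moreover have "norm (u - v) \<le> norm (a - u) + norm (a - b) + norm (b - v)" for u v a b :: "real^'n"
      using norm_triangle_ineq[of "(a - b) - (a - u)" "b - v"] norm_triangle_ineq4[of "a - b" "a - u"] by simp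
    from this[of "udir (p k) (q k)" "udir x y" "(1 / e) *\<^sub>R (m k - p k)" "(1 / e) *\<^sub>R (M x y - x)"]
    have "norm (udir (p k) (q k) - udir x y) \<le> norm ((1 / e) *\<^sub>R (m k - p k) - udir (p k) (q k))
       + norm ((1 / e) *\<^sub>R (m k - p k) - (1 / e) *\<^sub>R (M x y - x)) + norm ((1 / e) *\<^sub>R (M x y - x) - udir x y)" .
    ultimately show ?case using r by linarith
  qed
  then show "\<exists>no. \<forall>n\<ge>no. norm (udir (p n) (q n) - udir x y) < r" unfolding eventually_sequentially .
qed

end

section \<open>Maximal geodesics and detours\<close>

context riem
begin

section \<open>Tangential and normal parts of boundary vectors\<close>

lemma N_in_decomp:
  fixes u :: "real^'n"
  assumes x: "x \<in> sphere 0 1"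
  defines "n \<equiv> inward_normal g x"
  defines "w \<equiv> snd (N_in g (x, u))"
  shows "u = w + gip g x u n *\<^sub>R n" "w \<bullet> x = 0" "gip g x w n = 0" "gip g x n n = 1"
    "gip g x u u = gip g x w w + (gip g x u n)\<^sup>2"
proof -
  have xD: "x \<in> Dn" using x by auto
  show n1: "gip g x n n = 1" unfolding n_def using inward_normal_props[OF x] by metis
  show u: "u = w + gip g x u n *\<^sub>R n" unfolding w_def n_def N_in_def by simp
  show wn: "gip g x w n = 0" unfolding w_def N_in_def fst_conv snd_conv n_def[symmetric] gip_linear n1 by simp
  then show "w \<bullet> x = 0" using gip_inward_normal_pos_iff(2)[OF x] unfolding n_def by blast
  define a where "a = gip g x u n"
  have "u = w + a *\<^sub>R n" using u unfolding a_def .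
  then have "gip g x u u = gip g x w w + 2 * a * gip g x w n + a * a * gip g x n n"
    using gip_sym[OF xD, of n w] by (simp add: gip_linear algebra_simps)
  then show "gip g x u u = gip g x w w + (gip g x u n)\<^sup>2" using wn n1 unfolding a_def by (simp add: power2_eq_square)
qed

text \<open>The tangential part and unit length determine the square of the normal component, and
  inwardness selects its sign.\<close>

lemma N_in_inj:
  assumes "\<eta> \<in> in_boundary g" "\<eta>' \<in> in_boundary g" "N_in g \<eta> = N_in g \<eta>'"
  shows "\<eta> = \<eta>'"
proof -
  obtain x u x' u' where e: "\<eta> = (x, u)" "\<eta>' = (x', u')" by fastforce
  have xx: "x' = x" using assms(3) unfolding e N_in_def by simp
  define n where "n = inward_normal g x"
  have b: "x \<in> sphere 0 1" "gip g x u u = 1" "gip g x u n > 0" "gip g x u' u' = 1" "gip g x u' n > 0"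
    using assms(1,2) unfolding e xx in_boundary_def n_def by auto
  have w: "snd (N_in g (x, u)) = snd (N_in g (x, u'))" using assms(3) unfolding e xx by simp
  have "(gip g x u n)\<^sup>2 = (gip g x u' n)\<^sup>2"
    using N_in_decomp(5)[OF b(1), of u] N_in_decomp(5)[OF b(1), of u'] b(2,4) w unfolding n_def by simp
  then have "gip g x u n = gip g x u' n" using b(3,5) by (simp add: power2_eq_iff)
  then have "u = u'" using N_in_decomp(1)[OF b(1), of u] N_in_decomp(1)[OF b(1), of u'] w unfolding n_def by simp
  then show ?thesis unfolding e xx by simp
qed

lemma N_in_BS: assumes "(x, u) \<in> in_boundary g" shows "N_in g (x, u) \<in> BS g"
proof -
  have b: "x \<in> sphere 0 1" "gip g x u u = 1" "gip g x u (inward_normal g x) > 0"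
    using assms unfolding in_boundary_def by auto
  have "gip g x (snd (N_in g (x, u))) (snd (N_in g (x, u))) < 1"
    using N_in_decomp(5)[OF b(1), of u] b(2,3) by (smt (verit) zero_less_power)
  then show ?thesis using N_in_decomp(2)[OF b(1), of u] b(1) unfolding BS_def N_in_def by simp
qed

end

context simple
begin

lemma udir_in_boundary: "z \<in> sphere 0 1 \<Longrightarrow> p \<in> Dn \<Longrightarrow> z \<noteq> p \<Longrightarrow> (z, udir z p) \<in> in_boundary g"
  using udir_unit[of z p] udir_inward[of z p] gip_inward_normal_pos_iff(1)[of z "udir z p"] unfolding in_boundary_def by simp

section \<open>Maximal geodesics\<close>

lemma exp_dom_eq: assumes "x \<in> Dn" shows "exp_dom g x = rlog x ` Dn"
  using expm_bij[OF assms] unfolding rlog_def bij_betw_def by (metis inv_into_image_cancel order_refl)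

lemma compact_exp_dom: "x \<in> Dn \<Longrightarrow> compact (exp_dom g x)"
  using exp_dom_eq compact_continuous_image[OF rlog_continuous compact_cball] by simp

text \<open>Compactness of the exponential domain makes the set of admissible times closed and
  bounded. The maximum is 0 if \<open>u\<close> points out of the ball at a boundary point.\<close>

lemma maximal_time:
  assumes x: "x \<in> Dn" and u: "gip g x u u = 1"
  obtains r where "r \<ge> 0" "r *\<^sub>R u \<in> exp_dom g x" "\<And>s. s *\<^sub>R u \<in> exp_dom g x \<Longrightarrow> s \<le> r"
proof -
  define S where "S = {s. s *\<^sub>R u \<in> exp_dom g x}"
  have u0: "u \<noteq> 0" using u by auto
  have "S = (\<lambda>s. s *\<^sub>R u) -` exp_dom g x" unfolding S_def by auto
  moreover have "closed (exp_dom g x)" using compact_exp_dom[OF x] compact_imp_closed by blast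
  ultimately have cl: "closed S" by (simp add: closed_vimage continuous_intros)
  obtain B where B: "\<And>v. v \<in> exp_dom g x \<Longrightarrow> norm v \<le> B" using compact_exp_dom[OF x] compact_imp_bounded bounded_iff by metis
  have "norm s \<le> B / norm u" if "s \<in> S" for s using B[of "s *\<^sub>R u"] that u0 unfolding S_def by (simp add: field_simps)
  then have "bounded S" unfolding bounded_iff by blast
  then have cpt: "compact S" using cl compact_eq_bounded_closed by blast
  have "0 \<in> S" unfolding S_def using rlog_in[OF x x] x by simp
  then obtain r where "r \<in> S" "\<And>s. s \<in> S \<Longrightarrow> s \<le> r" using compact_attains_sup[OF cpt] by blast
  then show ?thesis using that[of r] \<open>0 \<in> S\<close> unfolding S_def by auto
qed

text \<open>If the endpoint at maximal time were interior, its logarithm would have a whole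
  neighbourhood in the exponential domain, and the geodesic could be prolonged.\<close>

lemma geodesic_reaches_sphere:
  assumes p: "p \<in> ball 0 1" and u: "gip g p u u = 1"
  obtains y where "y \<in> sphere 0 1" "udir p y = u"
proof -
  have pD: "p \<in> Dn" using p by auto
  obtain r where r: "r \<ge> 0" "r *\<^sub>R u \<in> exp_dom g p" "\<And>s. s *\<^sub>R u \<in> exp_dom g p \<Longrightarrow> s \<le> r"
    using maximal_time[OF pD u] by metis
  define y where "y = expm g p (r *\<^sub>R u)"
  have fp: "flow_point g p (r *\<^sub>R u) 1 y" unfolding y_def by (rule flow_point_expm[OF r(2)])
  have yD: "y \<in> Dn" using flow_point_in_Dn[OF fp] by blast
  have ry: "rlog p y = r *\<^sub>R u" by (rule rlog_unique[OF fp])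
  have "y \<notin> ball 0 1"
  proof
    assume yb: "y \<in> ball 0 1"
    have "r *\<^sub>R u \<in> rlog p ` ball 0 1" using yb ry by (metis imageI)
    then obtain e where e: "e > 0" "ball (r *\<^sub>R u) e \<subseteq> rlog p ` ball 0 1" using open_rlog_ball[OF pD] openE by blast
    have u0: "u \<noteq> 0" using u by auto
    have "dist (r *\<^sub>R u) ((r + e / 2 / norm u) *\<^sub>R u) = e / 2" using u0 e(1) by (simp add: dist_norm algebra_simps)
    then have "(r + e / 2 / norm u) *\<^sub>R u \<in> ball (r *\<^sub>R u) e" using e(1) unfolding mem_ball by linarith
    then have "(r + e / 2 / norm u) *\<^sub>R u \<in> exp_dom g p" using e(2) rlog_ball_subset[OF pD] by blast
    then have "r + e / 2 / norm u \<le> r" by (rule r(3))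
    then show False using e(1) u0 by (simp add: field_simps)
  qed
  then have ys: "y \<in> sphere 0 1" using yD by (auto simp: dist_norm)
  then have ne: "p \<noteq> y" using p by auto
  have r0: "r > 0" using ry rlog_eq_0_iff[OF pD yD] ne r(1) by (cases "r = 0") auto
  have "flow_point g p u r y" using flow_point_scale[OF fp, of "1 / r"] r0 by simp
  then show ?thesis using that[OF ys] flow_point_unit(2) u by blast
qed

lemma maximal_geodesic:
  assumes z: "z \<in> Dn" and v: "gip g z v v = 1" and fp: "flow_point g z v s p"
  obtains T \<gamma> \<gamma>' where "rgeodesic g \<gamma> \<gamma>' 0 T" "\<gamma> 0 = z" "\<gamma>' 0 = v"
    "\<And>t q. flow_point g z v t q \<Longrightarrow> t \<in> {0<..T} \<and> q = \<gamma> t"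
proof -
  obtain r where r: "r \<ge> 0" "r *\<^sub>R v \<in> exp_dom g z" "\<And>s. s *\<^sub>R v \<in> exp_dom g z \<Longrightarrow> s \<le> r"
    using maximal_time[OF z v] by metis
  have le: "t \<in> {0<..r}" if "flow_point g z v t q" for t q
  proof -
    have t: "t > 0" using flow_point_pos[OF that] .
    then have "flow_point g z (t *\<^sub>R v) 1 q" using flow_point_scale[OF that t] by simp
    then show ?thesis using r(3) t unfolding exp_dom_def by auto
  qed
  have r0: "r > 0" using le[OF fp] by auto
  have "flow_point g z v r (expm g z (r *\<^sub>R v))" using flow_point_scale[OF flow_point_expm[OF r(2)], of "1 / r"] r0 by simp
  then obtain \<gamma> \<gamma>' where G: "rgeodesic g \<gamma> \<gamma>' 0 r" "\<gamma> 0 = z" "\<gamma>' 0 = v" unfolding flow_point_def by blast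
  show ?thesis
  proof (rule that[OF G])
    fix t q assume f: "flow_point g z v t q"
    have t: "t \<in> {0<..r}" by (rule le[OF f])
    have "flow_point g z v t (\<gamma> t)" using rgeodesic_flow_point[OF G(1), of 0 t 1] t G(2,3) by auto
    then show "t \<in> {0<..r} \<and> q = \<gamma> t" using flow_point_unique[OF f] t by blast
  qed
qed

end

section \<open>Detours from a maximal geodesic to a boundary point\<close>

locale max_geodesic = simple g for g :: "'n::finite rmetric" +
  fixes \<gamma> \<gamma>' :: "real \<Rightarrow> real^'n" and T :: real
  assumes geo: "rgeodesic g \<gamma> \<gamma>' 0 T" and unit: "gip g (\<gamma> 0) (\<gamma>' 0) (\<gamma>' 0) = 1"
    and maximal: "\<And>t q. flow_point g (\<gamma> 0) (\<gamma>' 0) t q \<Longrightarrow> t \<in> {0<..T} \<and> q = \<gamma> t"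
begin

lemma T_pos: "T > 0" using rgeodesicD(1)[OF geo] .

lemma \<gamma>_Dn: "s \<in> {0..T} \<Longrightarrow> \<gamma> s \<in> Dn" using rgeodesicD(2)[OF geo] .

lemma speed: "s \<in> {0..T} \<Longrightarrow> gip g (\<gamma> s) (\<gamma>' s) (\<gamma>' s) = 1"
  using rgeodesic_constant_speed[OF geo, of s 0] unit T_pos by simp

lemma \<gamma>_not_boundary: assumes "s \<in> {0<..T}" "x \<in> sphere 0 1" "x \<noteq> \<gamma> T" shows "\<gamma> s \<noteq> x"
proof (cases "s = T")
  case False
  have "\<gamma>' s \<noteq> 0" using speed[of s] assms by auto
  then have "\<gamma> s \<in> ball 0 1" using geodesic_interior[OF geo, of s] assms False by auto
  then show ?thesis using assms by auto
qed (use assms in auto)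

text \<open>Length of the broken path that follows \<gamma> up to time \<open>s\<close> and then
  takes the geodesic to \<open>x\<close>. For \<open>x\<close> and \<open>\<gamma> 0\<close> on the
  sphere this is the total time in the broken scattering relation.\<close>

definition detour :: "real^'n \<Rightarrow> real \<Rightarrow> real" where "detour x s = s + rdist x (\<gamma> s)"

definition ddetour :: "real^'n \<Rightarrow> real \<Rightarrow> real" where "ddetour x s = 1 - gip g (\<gamma> s) (udir (\<gamma> s) x) (\<gamma>' s)"

lemma detour_derivative:
  assumes "x \<in> Dn" "s \<in> {0..T}" "\<gamma> s \<noteq> x"
  shows "(detour x has_real_derivative ddetour x s) (at s within {0..T})"
  unfolding detour_def[abs_def] ddetour_def
  using DERIV_add[OF DERIV_ident rdist_along_geodesic[OF geo assms]] by simp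

lemma detour_continuous: "x \<in> Dn \<Longrightarrow> continuous_on {0..T} (detour x)"
  unfolding detour_def[abs_def]
  by (intro continuous_intros continuous_on_compose2[OF rdist_continuous rgeodesicD(4)[OF geo]]) (use \<gamma>_Dn in auto)

text \<open>The derivative vanishes only if the geodesic continued from \<open>\<gamma> s\<close> ends at \<open>x\<close>, i.e. if \<open>x\<close> is the exit point.\<close>
lemma ddetour_pos:
  assumes s: "s \<in> {0<..T}" and x: "x \<in> sphere 0 1" "x \<noteq> \<gamma> T"
  shows "ddetour x s > 0"
proof (rule ccontr)
  assume "\<not> ddetour x s > 0"
  have xD: "x \<in> Dn" using x by auto
  have sT: "s \<in> {0..T}" using s by auto
  have gD: "\<gamma> s \<in> Dn" by (rule \<gamma>_Dn[OF sT])
  have ne: "\<gamma> s \<noteq> x" by (rule \<gamma>_not_boundary[OF s x])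
  have "gip g (\<gamma> s) (udir (\<gamma> s) x) (\<gamma>' s) \<le> 1"
    by (rule gip_unit_le_1(1)[OF gD udir_unit[OF gD xD ne] speed[OF sT]])
  then have "gip g (\<gamma> s) (udir (\<gamma> s) x) (\<gamma>' s) = 1" using \<open>\<not> ddetour x s > 0\<close> unfolding ddetour_def by linarith
  then have vel: "udir (\<gamma> s) x = \<gamma>' s" by (rule gip_unit_le_1(2)[OF gD udir_unit[OF gD xD ne] speed[OF sT]])
  define l where "l = rdist (\<gamma> s) x"
  obtain c c' where C: "rgeodesic g c c' 0 l" "c 0 = \<gamma> s" "c l = x" "c' 0 = udir (\<gamma> s) x"
    using unit_geodesic_exists[OF gD xD ne] unfolding l_def by metis
  have l: "l > 0" unfolding l_def using rdist_pos[OF gD xD ne] .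
  \<comment> \<open>Both pieces have velocity \<open>\<gamma>' s\<close> at the joint, so they form
    one geodesic reaching \<open>x\<close> at time \<open>s + l\<close>; by maximality
    \<open>x\<close> would be a point of \<gamma> at positive time, and the only boundary point
    there is the exit.\<close>
  have A: "rgeodesic g \<gamma> \<gamma>' 0 s" using rgeodesic_subinterval[OF geo, of 0 s] s by auto
  have B: "rgeodesic g (\<lambda>r. c (1 * r + (- s))) (\<lambda>r. 1 *\<^sub>R c' (1 * r + (- s))) s (s + l)"
    by (rule rgeodesic_affine[OF C(1)]) (use l in auto)
  from rgeodesic_concat[OF A B] C(2,4) vel
  have "rgeodesic g (\<lambda>r. if r \<in> {0..s} then \<gamma> r else c (1 * r + (- s))) (\<lambda>r. if r \<in> {0..s} then \<gamma>' r else 1 *\<^sub>R c' (1 * r + (- s))) 0 (s + l)"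
    by simp
  then have "flow_point g (\<gamma> 0) (\<gamma>' 0) (s + l) x"
    unfolding flow_point_def by (intro exI conjI) (assumption, use s l C(3) in auto)
  from maximal[OF this] have "s + l \<in> {0<..T}" "x = \<gamma> (s + l)" by auto
  then show False using \<gamma>_not_boundary[OF _ x, of "s + l"] by simp
qed

text \<open>The mean value theorem is used with derivatives on the open interval only, because
  \<open>x\<close> may be the starting point of \<gamma>, where the distance has no
  derivative.\<close>

lemma detour_strict_mono:
  assumes x: "x \<in> sphere 0 1" "x \<noteq> \<gamma> T" and ab: "a \<in> {0..T}" "b \<in> {0..T}" "a < b"
  shows "detour x a < detour x b"
proof -
  have xD: "x \<in> Dn" using x by auto
  have "\<exists>r. a < r \<and> r < b \<and> detour x b - detour x a = (b - a) * ddetour x r"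
  proof (rule mvt[OF ab(3), of "detour x" "\<lambda>r h. h * ddetour x r", simplified])
    show "continuous_on {a..b} (detour x)" by (rule continuous_on_subset[OF detour_continuous[OF xD]]) (use ab in auto)
    fix r assume r: "a < r" "r < b"
    have rT: "r \<in> {0<..T}" "r \<in> {0<..<T}" "r \<in> {0..T}" using r ab by auto
    have "(detour x has_real_derivative ddetour x r) (at r within {0..T})"
      by (rule detour_derivative[OF xD rT(3) \<gamma>_not_boundary[OF rT(1) x]])
    then have "(detour x has_real_derivative ddetour x r) (at r)"
      using rT(2) by (simp add: at_within_Icc_at)
    then show "(detour x has_derivative (\<lambda>h. h * ddetour x r)) (at r)"
      unfolding has_field_derivative_def by (rule has_derivative_eq_rhs) (auto simp: mult.commute)
  next
    fix r assume "a < r" "r < b" "detour x b - detour x a = (b - a) * ddetour x r"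
    then show ?thesis by blast
  qed
  then obtain r where r: "a < r" "r < b" "detour x b - detour x a = (b - a) * ddetour x r" by blast
  have "ddetour x r > 0" by (rule ddetour_pos[OF _ x]) (use r ab in auto)
  then have "(b - a) * ddetour x r > 0" using ab by simp
  then show ?thesis using r by linarith
qed

lemma udir_continuous: "continuous_on {p. fst p \<in> Dn \<and> snd p \<in> Dn \<and> fst p \<noteq> snd p} (\<lambda>p. udir (fst p) (snd p))"
  unfolding continuous_on_sequentially
proof (intro allI ballI impI)
  fix f :: "nat \<Rightarrow> (real^'n) \<times> (real^'n)" and a
  assume a: "a \<in> {p. fst p \<in> Dn \<and> snd p \<in> Dn \<and> fst p \<noteq> snd p}"
    and f: "(\<forall>n. f n \<in> {p. fst p \<in> Dn \<and> snd p \<in> Dn \<and> fst p \<noteq> snd p}) \<and> f \<longlonglongrightarrow> a"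
  have "(\<lambda>n. udir (fst (f n)) (snd (f n))) \<longlonglongrightarrow> udir (fst a) (snd a)"
    by (rule udir_tendsto[OF tendsto_fst[OF conjunct2[OF f]] tendsto_snd[OF conjunct2[OF f]]]) (use a f in auto)
  then show "((\<lambda>p. udir (fst p) (snd p)) \<circ> f) \<longlonglongrightarrow> udir (fst a) (snd a)" by (simp add: o_def)
qed

lemma ddetour_continuous: "continuous_on {p. fst p \<in> {0..T} \<and> snd p \<in> Dn \<and> \<gamma> (fst p) \<noteq> snd p} (\<lambda>p. ddetour (snd p) (fst p))"
proof -
  let ?W = "{p. fst p \<in> {0..T} \<and> snd p \<in> Dn \<and> \<gamma> (fst p) \<noteq> snd p}"
  have g: "continuous_on ?W (\<lambda>p. \<gamma> (fst p))" "continuous_on ?W (\<lambda>p. \<gamma>' (fst p))"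
    by (rule continuous_on_compose2[OF rgeodesicD(4)[OF geo] continuous_on_fst[OF continuous_on_id]], force)
       (rule continuous_on_compose2[OF rgeodesicD(5)[OF geo] continuous_on_fst[OF continuous_on_id]], force)
  have "continuous_on ?W (\<lambda>p. udir (fst (\<gamma> (fst p), snd p)) (snd (\<gamma> (fst p), snd p)))"
    by (rule continuous_on_compose2[OF udir_continuous continuous_on_Pair[OF g(1) continuous_on_snd[OF continuous_on_id]]])
      (use \<gamma>_Dn in auto)
  then show ?thesis unfolding ddetour_def by (intro continuous_on_diff continuous_on_const continuous_on_gip g) (use \<gamma>_Dn in auto)
qed

text \<open>The derivative of the detour is positive at \<open>(s, x)\<close> and jointly
  continuous, so it stays above half its value nearby. Uniformity in \<open>y\<close> is essential:
  the estimate is applied while boundary point and parameter move together.\<close>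

lemma detour_local_lower_bound:
  assumes s: "s \<in> {0<..T}" and x: "x \<in> sphere 0 1" "x \<noteq> \<gamma> T"
  obtains c e where "c > 0" "e > 0"
    "\<And>y a b. y \<in> Dn \<Longrightarrow> dist y x < e \<Longrightarrow> a \<in> {0..T} \<Longrightarrow> b \<in> {0..T} \<Longrightarrow> \<bar>a - s\<bar> < e \<Longrightarrow> \<bar>b - s\<bar> < e \<Longrightarrow>
       c * \<bar>b - a\<bar> \<le> \<bar>detour y b - detour y a\<bar>"
proof -
  have xD: "x \<in> Dn" using x by auto
  have sT: "s \<in> {0..T}" using s by auto
  have ne: "\<gamma> s \<noteq> x" by (rule \<gamma>_not_boundary[OF s x])
  define c where "c = ddetour x s / 2"
  have c: "c > 0" unfolding c_def using ddetour_pos[OF s x] by simp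
  let ?W = "{p. fst p \<in> {0..T} \<and> snd p \<in> Dn \<and> \<gamma> (fst p) \<noteq> snd p}"
  have "(s, x) \<in> ?W" using sT xD ne by simp
  then obtain e1 where e1: "e1 > 0" "\<And>p. p \<in> ?W \<Longrightarrow> dist p (s, x) < e1 \<Longrightarrow> dist (ddetour (snd p) (fst p)) (ddetour x s) < c"
    using ddetour_continuous c unfolding continuous_on_iff by fastforce
  \<comment> \<open>Keeps \<open>\<gamma> r\<close> apart from \<open>y\<close>, so that the
    derivative of the detour exists throughout the neighbourhood.\<close>
  have "continuous_on ({0..T} \<times> UNIV) (\<lambda>p. \<gamma> (fst p) - snd p)"
    by (auto intro!: continuous_on_compose2[OF rgeodesicD(4)[OF geo]] continuous_intros)
  then obtain e2 where e2: "e2 > 0" "\<And>p. p \<in> {0..T} \<times> UNIV \<Longrightarrow> dist p (s, x) < e2 \<Longrightarrow> dist (\<gamma> (fst p) - snd p) (\<gamma> s - x) < norm (\<gamma> s - x)"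
    using ne sT unfolding continuous_on_iff by (metis (no_types, lifting) SigmaI UNIV_I fst_conv snd_conv right_minus_eq zero_less_norm_iff)
  \<comment> \<open>Half of the radii, since the distance of pairs is at most the sum of the
    component distances.\<close>
  define e where "e = min e1 e2 / 2"
  have e: "e > 0" "2 * e \<le> e1" "2 * e \<le> e2" unfolding e_def using e1 e2 by auto
  have near: "\<gamma> r \<noteq> y \<and> ddetour y r > c" if "y \<in> Dn" "dist y x < e" "r \<in> {0..T}" "\<bar>r - s\<bar> < e" for y r
  proof -
    have "dist (r, y) (s, x) \<le> dist r s + dist y x" unfolding dist_Pair_Pair by (rule sqrt_sum_squares_le_sum) auto
    then have d: "dist (r, y) (s, x) < 2 * e" using that by (simp add: dist_real_def)
    have "\<gamma> r \<noteq> y" using e2(2)[of "(r, y)"] d e that by (auto simp: dist_norm norm_minus_commute)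
    moreover from this have "\<bar>ddetour y r - ddetour x s\<bar> < c" using e1(2)[of "(r, y)"] d e that by (auto simp: dist_real_def)
    then have "ddetour y r > c" using abs_ge_minus_self[of "ddetour y r - ddetour x s"] unfolding c_def by linarith
    ultimately show ?thesis by blast
  qed
  have one: "c * (b - a) \<le> detour y b - detour y a"
    if y: "y \<in> Dn" "dist y x < e" and ab: "a \<in> {0..T}" "b \<in> {0..T}" "\<bar>a - s\<bar> < e" "\<bar>b - s\<bar> < e" "a < b" for y a b
  proof -
    have "\<exists>r\<in>{a<..<b}. detour y b - detour y a = (*) (ddetour y r) (b - a)"
    proof (rule mvt_simple[OF ab(5)])
      fix r assume r: "a \<le> r" "r \<le> b"
      then have rT: "r \<in> {0..T}" "\<bar>r - s\<bar> < e" using ab by auto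
      have "(detour y has_real_derivative ddetour y r) (at r within {a..b})"
        by (rule DERIV_subset[OF detour_derivative[OF y(1) rT(1)]]) (use near[OF y rT] ab in auto)
      then show "(detour y has_derivative (*) (ddetour y r)) (at r within {a..b})" unfolding has_field_derivative_def .
    qed
    then obtain r where r: "r \<in> {a<..<b}" "detour y b - detour y a = ddetour y r * (b - a)" by blast
    have "c < ddetour y r" using near[OF y, of r] r ab by auto
    then show ?thesis using r(2) ab(5) by (simp add: mult_right_mono)
  qed
  show ?thesis
  proof (rule that[OF c e(1)])
    fix y a b assume y: "y \<in> Dn" "dist y x < e" and ab: "a \<in> {0..T}" "b \<in> {0..T}" "\<bar>a - s\<bar> < e" "\<bar>b - s\<bar> < e"
    consider "a < b" | "a = b" | "b < a" by linarith
    then show "c * \<bar>b - a\<bar> \<le> \<bar>detour y b - detour y a\<bar>"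
    proof cases
      case 1
      then show ?thesis using one[OF y ab 1] by (simp add: abs_if)
    next
      case 3
      then show ?thesis using one[OF y ab(2,1,4,3) 3] by (simp add: abs_if)
    qed simp
  qed
qed

end

section \<open>Two metrics with the same broken scattering relation\<close>

text \<open>A great circle through \<open>z\<close> and \<open>x\<close> offers two arcs between
  them, and \<open>e\<close>, being neither endpoint, lies on at most one. The second arc is run
  backwards, over \<open>{\<theta> - 2 * pi..0}\<close>. In dimension two the circle is the whole
  sphere.\<close>

lemma circle_arc_avoiding:
  fixes z x e :: "real^'n::finite"
  assumes "CARD('n) \<ge> 2" and z: "z \<in> sphere 0 1" and x: "x \<in> sphere 0 1" and "x \<noteq> z" "e \<noteq> z" "e \<noteq> x"
  obtains b l r t where "b \<bullet> z = 0" "norm b = 1" "l < r" "0 \<in> {l..r}" "t \<in> {l..r}" "x = cos t *\<^sub>R z + sin t *\<^sub>R b"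
    "\<And>s. s \<in> {l..r} \<Longrightarrow> cos s *\<^sub>R z + sin s *\<^sub>R b \<noteq> e"
proof -
  have zz: "z \<bullet> z = 1" and xx: "x \<bullet> x = 1" using z x by (auto simp: dot_square_norm)
  define w where "w = x - (z \<bullet> x) *\<^sub>R z"
  have "z \<bullet> w = 0" unfolding w_def by (simp add: inner_diff_right zz)
  then have wz: "w \<bullet> z = 0" by (simp add: inner_commute)
  have wx: "w \<bullet> w = 1 - (z \<bullet> x)\<^sup>2" unfolding w_def
    by (simp add: inner_diff_left inner_diff_right zz xx inner_commute power2_eq_square)
  have zx1: "\<bar>z \<bullet> x\<bar> \<le> 1" using Cauchy_Schwarz_ineq2[of z x] z x by simp
  define \<theta> where "\<theta> = arccos (z \<bullet> x)"
  have \<theta>: "cos \<theta> = z \<bullet> x" "\<theta> \<in> {0..pi}" "sin \<theta> = norm w"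
  proof -
    show c: "cos \<theta> = z \<bullet> x" unfolding \<theta>_def using zx1 by (intro cos_arccos) (auto simp: abs_le_iff)
    show "\<theta> \<in> {0..pi}" unfolding \<theta>_def using zx1 by (auto simp: abs_le_iff arccos_lbound arccos_ubound)
    have "sin \<theta> = sqrt (1 - (z \<bullet> x)\<^sup>2)" unfolding \<theta>_def using zx1 by (intro sin_arccos) (auto simp: abs_le_iff)
    then show "sin \<theta> = norm w" unfolding norm_eq_sqrt_inner wx .
  qed
  have \<theta>0: "\<theta> > 0"
  proof (rule ccontr)
    assume "\<not> \<theta> > 0"
    then have "\<theta> = 0" using \<theta>(2) by simp
    then have "z \<bullet> x = 1" "w = 0" using \<theta> by auto
    then show False using \<open>x \<noteq> z\<close> unfolding w_def by simp
  qed
  \<comment> \<open>The case \<open>w = 0\<close> means \<open>x = - z\<close>, where the circle is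
    not determined; any unit vector orthogonal to \<open>z\<close> will do.\<close>
  obtain b where b: "b \<bullet> z = 0" "norm b = 1" "w = norm w *\<^sub>R b"
  proof (cases "w = 0")
    case True
    obtain y where "y \<noteq> 0" "orthogonal z y" using orthogonal_to_vector_exists[of z] assms(1) by auto
    then show ?thesis using that[of "(1 / norm y) *\<^sub>R y"] True by (auto simp: orthogonal_def inner_commute)
  next
    case False
    then show ?thesis using that[of "(1 / norm w) *\<^sub>R w"] wz by auto
  qed
  define c where "c s = cos s *\<^sub>R z + sin s *\<^sub>R b" for s
  have x\<theta>: "x = c \<theta>" unfolding c_def \<theta> b(3)[symmetric] unfolding w_def by simp
  have cper: "c (s - 2 * pi) = c s" for s unfolding c_def using cos_periodic[of "s - 2 * pi"] sin_periodic[of "s - 2 * pi"] by simp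
  have cinj: "\<exists>n::int. s = t + 2 * n * pi" if "c s = c t" for s t
  proof -
    have "c s \<bullet> z = cos s" "c s \<bullet> b = sin s" for s
      unfolding c_def using b zz inner_commute[of z b] by (simp_all add: inner_add_left dot_square_norm)
    then have "cos s = cos t" "sin s = sin t" using that by metis+
    then show ?thesis using sin_cos_eq_iff[of s t] by auto
  qed
  show ?thesis
  proof (cases "\<exists>s\<in>{0..\<theta>}. c s = e")
    case False
    show ?thesis
      by (rule that[OF b(1,2), of 0 \<theta> \<theta>]) (use \<theta>0 x\<theta> False in \<open>auto simp: c_def\<close>)
  next
    case True
    then obtain s where s: "s \<in> {0..\<theta>}" "c s = e" by blast
    have "s \<noteq> 0" using s(2) \<open>e \<noteq> z\<close> unfolding c_def by auto
    moreover have "s \<noteq> \<theta>" using s(2) \<open>e \<noteq> x\<close> x\<theta> by auto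
    ultimately have s': "0 < s" "s < \<theta>" using s(1) by auto
    \<comment> \<open>Two parameters of the point \<open>e\<close> differ by a multiple of
      \<open>2 * pi\<close>, but \<open>s - t\<close> lies strictly between 0 and
      \<open>2 * pi\<close>.\<close>
    have ne: "c t \<noteq> e" if t: "t \<in> {\<theta> - 2 * pi..0}" for t
    proof
      assume "c t = e"
      then obtain n :: int where n: "s = t + 2 * n * pi" using cinj[of s t] s(2) by auto
      have "t \<le> 0" "t \<ge> \<theta> - 2 * pi" using t by auto
      then have "(2 * pi) * n > 0" "(2 * pi) * n < (2 * pi) * 1" using n s' by (simp_all only: mult.commute mult.left_commute)
      moreover have "2 * pi > 0" by simp
      ultimately have "real_of_int n > 0" "real_of_int n < 1"
        using zero_less_mult_pos mult_less_cancel_left_pos by blast+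
      then show False by simp
    qed
    show ?thesis
      by (rule that[OF b(1,2), of "\<theta> - 2 * pi" 0 "\<theta> - 2 * pi"])
        (use \<theta>(2) x\<theta> cper[of \<theta>] ne in \<open>auto simp: c_def intro: order.strict_trans1[of _ pi]\<close>)
  qed
qed

text \<open>Keeps the tangential part and exchanges the inward normals. When the boundary metrics
  agree, this is \<open>N_in g1\<close> followed by the inverse of \<open>N_in g2\<close> on inward
  unit vectors, extended linearly so that it also applies to logarithms.\<close>

definition bmap :: "'n::finite rmetric \<Rightarrow> 'n rmetric \<Rightarrow> real^'n \<Rightarrow> real^'n \<Rightarrow> real^'n" where
  "bmap g1 g2 z u = u + gip g1 z u (inward_normal g1 z) *\<^sub>R (inward_normal g2 z - inward_normal g1 z)"

lemma linear_bmap: "linear (bmap g1 g2 z)"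
  unfolding bmap_def by (auto intro!: linearI simp: gip_linear algebra_simps)

lemma bmap_scaleR: "bmap g1 g2 z (c *\<^sub>R u) = c *\<^sub>R bmap g1 g2 z u"
  using linear_bmap by (rule linear_cmul)

locale simple_pair = M: simple g1 + N: simple g2 for g1 g2 :: "'n::finite rmetric" +
  assumes bd: "same_boundary_metric g1 g2"
    and bs: "T > 0 \<Longrightarrow> broken_scattering g1 T v1 v2 = broken_scattering g2 T v1 v2"
    and card: "CARD('n) \<ge> 2"
begin

text \<open>The construction with the metrics exchanged later provides the inverse map.\<close>

lemma flipped: "simple_pair g2 g1"
  by unfold_locales (use bd bs card in \<open>auto simp: same_boundary_metric_def\<close>)

section \<open>Transport of boundary vectors from the first metric to the second\<close>

context
  fixes z :: "real^'n" assumes z: "z \<in> sphere 0 1"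
begin

lemma bmap_decomp:
  "bmap g1 g2 z u = snd (N_in g1 (z, u)) + gip g1 z u (inward_normal g1 z) *\<^sub>R inward_normal g2 z"
  unfolding bmap_def N_in_def by (simp add: algebra_simps)

lemma gip_bmap_normal: "gip g2 z (bmap g1 g2 z u) (inward_normal g2 z) = gip g1 z u (inward_normal g1 z)"
proof -
  have "gip g2 z (snd (N_in g1 (z, u))) (inward_normal g2 z) = 0"
    using N.gip_inward_normal_pos_iff(2)[OF z] M.N_in_decomp(2)[OF z] by blast
  then show ?thesis unfolding bmap_decomp gip_linear using N.N_in_decomp(4)[OF z] by simp
qed

lemma N_in_bmap: "N_in g2 (z, bmap g1 g2 z u) = N_in g1 (z, u)"
proof -
  have "snd (N_in g2 (z, bmap g1 g2 z u)) = snd (N_in g1 (z, u))"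
    unfolding N_in_def[of g2] fst_conv snd_conv gip_bmap_normal by (simp add: bmap_decomp)
  then show ?thesis by (simp add: N_in_def prod_eq_iff)
qed

lemma gip_bmap: "gip g2 z (bmap g1 g2 z u) (bmap g1 g2 z u) = gip g1 z u u"
proof -
  have "gip g2 z (snd (N_in g1 (z, u))) (snd (N_in g1 (z, u))) = gip g1 z (snd (N_in g1 (z, u))) (snd (N_in g1 (z, u)))"
    using bd z M.N_in_decomp(2)[OF z] unfolding same_boundary_metric_def by metis
  then show ?thesis
    unfolding N.N_in_decomp(5)[OF z, of "bmap g1 g2 z u"] M.N_in_decomp(5)[OF z, of u] N_in_bmap gip_bmap_normal by simp
qed

lemma bmap_inverse: "bmap g2 g1 z (bmap g1 g2 z u) = u"
  unfolding bmap_def[of g2] gip_bmap_normal by (simp add: bmap_def algebra_simps)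

text \<open>Tangential vectors are orthogonal to both normals, and on them the metrics agree. With
  the first variation formula this equates derivatives of the two distance functions along the
  sphere.\<close>

lemma gip_bmap_tangent: assumes k: "k \<bullet> z = 0" shows "gip g2 z (bmap g1 g2 z u) k = gip g1 z u k"
proof -
  have zD: "z \<in> Dn" using z by auto
  have "gip g1 z (inward_normal g1 z) k = 0" "gip g2 z (inward_normal g2 z) k = 0"
    using M.gip_inward_normal_pos_iff(2)[OF z, of k] N.gip_inward_normal_pos_iff(2)[OF z, of k] M.gip_sym[OF zD] N.gip_sym[OF zD] k by metis+
  moreover have "gip g1 z (snd (N_in g1 (z, u))) k = gip g2 z (snd (N_in g1 (z, u))) k"
    using bd z k M.N_in_decomp(2)[OF z] unfolding same_boundary_metric_def by metis
  moreover have "gip g1 z u k = gip g1 z (snd (N_in g1 (z, u)) + gip g1 z u (inward_normal g1 z) *\<^sub>R inward_normal g1 z) k"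
    using M.N_in_decomp(1)[OF z, of u] by simp
  ultimately show ?thesis unfolding bmap_decomp by (simp add: gip_linear)
qed

lemma bmap_in_boundary: "(z, u) \<in> in_boundary g1 \<Longrightarrow> (z, bmap g1 g2 z u) \<in> in_boundary g2"
  unfolding in_boundary_def by (simp add: gip_bmap gip_bmap_normal)

end

text \<open>The relation preserves only the total time. How it splits into \<open>s\<close> and
  \<open>s'\<close> in the second metric is unknown at this stage, and determining the split is the
  main difficulty.\<close>

lemma broken_transfer:
  assumes 1: "(z, u) \<in> in_boundary g1" "flow_point g1 z u t p" and 2: "(z', u') \<in> in_boundary g1" "flow_point g1 z' u' t' p"
  obtains s s' q where "s + s' = t + t'" "flow_point g2 z (bmap g1 g2 z u) s q" "flow_point g2 z' (bmap g1 g2 z' u') s' q"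
proof -
  have z: "z \<in> sphere 0 1" "z' \<in> sphere 0 1" using 1 2 unfolding in_boundary_def by auto
  have t: "t > 0" "t' > 0" using M.flow_point_pos 1 2 by auto
  have "broken_scattering g1 (t + t') (N_in g1 (z, u)) (N_in g1 (z', u'))"
    unfolding broken_scattering_def
    using M.N_in_BS[OF 1(1)] M.N_in_BS[OF 2(1)] t 1 2
    by (intro conjI exI[of _ t] exI[of _ t'] exI[of _ "(z, u)"] exI[of _ "(z', u')"] exI[of _ p]) auto
  then have "broken_scattering g2 (t + t') (N_in g1 (z, u)) (N_in g1 (z', u'))" using bs t by simp
  then obtain s s' \<eta> \<eta>' q where *: "s + s' = t + t'" "\<eta> \<in> in_boundary g2" "N_in g2 \<eta> = N_in g1 (z, u)"
     "\<eta>' \<in> in_boundary g2" "N_in g2 \<eta>' = N_in g1 (z', u')" "flow_point g2 (fst \<eta>) (snd \<eta>) s q" "flow_point g2 (fst \<eta>') (snd \<eta>') s' q"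
    unfolding broken_scattering_def by blast
  have "\<eta> = (z, bmap g1 g2 z u)"
    by (rule N.N_in_inj[OF *(2) bmap_in_boundary[OF z(1) 1(1)]]) (simp add: *(3) N_in_bmap[OF z(1)])
  moreover have "\<eta>' = (z', bmap g1 g2 z' u')"
    by (rule N.N_in_inj[OF *(4) bmap_in_boundary[OF z(2) 2(1)]]) (simp add: *(5) N_in_bmap[OF z(2)])
  ultimately show ?thesis using that[OF *(1)] *(6,7) by simp
qed

text \<open>The vector is paired with itself. In the second metric both legs then run along one unit
  speed geodesic to the same point, so both times equal the distance to it, which must be half the
  total.\<close>

lemma flow_transfer:
  assumes 1: "(z, u) \<in> in_boundary g1" "flow_point g1 z u t p"
  obtains q where "flow_point g2 z (bmap g1 g2 z u) t q"
proof -
  obtain s s' q where *: "s + s' = t + t" "flow_point g2 z (bmap g1 g2 z u) s q" "flow_point g2 z (bmap g1 g2 z u) s' q"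
    using broken_transfer[OF 1 1] by metis
  have "gip g2 z (bmap g1 g2 z u) (bmap g1 g2 z u) = 1"
    using bmap_in_boundary[of z u] 1(1) unfolding in_boundary_def by auto
  then have "s = s'" using N.flow_point_unit(1) *(2,3) by metis
  then show ?thesis using * that by simp
qed

text \<open>Written with logarithms so that smoothness is a matter of composition. That the
  transported vector belongs to the domain of \<open>expm g2 z\<close>, where the choice in
  \<open>expm\<close> is meaningful, comes from \<open>flow_point_Psi_rlog\<close>.\<close>

definition Psi :: "real^'n \<Rightarrow> real^'n \<Rightarrow> real^'n" where
  "Psi z p = expm g2 z (bmap g1 g2 z (M.rlog z p))"

lemma flow_point_Psi:
  assumes z: "z \<in> sphere 0 1" and p: "p \<in> Dn" "z \<noteq> p"
  shows "flow_point g2 z (bmap g1 g2 z (M.udir z p)) (M.rdist z p) (Psi z p)"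
proof -
  have zD: "z \<in> Dn" using z by auto
  obtain q where q: "flow_point g2 z (bmap g1 g2 z (M.udir z p)) (M.rdist z p) q"
    using flow_transfer[OF M.udir_in_boundary[OF z p] M.flow_point_udir[OF zD p]] by blast
  have "flow_point g2 z (bmap g1 g2 z (M.rlog z p)) 1 q"
    using N.flow_point_scale[OF q, of "M.rdist z p"] M.rdist_pos[OF zD p] M.rlog_eq[OF zD p(1)] by (simp add: bmap_scaleR)
  then have "Psi z p = q" unfolding Psi_def by (rule N.expm_eq(2))
  then show ?thesis using q by simp
qed

lemma flow_point_Psi_rlog:
  assumes z: "z \<in> sphere 0 1" and p: "p \<in> Dn"
  shows "flow_point g2 z (bmap g1 g2 z (M.rlog z p)) 1 (Psi z p)"
proof (cases "z = p")
  case True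
  have zD: "z \<in> Dn" using z by auto
  have "flow_point g2 z 0 1 z" by (rule N.flow_point_zero[OF zD]) simp
  moreover have "bmap g1 g2 z (M.rlog z p) = 0" using True zD linear_0[OF linear_bmap] by simp
  ultimately show ?thesis unfolding Psi_def using N.flow_point_expm[of 0 z] N.expm_eq(1) by simp
next
  case False
  have zD: "z \<in> Dn" using z by auto
  from flow_point_Psi[OF z p False] show ?thesis
    using N.flow_point_scale[of z _ "M.rdist z p" _ "M.rdist z p"] M.rdist_pos[OF zD p False] M.rlog_eq[OF zD p] by (fastforce simp: bmap_scaleR)
qed

lemma Psi_Dn: "z \<in> sphere 0 1 \<Longrightarrow> p \<in> Dn \<Longrightarrow> Psi z p \<in> Dn"
  using flow_point_Psi_rlog N.flow_point_in_Dn by blast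

lemma rlog_Psi: "z \<in> sphere 0 1 \<Longrightarrow> p \<in> Dn \<Longrightarrow> N.rlog z (Psi z p) = bmap g1 g2 z (M.rlog z p)"
  using flow_point_Psi_rlog N.rlog_unique by blast

lemma rdist_Psi: "z \<in> sphere 0 1 \<Longrightarrow> p \<in> Dn \<Longrightarrow> N.rdist z (Psi z p) = M.rdist z p"
  unfolding N.rdist_def M.rdist_def using rlog_Psi gip_bmap by simp

text \<open>For fixed \<open>z\<close>, the point \<open>Psi x p\<close> moves along a single \<open>g2\<close>-geodesic as \<open>x\<close> varies; its position
  \<open>\<sigma>\<close> has zero derivative because the detour functions of both metrics have equal boundary gradients.\<close>
lemma Psi_local_independence:
  assumes z: "z \<in> sphere 0 1" and p: "p \<in> ball 0 1"
  obtains e where "\<And>x. x \<in> sphere 0 1 \<Longrightarrow> x \<noteq> e \<Longrightarrow> Psi x p = Psi z p"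
proof -
  have pD: "p \<in> Dn" and zD: "z \<in> Dn" using p z by auto
  have ne: "x \<noteq> p" if "x \<in> sphere 0 1" for x using that p by auto
  define u where "u = M.udir z p"
  define v where "v = bmap g1 g2 z u"
  define s1 where "s1 = M.rdist z p"
  have zu: "(z, u) \<in> in_boundary g1" unfolding u_def by (rule M.udir_in_boundary[OF z pD ne[OF z]])
  have fp1: "flow_point g1 z u s1 p" unfolding u_def s1_def by (rule M.flow_point_udir[OF zD pD ne[OF z]])
  have fp2: "flow_point g2 z v s1 (Psi z p)" unfolding v_def u_def s1_def by (rule flow_point_Psi[OF z pD ne[OF z]])
  have vu: "gip g2 z v v = 1" using bmap_in_boundary[OF z zu] unfolding v_def in_boundary_def by auto
  obtain T \<gamma> \<gamma>' where G: "rgeodesic g2 \<gamma> \<gamma>' 0 T" "\<gamma> 0 = z" "\<gamma>' 0 = v"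
    "\<And>t q. flow_point g2 z v t q \<Longrightarrow> t \<in> {0<..T} \<and> q = \<gamma> t"
    using N.maximal_geodesic[OF zD vu fp2] by metis
  interpret G: max_geodesic g2 \<gamma> \<gamma>' T
    by unfold_locales (use G vu in auto)
  have s1T: "s1 \<in> {0<..T}" "Psi z p = \<gamma> s1" using G(4)[OF fp2] by auto
  \<comment> \<open>By maximality the meeting point lies on \<gamma>, with parameter
    \<open>s\<close>. The implication sits inside the existential so that a choice function on all
    points results; its regularity has to be established afterwards.\<close>
  have "\<exists>s. x \<in> sphere 0 1 \<longrightarrow> s \<in> {0<..T} \<and> flow_point g2 x (bmap g1 g2 x (M.udir x p)) (s1 + M.rdist x p - s) (\<gamma> s)" for x
  proof (cases "x \<in> sphere 0 1")
    case True
    have xD: "x \<in> Dn" using True by auto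
    obtain s s' q where *: "s + s' = s1 + M.rdist x p" "flow_point g2 z (bmap g1 g2 z u) s q" "flow_point g2 x (bmap g1 g2 x (M.udir x p)) s' q"
      using broken_transfer[OF zu fp1 M.udir_in_boundary[OF True pD ne[OF True]] M.flow_point_udir[OF xD pD ne[OF True]]] by metis
    then have "s' = s1 + M.rdist x p - s" by simp
    with * show ?thesis using G(4)[of s q] unfolding v_def[symmetric] by (intro exI[of _ s]) auto
  qed auto
  then obtain \<sigma> where \<sigma>0: "\<And>x. x \<in> sphere 0 1 \<Longrightarrow> \<sigma> x \<in> {0<..T} \<and> flow_point g2 x (bmap g1 g2 x (M.udir x p)) (s1 + M.rdist x p - \<sigma> x) (\<gamma> (\<sigma> x))"
    by metis
  have unit2: "gip g2 x (bmap g1 g2 x (M.udir x p)) (bmap g1 g2 x (M.udir x p)) = 1" if "x \<in> sphere 0 1" for x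
    using gip_bmap[OF that] M.udir_unit[of x p] that pD ne[OF that] by simp
  have \<sigma>: "\<sigma> x \<in> {0<..T}" "G.detour x (\<sigma> x) = s1 + M.rdist x p" "N.udir x (\<gamma> (\<sigma> x)) = bmap g1 g2 x (M.udir x p)" "x \<noteq> \<gamma> (\<sigma> x)"
    if x: "x \<in> sphere 0 1" for x
    using \<sigma>0[OF x] N.flow_point_unit[OF conjunct2[OF \<sigma>0[OF x]] unit2[OF x]] unfolding G.detour_def by auto
  have T0: "T > 0" by (rule G.T_pos)
  have rz: "N.rdist z (\<gamma> s) = s" if "s \<in> {0<..T}" for s
    using N.unit_geodesic(1)[OF G(1) G.unit, of 0 s] G(2) that by auto
  have ze: "z \<noteq> \<gamma> T" using N.unit_geodesic(5)[OF G(1) G.unit, of 0 T] T0 G(2) by auto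
  \<comment> \<open>For \<open>x = z\<close> both legs lie on \<gamma>, so the detour equation reads
    \<open>2 * \<sigma> z = 2 * s1\<close>.\<close>
  have \<sigma>z: "\<sigma> z = s1" using \<sigma>(2)[OF z] rz[OF \<sigma>(1)[OF z]] unfolding G.detour_def s1_def by simp
  have const: "\<sigma> x = s1" if x: "x \<in> sphere 0 1" "x \<noteq> \<gamma> T" for x
  proof (cases "x = z")
    case False
    obtain b l r t where b: "b \<bullet> z = 0" "norm b = 1" "l < r" "0 \<in> {l..r}" "t \<in> {l..r}" "x = cos t *\<^sub>R z + sin t *\<^sub>R b"
      "\<And>s. s \<in> {l..r} \<Longrightarrow> cos s *\<^sub>R z + sin s *\<^sub>R b \<noteq> \<gamma> T"
      using circle_arc_avoiding[OF card z x(1) False, of "\<gamma> T"] ze x(2) by metis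
    define c where "c s = cos s *\<^sub>R z + sin s *\<^sub>R b" for s
    define c' where "c' s = (- sin s) *\<^sub>R z + cos s *\<^sub>R b" for s
    have zz: "z \<bullet> z = 1" and bb: "b \<bullet> b = 1" using z b by (auto simp: dot_square_norm)
    have cs: "c s \<in> sphere 0 1" for s
    proof -
      have "c s \<bullet> c s = (cos s)\<^sup>2 + (sin s)\<^sup>2" unfolding c_def using b(1) zz bb inner_commute[of z b]
        by (simp add: inner_add_left inner_add_right power2_eq_square)
      then show ?thesis by (simp add: norm_eq_1)
    qed
    have cD: "c s \<in> Dn" for s using cs[of s] by auto
    have c'c: "c' s \<bullet> c s = 0" for s unfolding c_def c'_def using b(1) zz bb inner_commute[of z b]
      by (simp add: inner_add_left inner_add_right inner_diff_left)
    have dc: "(c has_vector_derivative c' s) (at s within {l..r})" for s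
      unfolding c_def[abs_def] c'_def has_vector_derivative_def by (auto intro!: derivative_eq_intros simp: algebra_simps)
    have ccont: "continuous_on {l..r} c" unfolding c_def[abs_def] by (intro continuous_intros)
    have ce: "c s \<noteq> \<gamma> T" if "s \<in> {l..r}" for s using b(7)[OF that] unfolding c_def .
    define f where "f s = \<sigma> (c s)" for s
    have fT: "f s \<in> {0<..T}" "f s \<in> {0..T}" for s using \<sigma>(1)[OF cs[of s]] unfolding f_def by auto
    have f0: "((\<lambda>s. f s) has_vector_derivative 0) (at s0 within {l..r})" if s0: "s0 \<in> {l..r}" for s0
    proof -
      define x0 where "x0 = c s0"
      have x0: "x0 \<in> sphere 0 1" "x0 \<noteq> \<gamma> T" "x0 \<in> Dn" unfolding x0_def using cs ce[OF s0] cD by auto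
      obtain k e where ke: "k > 0" "e > 0"
        "\<And>y a b. y \<in> Dn \<Longrightarrow> dist y x0 < e \<Longrightarrow> a \<in> {0..T} \<Longrightarrow> b \<in> {0..T} \<Longrightarrow> \<bar>a - f s0\<bar> < e \<Longrightarrow> \<bar>b - f s0\<bar> < e \<Longrightarrow>
          k * \<bar>b - a\<bar> \<le> \<bar>G.detour y b - G.detour y a\<bar>"
        using G.detour_local_lower_bound[OF fT(1) x0(1,2)] by metis
      \<comment> \<open>A cluster value \<open>w\<close> of \<open>f\<close> satisfies the detour
        equation at \<open>x0\<close> by continuity of the distances, and strict monotonicity of the
        detour leaves only \<open>f s0\<close>.\<close>
      have cont: "(f \<longlongrightarrow> f s0) (at s0 within {l..r})"
      proof -
        have "(\<lambda>n. f (X n)) \<longlonglongrightarrow> f s0" if X: "\<And>n. X n \<in> {l..r}" "X \<longlonglongrightarrow> s0" for X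
        proof (rule compact_LIMSEQ_unique_limit[of "{0..T}"])
          fix h :: "nat \<Rightarrow> nat" and w assume h: "strict_mono h" and w: "((\<lambda>n. f (X n)) \<circ> h) \<longlonglongrightarrow> w"
          have wT: "w \<in> {0..T}" by (rule closed_sequentially[OF _ _ w]) (use fT(2) in auto)
          have Xh: "(\<lambda>n. X (h n)) \<longlonglongrightarrow> s0" using LIMSEQ_subseq_LIMSEQ[OF X(2) h] by (simp add: o_def)
          have cX: "(\<lambda>n. c (X (h n))) \<longlonglongrightarrow> x0" unfolding x0_def
            by (rule continuous_on_tendsto_compose[OF ccont Xh s0]) (use X in auto)
          have w': "(\<lambda>n. f (X (h n))) \<longlonglongrightarrow> w" using w by (simp add: o_def)
          have gX: "(\<lambda>n. \<gamma> (f (X (h n)))) \<longlonglongrightarrow> \<gamma> w"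
            by (rule continuous_on_tendsto_compose[OF N.rgeodesicD(4)[OF G(1)] w' wT]) (use fT in auto)
          have gD: "\<gamma> (f s) \<in> Dn" for s by (rule G.\<gamma>_Dn[OF fT(2)])
          have "(\<lambda>n. f (X (h n)) + N.rdist (c (X (h n))) (\<gamma> (f (X (h n))))) \<longlonglongrightarrow> w + N.rdist x0 (\<gamma> w)"
            by (intro tendsto_add w' N.rdist_tendsto[OF cX gX]) (use cD gD x0 G.\<gamma>_Dn[OF wT] in auto)
          moreover have "f (X (h n)) + N.rdist (c (X (h n))) (\<gamma> (f (X (h n)))) = s1 + M.rdist (c (X (h n))) p" for n
            using \<sigma>(2)[OF cs[of "X (h n)"]] unfolding G.detour_def f_def by simp
          ultimately have "(\<lambda>n. s1 + M.rdist (c (X (h n))) p) \<longlonglongrightarrow> G.detour x0 w" unfolding G.detour_def by simp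
          moreover have "(\<lambda>n. s1 + M.rdist (c (X (h n))) p) \<longlonglongrightarrow> s1 + M.rdist x0 p"
            by (intro tendsto_add tendsto_const M.rdist_tendsto[OF cX tendsto_const]) (use cD x0 pD in auto)
          ultimately have "G.detour x0 w = s1 + M.rdist x0 p" using LIMSEQ_unique by blast
          then have eq: "G.detour x0 w = G.detour x0 (f s0)" using \<sigma>(2)[OF cs[of s0]] unfolding f_def x0_def by simp
          show "w = f s0"
            using G.detour_strict_mono[OF x0(1,2) wT fT(2)[of s0]] G.detour_strict_mono[OF x0(1,2) fT(2)[of s0] wT] eq
            by (cases w "f s0" rule: linorder_cases) auto
        qed (use fT in auto)
        then show ?thesis using continuous_within_sequentially[of s0 "{l..r}" f] unfolding continuous_within by (auto simp: o_def)
      qed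
      \<comment> \<open>The defect of the detour equation with the parameter frozen at
        \<open>f s0\<close>. It vanishes at \<open>s0\<close> together with its derivative, because
        the two distance functions have equal tangential gradients there.\<close>
      define m where "m s = s1 + M.rdist p (c s) - (f s0 + N.rdist (\<gamma> (f s0)) (c s))" for s
      have m0: "m s0 = 0"
        using \<sigma>(2)[OF cs[of s0]] M.rdist_sym[OF pD cD[of s0]] N.rdist_sym[OF cD[of s0] G.\<gamma>_Dn[OF fT(2)[of s0]]]
        unfolding m_def G.detour_def f_def by simp
      have gD: "\<gamma> (f s0) \<in> Dn" by (rule G.\<gamma>_Dn[OF fT(2)])
      have im: "c ` {l..r} \<subseteq> Dn" using cD by blast
      have d1: "((\<lambda>s. M.rdist p (c s)) has_derivative (\<lambda>h. - gip g1 x0 (M.udir x0 p) (h *\<^sub>R c' s0))) (at s0 within {l..r})"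
        unfolding x0_def
        by (rule has_derivative_in_compose[OF dc[unfolded has_vector_derivative_def] has_derivative_subset[OF M.rdist_has_derivative im]])
          (use pD cD ne[OF cs[of s0]] in auto)
      have d2: "((\<lambda>s. N.rdist (\<gamma> (f s0)) (c s)) has_derivative (\<lambda>h. - gip g2 x0 (N.udir x0 (\<gamma> (f s0))) (h *\<^sub>R c' s0))) (at s0 within {l..r})"
        unfolding x0_def
        by (rule has_derivative_in_compose[OF dc[unfolded has_vector_derivative_def] has_derivative_subset[OF N.rdist_has_derivative im]])
          (use gD cD \<sigma>(4)[OF cs[of s0]] f_def in auto)
      have gr: "gip g2 x0 (N.udir x0 (\<gamma> (f s0))) (h *\<^sub>R c' s0) = gip g1 x0 (M.udir x0 p) (h *\<^sub>R c' s0)" for h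
        using gip_bmap_tangent[OF x0(1), of "h *\<^sub>R c' s0" "M.udir x0 p"] \<sigma>(3)[OF x0(1)] c'c[of s0] unfolding f_def x0_def by simp
      have "(m has_derivative (\<lambda>h. 0)) (at s0 within {l..r})"
        unfolding m_def[abs_def] using d1 d2 unfolding gr by (auto intro!: derivative_eq_intros)
      then have dm: "((\<lambda>s. norm (m s - m s0) / norm (s - s0)) \<longlongrightarrow> 0) (at s0 within {l..r})"
        unfolding has_derivative_iff_norm by simp
      have ev1: "eventually (\<lambda>s. dist (f s) (f s0) < e) (at s0 within {l..r})" using tendstoD[OF cont ke(2)] .
      have "(c \<longlongrightarrow> x0) (at s0 within {l..r})" using ccont s0 unfolding continuous_on_def x0_def by blast
      then have ev2: "eventually (\<lambda>s. dist (c s) x0 < e) (at s0 within {l..r})" using tendstoD ke(2) by blast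
      \<comment> \<open>Freezing the parameter changes the detour by \<open>m s\<close>, and the
        local lower bound converts this into a bound on the change of parameter, so \<open>f\<close>
        inherits the zero derivative of \<open>m\<close>.\<close>
      have bound: "eventually (\<lambda>s. norm (norm (f s - f s0) / norm (s - s0)) \<le> (norm (m s - m s0) / norm (s - s0)) * (1 / k)) (at s0 within {l..r})"
        using ev1 ev2
      proof eventually_elim
        case (elim s)
        have "k * \<bar>f s - f s0\<bar> \<le> \<bar>G.detour (c s) (f s) - G.detour (c s) (f s0)\<bar>"
          by (rule ke(3)) (use elim fT cD ke in \<open>auto simp: dist_real_def\<close>)
        also have "G.detour (c s) (f s) - G.detour (c s) (f s0) = m s"
          using \<sigma>(2)[OF cs[of s]] M.rdist_sym[OF pD cD[of s]] N.rdist_sym[OF cD[of s] gD]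
          unfolding m_def f_def[of s, symmetric] G.detour_def by simp
        finally have "k * \<bar>f s - f s0\<bar> \<le> \<bar>m s - m s0\<bar>" using m0 by simp
        then have "\<bar>f s - f s0\<bar> \<le> \<bar>m s - m s0\<bar> * (1 / k)" using ke(1) by (simp add: field_simps)
        then have "\<bar>f s - f s0\<bar> / \<bar>s - s0\<bar> \<le> \<bar>m s - m s0\<bar> * (1 / k) / \<bar>s - s0\<bar>" by (rule divide_right_mono) simp
        then show ?case by (simp add: mult.commute)
      qed
      have "((\<lambda>s. (norm (m s - m s0) / norm (s - s0)) * (1 / k)) \<longlongrightarrow> 0) (at s0 within {l..r})"
        using tendsto_mult_right[OF dm, of "1 / k"] by simp
      from Lim_null_comparison[OF bound this]
      have "((\<lambda>s. norm (f s - f s0) / norm (s - s0)) \<longlongrightarrow> 0) (at s0 within {l..r})" .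
      then have "(f has_derivative (\<lambda>h. 0)) (at s0 within {l..r})"
        unfolding has_derivative_iff_norm by simp
      then show ?thesis unfolding has_vector_derivative_def by simp
    qed
    have "\<exists>a. \<forall>s\<in>{l..r}. f s = a"
      using has_vector_derivative_zero_constant[OF convex_real_interval(5) f0] by metis
    then have "f t = f 0" using b(4,5) by metis
    moreover have "c 0 = z" "c t = x" unfolding c_def using b(6) by auto
    ultimately show ?thesis using \<sigma>z unfolding f_def by simp
  qed (use \<sigma>z in simp)
  show ?thesis
  proof (rule that[of "\<gamma> T"])
    fix x assume x: "x \<in> sphere 0 1" "x \<noteq> \<gamma> T"
    have "flow_point g2 x (bmap g1 g2 x (M.udir x p)) (M.rdist x p) (\<gamma> s1)" using \<sigma>0[OF x(1)] const[OF x] by simp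
    then show "Psi x p = Psi z p"
      using N.flow_point_unique[OF flow_point_Psi[OF x(1) pD ne[OF x(1)]]] s1T(2) by simp
  qed
qed

end

section \<open>The isometry\<close>

lemma continuous_on_eq_on_cball:
  fixes f h :: "real^'n::finite \<Rightarrow> real"
  assumes "continuous_on Dn f" "continuous_on Dn h" "\<And>x. x \<in> ball 0 1 \<Longrightarrow> f x = h x" "x \<in> Dn"
  shows "f x = h x"
proof -
  have cl: "closure (ball 0 1) = (Dn :: (real^'n) set)" by (rule closure_ball) simp
  have "(\<lambda>x. f x - h x) x = 0"
    by (rule continuous_constant_on_closure[of "ball 0 1"]) (use assms in \<open>auto simp: cl intro!: continuous_on_diff\<close>)
  then show ?thesis by simp
qed

context simple_pair
begin

text \<open>Each base point leaves at most one exceptional boundary point. Among \<open>z\<close>,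
  \<open>- z\<close> and a unit vector orthogonal to \<open>z\<close> at least one avoids both
  exceptions and links the two base points.\<close>

lemma Psi_independent:
  assumes z: "z \<in> sphere 0 1" "z' \<in> sphere 0 1" and p: "p \<in> ball 0 1"
  shows "Psi z p = Psi z' p"
proof -
  obtain e where e: "\<And>x. x \<in> sphere 0 1 \<Longrightarrow> x \<noteq> e \<Longrightarrow> Psi x p = Psi z p" by (rule Psi_local_independence[OF z(1) p]) blast
  obtain e' where e': "\<And>x. x \<in> sphere 0 1 \<Longrightarrow> x \<noteq> e' \<Longrightarrow> Psi x p = Psi z' p" by (rule Psi_local_independence[OF z(2) p]) blast
  obtain y where y: "y \<noteq> 0" "orthogonal z y" using orthogonal_to_vector_exists[of z] card by auto
  define b where "b = (1 / norm y) *\<^sub>R y"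
  have b: "b \<in> sphere 0 1" "z \<bullet> b = 0" unfolding b_def using y by (auto simp: orthogonal_def)
  have zz: "z \<bullet> z = 1" using z(1) by (simp add: dot_square_norm)
  have "b \<noteq> z" "b \<noteq> - z" using b(2) zz by auto
  moreover have "z \<noteq> - z" using zz by (metis inner_minus_right neg_equal_zero zero_neq_one)
  moreover have "- z \<in> sphere 0 1" using z(1) by simp
  ultimately have "\<exists>x\<in>sphere 0 1. x \<noteq> e \<and> x \<noteq> e'" using z(1) b(1) by metis
  then show ?thesis using e e' by metis
qed

lemma Psi_smooth: assumes z: "z \<in> sphere 0 1" shows "sm_smooth_on Dn (Psi z)"
proof -
  have zD: "z \<in> Dn" using z by auto
  have 1: "sm_smooth_on Dn (\<lambda>p. bmap g1 g2 z (M.rlog z p))"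
    by (rule sm_smooth_on_compose[OF M.rlog_smooth[OF zD] sm_smooth_on_bounded_linear[of _ UNIV]])
      (auto intro: linear_bmap[unfolded linear_conv_bounded_linear])
  show ?thesis unfolding Psi_def[abs_def]
    by (rule sm_smooth_on_compose[OF 1 N.expm_smooth[OF zD]]) (use N.expm_eq(1)[OF flow_point_Psi_rlog[OF z]] in auto)
qed

lemma Psi_inverse:
  assumes z: "z \<in> sphere 0 1" and p: "p \<in> Dn" shows "simple_pair.Psi g2 g1 z (Psi z p) = p"
proof -
  interpret F: simple_pair g2 g1 by (rule flipped)
  have "z \<in> Dn" using z by auto
  then show ?thesis unfolding F.Psi_def rlog_Psi[OF z p] bmap_inverse[OF z] using M.expm_rlog p by simp
qed

text \<open>The inverse is the same construction with the metrics exchanged, hence smooth for the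
  same reason.\<close>

lemma Psi_diffeo: assumes z: "z \<in> sphere 0 1" shows "sm_diffeo (Psi z) Dn Dn"
proof -
  interpret F: simple_pair g2 g1 by (rule flipped)
  have inv: "F.Psi z (Psi z p) = p" "Psi z (F.Psi z p) = p" if "p \<in> Dn" for p
    using Psi_inverse[OF z that] F.Psi_inverse[OF z that] by auto
  have bij: "bij_betw (Psi z) Dn Dn"
    by (rule bij_betw_byWitness[where f'="F.Psi z"]) (use inv Psi_Dn[OF z] F.Psi_Dn[OF z] in auto)
  have "F.Psi z q = inv_into Dn (Psi z) q" if q: "q \<in> Dn" for q
    using inv_into_f_eq[OF bij_betw_imp_inj_on[OF bij] F.Psi_Dn[OF z q] inv(2)[OF q]] by simp
  then have "sm_smooth_on Dn (inv_into Dn (Psi z))" using F.Psi_smooth[OF z] by (rule sm_smooth_on_cong)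
  then show ?thesis unfolding sm_diffeo_def using bij Psi_smooth[OF z] by blast
qed

text \<open>\<open>Psi_independent\<close> concerns interior points, so the equality of distances to
  \<open>x\<close> is extended to the sphere by continuity and then evaluated at
  \<open>p = x\<close>.\<close>

lemma Psi_boundary: assumes z: "z \<in> sphere 0 1" and x: "x \<in> sphere 0 1" shows "Psi z x = x"
proof -
  have xD: "x \<in> Dn" using x by auto
  have "N.rdist x (Psi z x) = M.rdist x x"
  proof (rule continuous_on_eq_on_cball[where f="\<lambda>p. N.rdist x (Psi z p)", OF _ M.rdist_continuous[OF xD] _ xD])
    show "continuous_on Dn (\<lambda>p. N.rdist x (Psi z p))"
      by (rule continuous_on_compose2[OF N.rdist_continuous[OF xD] sm_smooth_on_imp_continuous_on[OF Psi_smooth[OF z]]])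
        (use Psi_Dn[OF z] in auto)
    show "N.rdist x (Psi z p) = M.rdist x p" if "p \<in> ball 0 1" for p
      unfolding Psi_independent[OF z x that] using rdist_Psi[OF x, of p] that by auto
  qed
  then show ?thesis using N.rdist_eq_0_iff[OF xD Psi_Dn[OF z xD]] xD by simp
qed

section \<open>The differential of the map is isometric\<close>

definition dPsi :: "real^'n \<Rightarrow> real^'n \<Rightarrow> real^'n \<Rightarrow> real^'n" where
  "dPsi z p = frechet_derivative (Psi z) (at p within Dn)"

lemma dPsi: "z \<in> sphere 0 1 \<Longrightarrow> p \<in> Dn \<Longrightarrow> (Psi z has_derivative dPsi z p) (at p within Dn)"
  unfolding dPsi_def by (rule sm_smooth_on_has_frechet_derivative[OF Psi_smooth])

text \<open>A unit vector at an interior point is the final velocity of a geodesic issuing from a boundary point \<open>y\<close>,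
  and \<open>Psi z = Psi y\<close> carries that geodesic to a unit speed geodesic.\<close>
lemma dPsi_unit:
  assumes z: "z \<in> sphere 0 1" and p: "p \<in> ball 0 1" and u: "gip g1 p u u = 1"
  shows "gip g2 (Psi z p) (dPsi z p u) (dPsi z p u) = 1"
proof -
  have pD: "p \<in> Dn" using p by auto
  have "gip g1 p (- u) (- u) = 1" using u by (simp add: gip_linear)
  then obtain y where y: "y \<in> sphere 0 1" "M.udir p y = - u" using M.geodesic_reaches_sphere[OF p] by metis
  have yD: "y \<in> Dn" and yp: "y \<noteq> p" using y(1) p by auto
  define d where "d = M.rdist y p"
  have d: "d > 0" unfolding d_def by (rule M.rdist_pos[OF yD pD yp])
  obtain c c' where C: "rgeodesic g1 c c' 0 d" "c 0 = y" "c d = p" "c' 0 = M.udir y p" "c' d = - M.udir p y"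
    "gip g1 (c 0) (c' 0) (c' 0) = 1"
    using M.unit_geodesic_exists[OF yD pD yp] unfolding d_def by metis
  obtain \<gamma> \<gamma>' where G: "rgeodesic g2 \<gamma> \<gamma>' 0 d" "\<gamma> 0 = y" "\<gamma>' 0 = bmap g1 g2 y (M.udir y p)" "\<gamma> d = Psi y p"
    using flow_point_Psi[OF y(1) pD yp] unfolding flow_point_def d_def by metis
  have eq: "Psi z (c t) = \<gamma> t" if t: "t \<in> {0<..d}" for t
  proof -
    have cD: "c t \<in> Dn" using M.rgeodesicD(2)[OF C(1)] t by auto
    have cb: "c t \<in> ball 0 1"
    proof (cases "t = d")
      case False
      have "c' t \<noteq> 0" using M.rgeodesic_constant_speed[OF C(1), of t 0] t d C(6) by auto
      then show ?thesis using M.geodesic_interior[OF C(1), of t] t False by auto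
    qed (use C p in simp)
    have "M.rdist y (c t) = t" "M.udir y (c t) = M.udir y p" "y \<noteq> c t"
      using M.unit_geodesic[OF C(1,6), of 0 t] t C(2,4) by auto
    then have "flow_point g2 y (bmap g1 g2 y (M.udir y p)) t (Psi y (c t))"
      using flow_point_Psi[OF y(1) cD] by simp
    moreover have "flow_point g2 y (bmap g1 g2 y (M.udir y p)) t (\<gamma> t)"
      using N.rgeodesic_flow_point[OF G(1), of 0 t 1] t G(2,3) by simp
    ultimately have "Psi y (c t) = \<gamma> t" by (rule N.flow_point_unique)
    then show ?thesis using Psi_independent[OF z y(1) cb] by simp
  qed
  \<comment> \<open>Half of the time interval is enough for a one-sided derivative at
    \<open>d\<close>, and it avoids the starting time, where \<open>c\<close> is on the sphere and
    \<open>eq\<close> does not apply.\<close>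
  have sub: "{d/2..d} \<subseteq> {0..d}" using d by auto
  have dc: "(c has_derivative (\<lambda>h. h *\<^sub>R u)) (at d within {d/2..d})"
    using has_vector_derivative_within_subset[OF M.rgeodesicD(3)[OF C(1), of d] sub] C(5) y(2) d unfolding has_vector_derivative_def by simp
  have "c ` {d/2..d} \<subseteq> Dn" using M.rgeodesicD(2)[OF C(1)] sub by blast
  then have "(Psi z has_derivative dPsi z p) (at (c d) within c ` {d/2..d})"
    using has_derivative_subset[OF dPsi[OF z pD]] C(3) by simp
  from has_derivative_in_compose[OF dc this]
  have "((\<lambda>t. Psi z (c t)) has_vector_derivative dPsi z p u) (at d within {d/2..d})"
    unfolding has_vector_derivative_def using linear_cmul[OF has_derivative_linear[OF dPsi[OF z pD]]] by simp
  then have "(\<gamma> has_vector_derivative dPsi z p u) (at d within {d/2..d})"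
    by (rule has_vector_derivative_transform[rotated 2]) (use eq d in auto)
  moreover have "(\<gamma> has_vector_derivative \<gamma>' d) (at d within {d/2..d})"
    using has_vector_derivative_within_subset[OF N.rgeodesicD(3)[OF G(1), of d] sub] d by simp
  ultimately have "dPsi z p u = \<gamma>' d"
    using vector_derivative_unique_within_closed_interval[of "d/2" d d, unfolded cbox_interval] d by auto
  moreover have "gip g2 (\<gamma> d) (\<gamma>' d) (\<gamma>' d) = gip g2 y (bmap g1 g2 y (M.udir y p)) (bmap g1 g2 y (M.udir y p))"
    using N.rgeodesic_constant_speed[OF G(1), of d 0] d G(2,3) by simp
  moreover have "\<dots> = 1" using gip_bmap[OF y(1)] M.udir_unit[OF yD pD yp] by simp
  moreover have "Psi z p = \<gamma> d" using eq[of d] d C(3) by simp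
  ultimately show ?thesis by simp
qed

text \<open>Homogeneity passes from unit vectors to all squared lengths, and polarisation with
  \<open>u + v\<close> recovers the inner product.\<close>

lemma dPsi_isometric_interior:
  assumes z: "z \<in> sphere 0 1" and p: "p \<in> ball 0 1"
  shows "gip g2 (Psi z p) (dPsi z p u) (dPsi z p v) = gip g1 p u v"
proof -
  have pD: "p \<in> Dn" using p by auto
  have PD: "Psi z p \<in> Dn" by (rule Psi_Dn[OF z pD])
  have lin: "linear (dPsi z p)" using dPsi[OF z pD] has_derivative_linear by blast
  have sq: "gip g2 (Psi z p) (dPsi z p w) (dPsi z p w) = gip g1 p w w" for w
  proof (cases "w = 0")
    case True then show ?thesis using linear_0[OF lin] by simp
  next
    case False
    define a where "a = sqrt (gip g1 p w w)"
    have a: "a > 0" "a * a = gip g1 p w w" unfolding a_def using M.gip_pos[OF pD False] by auto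
    have "gip g1 p ((1/a) *\<^sub>R w) ((1/a) *\<^sub>R w) = 1" using a(1) by (simp add: gip_linear a(2)[symmetric])
    from dPsi_unit[OF z p this] show ?thesis using a by (simp add: linear_cmul[OF lin] gip_linear field_simps)
  qed
  have "gip g2 (Psi z p) (dPsi z p (u + v)) (dPsi z p (u + v)) = gip g1 p (u + v) (u + v)" by (rule sq)
  then show ?thesis
    using sq[of u] sq[of v] M.gip_sym[OF pD, of v u] N.gip_sym[OF PD, of "dPsi z p v" "dPsi z p u"]
    by (simp add: linear_add[OF lin] gip_linear)
qed

text \<open>The derivative within the ball is continuous up to the sphere, so the interior identity
  extends.\<close>

lemma dPsi_isometric:
  assumes z: "z \<in> sphere 0 1" and p: "p \<in> Dn"
  shows "gip g1 p u v = gip g2 (Psi z p) (dPsi z p u) (dPsi z p v)"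
proof (rule continuous_on_eq_on_cball[OF _ _ _ p])
  show "continuous_on Dn (\<lambda>p. gip g1 p u v)"
    by (intro M.continuous_on_gip continuous_intros) auto
  have "continuous_on Dn (\<lambda>p. dPsi z p h)" for h
    unfolding dPsi_def by (rule sm_smooth_on_imp_continuous_on[OF sm_smooth_on_frechet_derivative[OF Psi_smooth[OF z] cone_set_Dn]])
  then show "continuous_on Dn (\<lambda>p. gip g2 (Psi z p) (dPsi z p u) (dPsi z p v))"
    by (intro N.continuous_on_gip sm_smooth_on_imp_continuous_on[OF Psi_smooth[OF z]] Psi_Dn[OF z])
qed (use dPsi_isometric_interior[OF z] in simp)

end

theorem theorem4p2:
  fixes g1 g2 :: "'n::finite rmetric"
  assumes "CARD('n) \<ge> 2"
    and "simple_metric g1" and "simple_metric g2"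
    and "same_boundary_metric g1 g2"
    and "\<forall>T>0. \<forall>v1 v2. broken_scattering g1 T v1 v2 = broken_scattering g2 T v1 v2"
  shows "\<exists>\<Psi>. riem_isometry g1 g2 \<Psi> \<and> (\<forall>x\<in>sphere 0 1. \<Psi> x = x)"
proof -
  interpret simple_pair g1 g2 by unfold_locales (use assms in auto)
  \<comment> \<open>Any boundary point serves, since the maps for different base points agree on the
    open ball.\<close>
  define z :: "real^'n" where "z = axis undefined 1"
  have z: "z \<in> sphere 0 1" unfolding z_def by (simp add: norm_axis_1)
  have "riem_isometry g1 g2 (Psi z)"
    unfolding riem_isometry_def using Psi_diffeo[OF z] dPsi_isometric[OF z] unfolding dPsi_def by blast
  then show ?thesis using Psi_boundary[OF z] by blast
qed

end
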